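(* Let $X$ be a real-valued quasi-left continuous semimartingale such that $|\Delta X|\le c$ for some $c>0$. Then for all $\lambda,a>0$ and each sign $\bullet\in\{+,-\}$, $$P\Big(\bullet(X_t-X_0-X^p_t)\ge a+\tfrac{\lambda e^{\lambda c}}{2}\langle X^m\rangle_t\ \text{ for some } t\ge0\Big)\le e^{-\lambda a}.$$
   Context: All processes live on a filtered probability space $(\Omega,\mathcal F,\mathbf F,P)$ satisfying the usual conditions. A semimartingale is a process $X=X_0+M+A$ with $X_0$ $\mathcal F_0$-measurable, $M$ a local martingale and $A$ of locally finite variation. $\Delta X=X-X_-$ is the jump process. $X$ is quasi-left continuous if $\Delta X_T=0$ a.s. on $\{T<\infty\}$ for every predictable time $T$. A semimartingale with bounded jumps is special, i.e. it can be written uniquely as $X=X_0+X^m+X^p$, where $X^p$ (the compensator of $X$) is predictable with locally finite variation and $X^p_0=0$, and $X^m$ is a local martingale with $X^m_0=0$. Under the hypotheses $X^m$ is locally square-integrable, and $\langle X^m\rangle$ denotes its predictable quadratic variation, i.e. the compensator of $(X^m)^2$. *)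

theory Defs
  imports "HOL-Probability.Probability"
begin

text \<open>
  Processes are functions \<open>X :: real \<Rightarrow> 'a \<Rightarrow> real\<close> of which only the values at times \<open>t \<ge> 0\<close> matter.
  Stopping times may take the value \<open>\<infinity>\<close>, so the filtration is indexed by \<^typ>\<open>ennreal\<close>,
  which is what the library notion \<^const>\<open>stopping_time\<close> needs. The additional
  \<open>\<sigma>\<close>-algebra \<open>F \<infinity>\<close> is arbitrary apart from monotonicity and influences none of the notions below:
  in \<^const>\<open>stopping_time\<close> the condition at \<open>\<infinity>\<close> is trivially true.

  Properties of paths, and equalities between processes, are required outside a single null set.
\<close>

locale usual_filtered_prob_space =
  prob_space M + filtration "space M" F
  for M :: "'a measure" and F :: "ennreal \<Rightarrow> 'a measure" +
  assumes sets_F_subset: "sets (F t) \<subseteq> sets M"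
    and complete_F_0: "N \<in> null_sets M \<Longrightarrow> B \<subseteq> N \<Longrightarrow> B \<in> sets (F 0)"
    and right_continuous_F: "t < \<infinity> \<Longrightarrow> sets (F t) = (\<Inter>s\<in>{t<..}. sets (F s))"

definition adapted :: "(ennreal \<Rightarrow> 'a measure) \<Rightarrow> (real \<Rightarrow> 'a \<Rightarrow> real) \<Rightarrow> bool" where
  "adapted F X \<longleftrightarrow> (\<forall>t\<ge>0. X t \<in> borel_measurable (F (ennreal t)))"

definition cadlag :: "(real \<Rightarrow> real) \<Rightarrow> bool" where
  "cadlag f \<longleftrightarrow>
     (\<forall>t\<ge>0. (f \<longlongrightarrow> f t) (at_right t)) \<and> (\<forall>t>0. \<exists>l. (f \<longlongrightarrow> l) (at_left t))"

text \<open>The convention is \<open>X\<^bsub>0-\<^esub> = X\<^sub>0\<close>, so that there is no jump at time \<open>0\<close>.\<close>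

definition left_limit :: "(real \<Rightarrow> real) \<Rightarrow> real \<Rightarrow> real" where
  "left_limit f t = (if t \<le> 0 then f 0 else Lim (at_left t) f)"

definition jump :: "(real \<Rightarrow> 'a \<Rightarrow> real) \<Rightarrow> real \<Rightarrow> 'a \<Rightarrow> real" where
  "jump X t \<omega> = X t \<omega> - left_limit (\<lambda>s. X s \<omega>) t"

definition stopped :: "(real \<Rightarrow> 'a \<Rightarrow> real) \<Rightarrow> ('a \<Rightarrow> ennreal) \<Rightarrow> real \<Rightarrow> 'a \<Rightarrow> real" where
  "stopped X T t \<omega> = X (enn2real (min (ennreal t) (T \<omega>))) \<omega>"

definition martingale ::
  "'a measure \<Rightarrow> (ennreal \<Rightarrow> 'a measure) \<Rightarrow> (real \<Rightarrow> 'a \<Rightarrow> real) \<Rightarrow> bool" where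
  "martingale M F X \<longleftrightarrow>
     adapted F X \<and> (AE \<omega> in M. cadlag (\<lambda>t. X t \<omega>)) \<and>
     (\<forall>t\<ge>0. integrable M (X t)) \<and>
     (\<forall>s\<ge>0. \<forall>t\<ge>s. AE \<omega> in M. real_cond_exp M (F (ennreal s)) (X t) \<omega> = X s \<omega>)"

definition local_martingale ::
  "'a measure \<Rightarrow> (ennreal \<Rightarrow> 'a measure) \<Rightarrow> (real \<Rightarrow> 'a \<Rightarrow> real) \<Rightarrow> bool" where
  "local_martingale M F X \<longleftrightarrow>
     adapted F X \<and> (AE \<omega> in M. cadlag (\<lambda>t. X t \<omega>)) \<and>
     (\<exists>T :: nat \<Rightarrow> 'a \<Rightarrow> ennreal.
        (\<forall>n. stopping_time F (T n)) \<and>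
        (AE \<omega> in M. incseq (\<lambda>n. T n \<omega>) \<and> (\<lambda>n. T n \<omega>) \<longlonglongrightarrow> \<infinity>) \<and>
        (\<forall>n. martingale M F (stopped X (T n))))"

definition finite_variation_on :: "(real \<Rightarrow> real) \<Rightarrow> real \<Rightarrow> real \<Rightarrow> bool" where
  "finite_variation_on f a b \<longleftrightarrow>
     (\<exists>B. \<forall>n. \<forall>s :: nat \<Rightarrow> real. mono s \<and> range s \<subseteq> {a..b} \<longrightarrow>
        (\<Sum>i<n. \<bar>f (s (Suc i)) - f (s i)\<bar>) \<le> B)"

definition locally_finite_variation ::
  "'a measure \<Rightarrow> (ennreal \<Rightarrow> 'a measure) \<Rightarrow> (real \<Rightarrow> 'a \<Rightarrow> real) \<Rightarrow> bool" where
  "locally_finite_variation M F A \<longleftrightarrow>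
     adapted F A \<and> (AE \<omega> in M. cadlag (\<lambda>t. A t \<omega>)) \<and>
     (AE \<omega> in M. \<forall>t\<ge>0. finite_variation_on (\<lambda>s. A s \<omega>) 0 t)"

definition semimartingale ::
  "'a measure \<Rightarrow> (ennreal \<Rightarrow> 'a measure) \<Rightarrow> (real \<Rightarrow> 'a \<Rightarrow> real) \<Rightarrow> bool" where
  "semimartingale M F X \<longleftrightarrow>
     X 0 \<in> borel_measurable (F 0) \<and>
     (\<exists>N A. local_martingale M F N \<and> locally_finite_variation M F A \<and>
        (AE \<omega> in M. \<forall>t\<ge>0. X t \<omega> = X 0 \<omega> + N t \<omega> + A t \<omega>))"

definition predictable_sigma :: "(ennreal \<Rightarrow> 'a measure) \<Rightarrow> (real \<times> 'a) measure" where
  "predictable_sigma F = sigma ({0..} \<times> space (F 0))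
     ({{0} \<times> B | B. B \<in> sets (F 0)} \<union>
      {{s<..t} \<times> B | s t B. 0 \<le> s \<and> s \<le> t \<and> B \<in> sets (F (ennreal s))})"

definition predictable :: "(ennreal \<Rightarrow> 'a measure) \<Rightarrow> (real \<Rightarrow> 'a \<Rightarrow> real) \<Rightarrow> bool" where
  "predictable F X \<longleftrightarrow> (\<lambda>(t, \<omega>). X t \<omega>) \<in> borel_measurable (predictable_sigma F)"

text \<open>
  A time \<open>T\<close> is predictable if the stochastic interval \<open>[0, T)\<close> is a predictable set;
  such a \<open>T\<close> is automatically a stopping time.
\<close>

definition predictable_time :: "(ennreal \<Rightarrow> 'a measure) \<Rightarrow> ('a \<Rightarrow> ennreal) \<Rightarrow> bool" where
  "predictable_time F T \<longleftrightarrow>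
     {(t, \<omega>). 0 \<le> t \<and> \<omega> \<in> space (F 0) \<and> ennreal t < T \<omega>} \<in> sets (predictable_sigma F)"

definition quasi_left_continuous ::
  "'a measure \<Rightarrow> (ennreal \<Rightarrow> 'a measure) \<Rightarrow> (real \<Rightarrow> 'a \<Rightarrow> real) \<Rightarrow> bool" where
  "quasi_left_continuous M F X \<longleftrightarrow>
     (\<forall>T. predictable_time F T \<longrightarrow>
        (AE \<omega> in M. T \<omega> < \<infinity> \<longrightarrow> jump X (enn2real (T \<omega>)) \<omega> = 0))"

definition martingale_part ::
  "(real \<Rightarrow> 'a \<Rightarrow> real) \<Rightarrow> (real \<Rightarrow> 'a \<Rightarrow> real) \<Rightarrow> real \<Rightarrow> 'a \<Rightarrow> real" where
  "martingale_part X A t \<omega> = X t \<omega> - X 0 \<omega> - A t \<omega>"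

text \<open>
  Compensators are unique only up to indistinguishability, so \<open>A\<close> being the compensator of \<open>X\<close> is a
  relation, and likewise for the predictable quadratic variation.
\<close>

definition compensator ::
  "'a measure \<Rightarrow> (ennreal \<Rightarrow> 'a measure) \<Rightarrow> (real \<Rightarrow> 'a \<Rightarrow> real) \<Rightarrow> (real \<Rightarrow> 'a \<Rightarrow> real) \<Rightarrow> bool"
where
  "compensator M F X A \<longleftrightarrow>
     predictable F A \<and> locally_finite_variation M F A \<and> (AE \<omega> in M. A 0 \<omega> = 0) \<and>
     local_martingale M F (martingale_part X A)"

definition predictable_quadratic_variation ::
  "'a measure \<Rightarrow> (ennreal \<Rightarrow> 'a measure) \<Rightarrow> (real \<Rightarrow> 'a \<Rightarrow> real) \<Rightarrow> (real \<Rightarrow> 'a \<Rightarrow> real) \<Rightarrow> bool"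
where
  "predictable_quadratic_variation M F N Q \<longleftrightarrow> compensator M F (\<lambda>t \<omega>. (N t \<omega>)\<^sup>2) Q"

text \<open>
  An event \<open>{\<omega>. \<exists>t\<ge>0. \<dots>}\<close> defined by an uncountable quantifier over time is measurable only by the
  measurable projection theorem, which rests on completeness, and \<^const>\<open>emeasure\<close> vanishes by
  convention on non-measurable sets. The probability of such an event is therefore bounded through
  \<^const>\<open>outer_measure_of\<close>, which always dominates \<^const>\<open>emeasure\<close> and agrees with it
  on measurable sets.
\<close>

end

theory Submission
  imports Defs
begin

text \<open>
  Write \<open>N\<close> for the martingale part \<open>X - X\<^sub>0 - X\<^sup>p\<close>, \<open>Q\<close> for its predictable quadratic variation and
  \<open>L = N\<^sup>2 - N\<^sub>0\<^sup>2 - Q\<close>, a local martingale. With \<open>\<mu> = \<epsilon>\<lambda>\<close> and \<open>K = \<lambda>\<^sup>2 e\<^bsup>\<lambda>c\<^esup> / 2\<close> the event says that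
  \<open>W = \<mu>N - KQ\<close> reaches \<open>\<lambda>a\<close>. Everything rests on \<open>E e\<^bsup>W(S)\<^esup> \<le> 1\<close> for bounded stopping times \<open>S\<close> up to
  which \<open>N\<close> and \<open>Q\<close> are bounded: stopping \<open>W\<close> when it first exceeds \<open>b < \<lambda>a\<close> and using Markov's inequality
  bounds the probability that this ever happens by \<open>e\<^bsup>-b\<^esup>\<close>, and \<open>b\<close> may increase to \<open>\<lambda>a\<close>
  (\<open>exponential_maximal_inequality\<close>).

  The bound \<open>E e\<^bsup>W(S)\<^esup> \<le> 1\<close> (\<open>exponential_bound\<close>) is obtained without stochastic integration, by summing over a
  fine time grid. Let \<open>d\<close> and \<open>e\<close> be the increments of \<open>N\<close> and \<open>Q\<close> over one cell. As long as \<open>\<bar>d\<bar>\<close> does not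
  exceed \<open>c\<close> by much, Taylor's formula gives
  \<open>e\<^bsup>\<mu>d - Ke\<^esup> - 1 \<le> \<mu>d + K(d\<^sup>2 - e)\<close> up to a multiple of \<open>\<theta>d\<^sup>2 + e\<^sup>2/\<theta>\<close>, where \<open>\<theta>\<close> is small. The terms \<open>d\<close>
  and \<open>d\<^sup>2 - e\<close> (the increment of \<open>L\<close> minus \<open>2Nd\<close>) have expectation zero against every bounded weight that is
  known at the beginning of the cell. The sum of the \<open>d\<^sup>2\<close> has bounded expectation, and the sum of the \<open>e\<^sup>2\<close>
  vanishes in the limit because \<open>Q\<close> is continuous and has finite variation. On the paths for which the grid is
  still too coarse the sum is frozen after the first bad cell; the probability of these paths tends to zero.

  This uses that \<open>\<bar>\<Delta>N\<bar> \<le> c\<close> and \<open>\<Delta>Q = 0\<close>, and here quasi-left continuity enters. The first jump of a given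
  size of a predictable process happens at a predictable time \<open>T\<close>. There \<open>X\<close> does not jump, so
  \<open>\<Delta>X\<^sup>p = - \<Delta>N\<close> at \<open>T\<close>. The jump of a martingale at a predictable time has expectation zero, hence it cannot
  have a strict sign, and \<open>X\<^sup>p\<close> is continuous. So \<open>\<Delta>N = \<Delta>X\<close>, thus \<open>\<Delta>Q = - \<Delta>L\<close> at predictable times, and the
  same argument shows that \<open>Q\<close> is continuous (\<open>predictable_no_jumps\<close>).

  That martingale jumps at \<open>T\<close> are centred follows from optional stopping once \<open>T\<close> is announced by stopping times
  that increase to it strictly from below. Up to an event of small probability such times come from a
  regularity argument (\<open>predictable_regularity\<close>, \<open>predictable_time_announced\<close>): with respect to the
  distribution of \<open>(T(\<omega>), \<omega>)\<close>, the complement of the graph of \<open>T\<close> is approximated from outside by a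
  set \<open>{g > 0}\<close> with \<open>g\<close> continuous and adapted, and the first times at which \<open>g\<close> falls below \<open>1/n\<close> announce \<open>T\<close>.

  Optional stopping in continuous time (\<open>optional_stopping\<close>) is the limit of the trivial case of finitely many
  values. Uniform integrability is expressed by the excesses \<open>E (\<bar>Y\<bar> - R)\<^sup>+\<close>: they increase along a martingale,
  because \<open>x \<mapsto> (\<bar>x\<bar> - R)\<^sup>+\<close> is convex, so one bound serves all approximating times.
\<close>

section \<open>Jumps of right-continuous paths with left limits\<close>

lemma cadlag_uminus: "cadlag f \<Longrightarrow> cadlag (\<lambda>t. - f t)"
  unfolding cadlag_def by (metis tendsto_minus)

lemma left_limit_tendsto:
  assumes "cadlag f" "t > 0"
  shows "(f \<longlongrightarrow> left_limit f t) (at_left t)"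
proof -
  obtain l where "(f \<longlongrightarrow> l) (at_left t)" using assms by (auto simp: cadlag_def)
  then show ?thesis using assms(2) tendsto_Lim[of "at_left t" f l]
    by (simp add: left_limit_def)
qed

lemma left_limit_eqI:
  assumes "t > 0" "(f \<longlongrightarrow> l) (at_left t)"
  shows "left_limit f t = l"
  using assms tendsto_Lim[of "at_left t" f l] by (simp add: left_limit_def)

lemma left_limit_uminus:
  assumes "cadlag f"
  shows "left_limit (\<lambda>t. - f t) t = - left_limit f t"
proof (cases "t > 0")
  case True
  show ?thesis
    by (rule left_limit_eqI[OF True]) (intro tendsto_minus left_limit_tendsto assms True)
qed (simp add: left_limit_def)

lemma cadlag_right_continuous:
  assumes "cadlag f" "t \<ge> 0"
  shows "continuous (at t within {t..}) f"
  using assms unfolding cadlag_def continuous_within at_within_Ici_at_right by auto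

lemma cadlag_tendsto_right:
  assumes "cadlag f" "t \<ge> 0" "(x \<longlongrightarrow> t) G" "eventually (\<lambda>k. x k \<ge> t) G"
  shows "((\<lambda>k. f (x k)) \<longlongrightarrow> f t) G"
  by (rule continuous_within_tendsto_compose[OF cadlag_right_continuous[OF assms(1,2)]])
     (use assms in auto)

lemma cadlag_tendsto_left:
  assumes "cadlag f" "t > 0" "(x \<longlongrightarrow> t) G" "eventually (\<lambda>k. x k < t) G"
  shows "((\<lambda>k. f (x k)) \<longlongrightarrow> left_limit f t) G"
proof -
  have "filterlim x (at_left t) G"
    unfolding filterlim_at using assms by (auto elim: eventually_mono)
  then show ?thesis
    using left_limit_tendsto[OF assms(1,2)] filterlim_compose by blast
qed

text \<open>
  If the increments over \<open>[p k, q k]\<close> stay positive while both end points tend to \<open>s\<close>, then \<open>s\<close> must eventually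
  separate them: on either side alone the one-sided limit of \<open>f\<close> would make the increments vanish.
\<close>

lemma jump_at_limit_of_increments:
  assumes f: "cadlag f"
    and p: "\<And>k. 0 \<le> p k" "\<And>k. p k \<le> q k" "p \<longlonglongrightarrow> s" "q \<longlonglongrightarrow> s"
    and e: "\<And>k. e k \<le> f (q k) - f (p k)" "e \<longlonglongrightarrow> d" "d > 0"
  shows "s > 0" "d \<le> f s - left_limit f s"
proof -
  have s0: "s \<ge> 0"
    using p(1,3) by (intro LIMSEQ_le_const[OF p(3)]) auto
  have no_right: "eventually (\<lambda>k. p k < s) sequentially"
  proof (rule ccontr)
    assume "\<not> ?thesis"
    then have fr: "frequently (\<lambda>k. p k \<ge> s) sequentially"
      by (simp add: not_eventually not_less)
    define G where "G = inf sequentially (principal {k. p k \<ge> s})"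
    have G: "G \<noteq> bot"
      using fr unfolding G_def by (auto simp: trivial_limit_def eventually_inf_principal frequently_def)
    have le: "G \<le> sequentially" by (simp add: G_def)
    have ev: "eventually (\<lambda>k. p k \<ge> s) G" by (simp add: G_def eventually_inf_principal)
    have ev': "eventually (\<lambda>k. q k \<ge> s) G" by (rule eventually_mono[OF ev]) (use p(2) order_trans in blast)
    have "((\<lambda>k. f (q k) - f (p k)) \<longlongrightarrow> f s - f s) G"
      by (intro tendsto_diff cadlag_tendsto_right[OF f s0] ev ev' tendsto_mono[OF le] p)
    from tendsto_le[OF G this tendsto_mono[OF le e(2)] always_eventually] e(1)
    have "d \<le> f s - f s" by blast
    with e(3) show False by simp
  qed
  then obtain k where "p k < s" by (metis eventually_happens' sequentially_bot)
  with p(1) show s: "s > 0" using le_less_trans by blast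
  have pl: "(\<lambda>k. f (p k)) \<longlonglongrightarrow> left_limit f s"
    by (rule cadlag_tendsto_left[OF f s p(3) no_right])
  have no_left: "eventually (\<lambda>k. q k \<ge> s) sequentially"
  proof (rule ccontr)
    assume "\<not> ?thesis"
    then have fr: "frequently (\<lambda>k. q k < s) sequentially"
      by (simp add: not_eventually not_le)
    define G where "G = inf sequentially (principal {k. q k < s})"
    have G: "G \<noteq> bot"
      using fr unfolding G_def by (auto simp: trivial_limit_def eventually_inf_principal frequently_def)
    have le: "G \<le> sequentially" by (simp add: G_def)
    have ev: "eventually (\<lambda>k. q k < s) G" by (simp add: G_def eventually_inf_principal)
    have "((\<lambda>k. f (q k) - f (p k)) \<longlongrightarrow> left_limit f s - left_limit f s) G"
      by (intro tendsto_diff cadlag_tendsto_left[OF f s] ev tendsto_mono[OF le] p pl)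
    from tendsto_le[OF G this tendsto_mono[OF le e(2)] always_eventually] e(1)
    have "d \<le> left_limit f s - left_limit f s" by blast
    with e(3) show False by simp
  qed
  have "(\<lambda>k. f (q k) - f (p k)) \<longlonglongrightarrow> f s - left_limit f s"
    by (intro tendsto_diff pl cadlag_tendsto_right[OF f s0] no_left p)
  then show "d \<le> f s - left_limit f s"
    by (rule LIMSEQ_le[OF e(2)]) (use e(1) in auto)
qed

lemma tendsto_inverse_Suc: "(\<lambda>k. 1 / real (Suc k)) \<longlonglongrightarrow> 0"
  using LIMSEQ_inverse_real_of_nat by (simp add: inverse_eq_divide)

text \<open>
  Compactness of \<open>[0, r]\<close> supplies the limit point needed in \<open>jump_at_limit_of_increments\<close>.
\<close>

lemma jump_of_close_increments:
  assumes f: "cadlag f" and d: "d > 0"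
    and ex: "\<And>k::nat. \<exists>p q. 0 \<le> p \<and> p \<le> q \<and> q \<le> r \<and> q - p \<le> 1 / real (Suc k) \<and>
               d - 1 / real (Suc k) \<le> f q - f p"
  shows "\<exists>s. 0 < s \<and> s \<le> r \<and> d \<le> f s - left_limit f s"
proof -
  from ex obtain p q where pq: "\<And>k. 0 \<le> p k" "\<And>k. p k \<le> q k" "\<And>k. q k \<le> r"
    "\<And>k::nat. q k - p k \<le> 1 / real (Suc k)" "\<And>k. d - 1 / real (Suc k) \<le> f (q k) - f (p k)"
    by metis
  have "\<exists>l\<in>{0..r}. \<exists>\<rho>. strict_mono \<rho> \<and> (p \<circ> \<rho>) \<longlonglongrightarrow> l"
  proof (rule seq_compactE)
    show "seq_compact {0..r}" using compact_imp_seq_compact[OF compact_Icc] .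
    show "\<forall>n. p n \<in> {0..r}" using pq(1-3) order_trans by fastforce
  qed blast
  then obtain s \<rho> where s: "s \<in> {0..r}" "strict_mono \<rho>" "(p \<circ> \<rho>) \<longlonglongrightarrow> s" by blast
  have z: "(\<lambda>k. 1 / real (Suc (\<rho> k))) \<longlonglongrightarrow> 0"
    using LIMSEQ_subseq_LIMSEQ[OF tendsto_inverse_Suc s(2)] by (simp add: o_def)
  have "(\<lambda>k. q (\<rho> k) - p (\<rho> k)) \<longlonglongrightarrow> 0"
    by (rule tendsto_sandwich[OF _ _ tendsto_const z]) (use pq in auto)
  from tendsto_add[OF this s(3)] have q: "(\<lambda>k. q (\<rho> k)) \<longlonglongrightarrow> s" by (simp add: o_def)
  have e: "(\<lambda>k. d - 1 / real (Suc (\<rho> k))) \<longlonglongrightarrow> d" using tendsto_diff[OF tendsto_const z, of d] by simp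
  have p': "(\<lambda>k. p (\<rho> k)) \<longlonglongrightarrow> s" using s(3) by (simp add: o_def)
  note J = jump_at_limit_of_increments[OF f pq(1) pq(2) p' q pq(5) e d]
  show ?thesis using J s(1) by auto
qed

text \<open>
  A right-continuous path with left limits need not be uniformly continuous, but over short intervals it rises
  by little more than its largest upward jump.
\<close>

lemma increments_le_of_jumps_le:
  assumes f: "cadlag f" and c: "0 \<le> c" "c < c'"
    and j: "\<And>t. 0 < t \<Longrightarrow> t \<le> u \<Longrightarrow> f t - left_limit f t \<le> c"
  shows "\<exists>h>0. \<forall>p q. 0 \<le> p \<longrightarrow> p \<le> q \<longrightarrow> q \<le> u \<longrightarrow> q - p \<le> h \<longrightarrow> f q - f p \<le> c'"
proof (rule ccontr)
  assume neg: "\<not> ?thesis"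
  have "\<exists>s. 0 < s \<and> s \<le> u \<and> c' \<le> f s - left_limit f s"
  proof (rule jump_of_close_increments[OF f])
    fix k :: nat
    have "0 < 1 / real (Suc k)" by simp
    with neg obtain p q where "0 \<le> p" "p \<le> q" "q \<le> u" "q - p \<le> 1 / real (Suc k)" "\<not> f q - f p \<le> c'"
      by meson
    moreover have "c' - 1 / real (Suc k) \<le> c'" by simp
    ultimately show "\<exists>p q. 0 \<le> p \<and> p \<le> q \<and> q \<le> u \<and> q - p \<le> 1 / real (Suc k) \<and>
               c' - 1 / real (Suc k) \<le> f q - f p" by (meson linear order_trans)
  qed (use c in auto)
  with j c show False by fastforce
qed

lemma abs_increments_le_of_jumps_le:
  assumes f: "cadlag f" and c: "0 \<le> c" "c < c'"
    and j: "\<And>t. 0 < t \<Longrightarrow> t \<le> u \<Longrightarrow> \<bar>f t - left_limit f t\<bar> \<le> c"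
  shows "\<exists>h>0. \<forall>p q. 0 \<le> p \<longrightarrow> p \<le> q \<longrightarrow> q \<le> u \<longrightarrow> q - p \<le> h \<longrightarrow> \<bar>f q - f p\<bar> \<le> c'"
proof -
  obtain h where h: "h > 0" "\<And>p q. 0 \<le> p \<Longrightarrow> p \<le> q \<Longrightarrow> q \<le> u \<Longrightarrow> q - p \<le> h \<Longrightarrow> f q - f p \<le> c'"
    using increments_le_of_jumps_le[OF f c, of u] abs_le_D1[OF j] by blast
  obtain h' where h': "h' > 0" "\<And>p q. 0 \<le> p \<Longrightarrow> p \<le> q \<Longrightarrow> q \<le> u \<Longrightarrow> q - p \<le> h' \<Longrightarrow> - f q - - f p \<le> c'"
    using increments_le_of_jumps_le[OF cadlag_uminus[OF f] c, of u] abs_le_D2[OF j]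
    unfolding left_limit_uminus[OF f] by auto
  show ?thesis
  proof (intro exI[of _ "min h h'"] conjI allI impI)
    fix p q assume "0 \<le> p" "p \<le> q" "q \<le> u" "q - p \<le> min h h'"
    then show "\<bar>f q - f p\<bar> \<le> c'" using h(2)[of p q] h'(2)[of p q] by auto
  qed (use h(1) h'(1) in auto)
qed

lemma jump_near_increment:
  assumes f: "cadlag f" and t: "0 < t" and e: "e > 0"
  shows "\<exists>p0<t. \<forall>p. p0 < p \<longrightarrow> p < t \<longrightarrow> \<bar>f p - left_limit f t\<bar> < e"
  using order_tendstoD[OF left_limit_tendsto[OF f t]] tendstoD[OF left_limit_tendsto[OF f t] e]
  unfolding eventually_at_left_field dist_real_def by blast

text \<open>
  This turns the existence of a large jump before time \<open>r\<close> into a countable condition on the values of the path up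
  to time \<open>r\<close>, which makes the time of the first large jump a stopping time. The end point \<open>r\<close> is included among
  the sampling points, since a jump at \<open>r\<close> itself could otherwise be detected only after \<open>r\<close>.
\<close>

lemma exists_jump_iff:
  assumes f: "cadlag f" and d: "d > 0" and r: "r \<ge> 0"
  shows "(\<exists>t. 0 < t \<and> t \<le> r \<and> d \<le> f t - left_limit f t) \<longleftrightarrow>
    (\<forall>k::nat. \<exists>p\<in>insert r (\<rat> \<inter> {0..r}). \<exists>q\<in>insert r (\<rat> \<inter> {0..r}).
       p \<le> q \<and> q - p \<le> 1 / real (Suc k) \<and> d - 1 / real (Suc k) \<le> f q - f p)"
    (is "?L \<longleftrightarrow> ?R")
proof
  assume ?L
  then obtain t where t: "0 < t" "t \<le> r" "d \<le> f t - left_limit f t" by auto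
  show ?R
  proof
    fix k :: nat
    define e where "e = 1 / (2 * real (Suc k))"
    have e: "e > 0" "1 / real (Suc k) = e + e" by (auto simp: e_def field_simps)
    obtain p0 where p0: "p0 < t" "\<And>p. p0 < p \<Longrightarrow> p < t \<Longrightarrow> \<bar>f p - left_limit f t\<bar> < e"
      using jump_near_increment[OF f t(1) e(1)] by blast
    have "max p0 (max 0 (t - e)) < t" using p0(1) t(1) e by auto
    then obtain p where p: "p \<in> \<rat>" "max p0 (max 0 (t - e)) < p" "p < t"
      using Rats_dense_in_real by blast
    have "\<exists>q\<in>insert r (\<rat> \<inter> {0..r}). t \<le> q \<and> q \<le> t + e \<and> \<bar>f q - f t\<bar> \<le> e"
    proof (cases "t = r")
      case True
      then show ?thesis using e t(1) by (intro bexI[of _ r]) auto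
    next
      case False
      have "(f \<longlongrightarrow> f t) (at_right t)" using f t(1) by (auto simp: cadlag_def)
      from tendstoD[OF this e(1)] obtain q0 where q0: "q0 > t" "\<And>q. t < q \<Longrightarrow> q < q0 \<Longrightarrow> \<bar>f q - f t\<bar> < e"
        unfolding eventually_at_right_field dist_real_def by blast
      have "t < min q0 (min r (t + e))" using q0(1) t(2) False e by auto
      then obtain q where "q \<in> \<rat>" "t < q" "q < min q0 (min r (t + e))"
        using Rats_dense_in_real by blast
      then show ?thesis using q0(2)[of q] t(1) by (intro bexI[of _ q]) auto
    qed
    then obtain q where q: "q\<in>insert r (\<rat> \<inter> {0..r})" "t \<le> q" "q \<le> t + e" "\<bar>f q - f t\<bar> \<le> e" by blast
    have "p\<in>insert r (\<rat> \<inter> {0..r})" "p \<le> q" "q - p \<le> 1 / real (Suc k)" using p q t(2) unfolding e(2) by auto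
    moreover have "d - 1 / real (Suc k) \<le> f q - f p"
      using p0(2)[of p] p q(4) t(3) unfolding e(2) by linarith
    ultimately show "\<exists>p\<in>insert r (\<rat> \<inter> {0..r}). \<exists>q\<in>insert r (\<rat> \<inter> {0..r}).
       p \<le> q \<and> q - p \<le> 1 / real (Suc k) \<and> d - 1 / real (Suc k) \<le> f q - f p" using q(1) by blast
  qed
next
  assume R: ?R
  show ?L
  proof (rule jump_of_close_increments[OF f d])
    fix k :: nat
    from R obtain p q where "p\<in>insert r (\<rat> \<inter> {0..r})" "q\<in>insert r (\<rat> \<inter> {0..r})"
       "p \<le> q" "q - p \<le> 1 / real (Suc k)" "d - 1 / real (Suc k) \<le> f q - f p" by blast
    then show "\<exists>p q. 0 \<le> p \<and> p \<le> q \<and> q \<le> r \<and> q - p \<le> 1 / real (Suc k) \<and>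
               d - 1 / real (Suc k) \<le> f q - f p"
      using r by (intro exI[of _ p] exI[of _ q]) auto
  qed
qed

text \<open>
  Jumps of size at least \<open>d\<close> cannot accumulate.
\<close>

lemma first_jump_attained:
  assumes f: "cadlag f" and d: "d > 0"
    and J: "J = {t. 0 < t \<and> d \<le> f t - left_limit f t}" "J \<noteq> {}"
  shows "Inf J \<in> J"
proof -
  have bdd: "bdd_below J" unfolding J by (intro bdd_belowI[of _ 0]) auto
  have "\<exists>p q. 0 \<le> p \<and> p \<le> q \<and> Inf J \<le> q \<and> q \<le> Inf J + 1 / real (Suc k) \<and> q - p \<le> 1 / real (Suc k) \<and>
               d - 1 / real (Suc k) \<le> f q - f p" for k :: nat
  proof -
    have "Inf J < Inf J + 1 / real (Suc k)" by simp
    then obtain t where t: "t \<in> J" "t < Inf J + 1 / real (Suc k)"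
      using cInf_lessD[OF J(2)] by blast
    then have tJ: "0 < t" "d \<le> f t - left_limit f t" by (auto simp: J)
    define e where "e = 1 / real (Suc k)"
    have e: "e > 0" by (simp add: e_def)
    obtain p0 where p0: "p0 < t" "\<And>p. p0 < p \<Longrightarrow> p < t \<Longrightarrow> \<bar>f p - left_limit f t\<bar> < e"
      using jump_near_increment[OF f tJ(1) e(1)] by blast
    have "max p0 (max 0 (t - e)) < t" using p0(1) tJ(1) e by auto
    then obtain p where p: "max p0 (max 0 (t - e)) < p" "p < t"
      using dense by blast
    have "0 \<le> p" "p \<le> t" "t - p \<le> 1 / real (Suc k)" "d - 1 / real (Suc k) \<le> f t - f p"
      using p0(2)[of p] p tJ(2) unfolding e_def[symmetric] by auto
    moreover have "Inf J \<le> t" using t(1) bdd by (rule cInf_lower)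
    ultimately show ?thesis using t(2) by (intro exI[of _ p] exI[of _ t]) auto
  qed
  then obtain p q where pq: "\<And>k. 0 \<le> p k" "\<And>k. p k \<le> q k" "\<And>k. Inf J \<le> q k"
      "\<And>k::nat. q k \<le> Inf J + 1 / real (Suc k)" "\<And>k::nat. q k - p k \<le> 1 / real (Suc k)"
      "\<And>k. d - 1 / real (Suc k) \<le> f (q k) - f (p k)"
    by metis
  have q: "q \<longlonglongrightarrow> Inf J"
    by (rule tendsto_sandwich[OF _ _ tendsto_const])
       (use pq tendsto_add[OF tendsto_const tendsto_inverse_Suc, of "Inf J"] in auto)
  have "(\<lambda>k. q k - p k) \<longlonglongrightarrow> 0"
    by (rule tendsto_sandwich[OF _ _ tendsto_const tendsto_inverse_Suc]) (use pq in auto)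
  from tendsto_diff[OF q this] have p: "p \<longlonglongrightarrow> Inf J" by simp
  have e: "(\<lambda>k. d - 1 / real (Suc k)) \<longlonglongrightarrow> d"
    using tendsto_diff[OF tendsto_const tendsto_inverse_Suc, of d] by simp
  note j = jump_at_limit_of_increments[OF f pq(1) pq(2) p q pq(6) e d]
  show ?thesis using j by (simp add: J)
qed

lemma cadlag_bounded:
  assumes f: "cadlag f"
  shows "\<exists>B. \<forall>t. 0 \<le> t \<longrightarrow> t \<le> u \<longrightarrow> \<bar>f t\<bar> \<le> B"
proof (rule ccontr)
  assume neg: "\<not> ?thesis"
  then have "\<forall>n::nat. \<exists>t. 0 \<le> t \<and> t \<le> u \<and> real n < \<bar>f t\<bar>" by (meson not_le)
  then obtain x where x: "\<And>n::nat. 0 \<le> x n \<and> x n \<le> u \<and> real n < \<bar>f (x n)\<bar>" by metis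
  have "\<exists>l\<in>{0..u}. \<exists>\<rho>. strict_mono \<rho> \<and> (x \<circ> \<rho>) \<longlonglongrightarrow> l"
  proof (rule seq_compactE)
    show "seq_compact {0..u}" using compact_imp_seq_compact[OF compact_Icc] .
    show "\<forall>n. x n \<in> {0..u}" using x by auto
  qed blast
  then obtain s \<rho> where s: "s \<in> {0..u}" "strict_mono \<rho>" "(x \<circ> \<rho>) \<longlonglongrightarrow> s" by blast
  have lim: "filterlim (\<lambda>k. \<bar>f (x (\<rho> k))\<bar>) at_top sequentially"
  proof (rule filterlim_at_top_mono)
    show "filterlim (\<lambda>k. real (\<rho> k)) at_top sequentially"
      using filterlim_compose[OF filterlim_real_sequentially filterlim_subseq[OF s(2)]] .
  qed (rule always_eventually, rule allI, rule less_imp_le, use x in blast)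
  have contra: False if G: "G \<noteq> bot" "G \<le> sequentially" "((\<lambda>k. f (x (\<rho> k))) \<longlongrightarrow> l) G" for G l
    using not_tendsto_and_filterlim_at_infinity[OF G(1) tendsto_rabs[OF G(3)]]
      filterlim_at_top_imp_at_infinity[OF filterlim_mono[OF lim order_refl G(2)]] by blast
  show False
  proof (cases "frequently (\<lambda>k. x (\<rho> k) \<ge> s) sequentially")
    case True
    define G where "G = inf sequentially (principal {k. x (\<rho> k) \<ge> s})"
    show False
    proof (rule contra)
      show "G \<noteq> bot"
        using True unfolding G_def by (auto simp: trivial_limit_def eventually_inf_principal frequently_def)
      show "G \<le> sequentially" by (simp add: G_def)
      then show "((\<lambda>k. f (x (\<rho> k))) \<longlongrightarrow> f s) G"
        by (intro cadlag_tendsto_right[OF f] tendsto_mono[OF _ s(3)[unfolded o_def]])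
           (use s(1) in \<open>auto simp: G_def eventually_inf_principal\<close>)
    qed
  next
    case False
    then have ev: "eventually (\<lambda>k. x (\<rho> k) < s) sequentially" by (simp add: not_frequently not_le)
    then obtain k where "x (\<rho> k) < s" by (metis eventually_happens' sequentially_bot)
    then have "s > 0" using x[of "\<rho> k"] by linarith
    from contra[OF sequentially_bot order_refl cadlag_tendsto_left[OF f this s(3)[unfolded o_def] ev]]
    show False .
  qed
qed

section \<open>Convergence of expectations\<close>

lemma integrable_excess:
  fixes f :: "'a \<Rightarrow> real"
  assumes "integrable M f" "R \<ge> 0"
  shows "integrable M (\<lambda>x. max 0 (\<bar>f x\<bar> - R))"
  by (rule Bochner_Integration.integrable_bound[OF assms(1)])
     (use assms in \<open>auto intro!: AE_I2 borel_measurable_max borel_measurable_diff borel_measurable_abs\<close>)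

text \<open>
  The quantity \<open>E (\<bar>f\<bar> - R)\<^sup>+\<close> measures how far \<open>f\<close> is from being bounded by \<open>R\<close>; families for which it tends to
  zero uniformly are the uniformly integrable ones.
\<close>

lemma excess_tendsto_0:
  fixes f :: "'a \<Rightarrow> real"
  assumes f: "integrable M f"
  shows "((\<lambda>R. \<integral>x. max 0 (\<bar>f x\<bar> - R) \<partial>M) \<longlongrightarrow> 0) at_top"
proof -
  have [measurable]: "f \<in> borel_measurable M" using f by simp
  have "((\<lambda>R. \<integral>x. max 0 (\<bar>f x\<bar> - R) \<partial>M) \<longlongrightarrow> (\<integral>x. 0 \<partial>M)) at_top"
  proof (rule integral_dominated_convergence_at_top)
    show "integrable M (\<lambda>x. \<bar>f x\<bar>)" using f by simp
    show "\<forall>\<^sub>F R in at_top. AE x in M. norm (max 0 (\<bar>f x\<bar> - R)) \<le> \<bar>f x\<bar>"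
      using eventually_ge_at_top[of 0] by eventually_elim auto
    show "AE x in M. ((\<lambda>R. max 0 (\<bar>f x\<bar> - R)) \<longlongrightarrow> 0) at_top"
    proof (intro AE_I2 tendsto_eventually)
      fix x
      show "\<forall>\<^sub>F R in at_top. max 0 (\<bar>f x\<bar> - R) = 0"
        using eventually_ge_at_top[of "\<bar>f x\<bar>"] by eventually_elim auto
    qed
  qed simp_all
  then show ?thesis by simp
qed

text \<open>
  Vitali's convergence theorem, with uniform integrability given by a common bound \<open>h\<close> on the excesses.
  Truncation at \<open>R\<close> changes the integrals by at most \<open>h R\<close>, and dominated convergence applies to the truncated functions.
\<close>

lemma (in finite_measure) uniform_excess_limit:
  fixes f :: "nat \<Rightarrow> 'a \<Rightarrow> real"
  assumes f: "\<And>k. integrable M (f k)" and g[measurable]: "g \<in> borel_measurable M"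
    and lim: "AE x in M. (\<lambda>k. f k x) \<longlonglongrightarrow> g x"
    and h: "\<And>k R. R \<ge> 0 \<Longrightarrow> (\<integral>x. max 0 (\<bar>f k x\<bar> - R) \<partial>M) \<le> h R" "(h \<longlongrightarrow> 0) at_top"
  shows "integrable M g"
    and "\<And>R. R \<ge> 0 \<Longrightarrow> (\<integral>x. max 0 (\<bar>g x\<bar> - R) \<partial>M) \<le> h R"
    and "(\<lambda>k. \<integral>x. f k x \<partial>M) \<longlonglongrightarrow> (\<integral>x. g x \<partial>M)"
proof -
  have [measurable]: "\<And>k. f k \<in> borel_measurable M" using f by simp
  have hpos: "0 \<le> h R" if "R \<ge> 0" for R
    by (rule order_trans[OF _ h(1)[OF that, of 0]]) simp
  have nn: "(\<integral>\<^sup>+x. ennreal (max 0 (\<bar>g x\<bar> - R)) \<partial>M) \<le> ennreal (h R)" if R: "R \<ge> 0" for R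
  proof -
    have "(\<integral>\<^sup>+x. ennreal (max 0 (\<bar>g x\<bar> - R)) \<partial>M)
        = (\<integral>\<^sup>+x. liminf (\<lambda>k. ennreal (max 0 (\<bar>f k x\<bar> - R))) \<partial>M)"
    proof (rule nn_integral_cong_AE)
      show "AE x in M. ennreal (max 0 (\<bar>g x\<bar> - R)) = liminf (\<lambda>k. ennreal (max 0 (\<bar>f k x\<bar> - R)))"
        using lim
      proof eventually_elim
        case (elim x)
        have "(\<lambda>k. ennreal (max 0 (\<bar>f k x\<bar> - R))) \<longlonglongrightarrow> ennreal (max 0 (\<bar>g x\<bar> - R))"
          by (intro tendsto_ennrealI tendsto_max tendsto_const tendsto_diff tendsto_rabs elim)
        then show ?case by (intro lim_imp_Liminf[symmetric]) auto
      qed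
    qed
    also have "\<dots> \<le> liminf (\<lambda>k. \<integral>\<^sup>+x. ennreal (max 0 (\<bar>f k x\<bar> - R)) \<partial>M)"
      by (rule nn_integral_liminf) measurable
    also have "\<dots> \<le> liminf (\<lambda>k::nat. ennreal (h R))"
    proof (intro Liminf_mono always_eventually allI)
      fix k
      show "(\<integral>\<^sup>+x. ennreal (max 0 (\<bar>f k x\<bar> - R)) \<partial>M) \<le> ennreal (h R)"
        by (subst nn_integral_eq_integral[OF integrable_excess[OF f R]])
           (use h(1)[OF R] in \<open>auto intro: ennreal_leI\<close>)
    qed
    also have "\<dots> = ennreal (h R)" by (simp add: Liminf_const)
    finally show ?thesis .
  qed
  show g_int: "integrable M g"
  proof (rule integrableI_bounded)
    have "(\<integral>\<^sup>+x. ennreal (norm (g x)) \<partial>M) = (\<integral>\<^sup>+x. ennreal (max 0 (\<bar>g x\<bar> - 0)) \<partial>M)" by simp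
    also have "\<dots> < \<infinity>" using nn[of 0] by (auto intro: le_less_trans)
    finally show "(\<integral>\<^sup>+x. ennreal (norm (g x)) \<partial>M) < \<infinity>" .
  qed simp
  show hg: "(\<integral>x. max 0 (\<bar>g x\<bar> - R) \<partial>M) \<le> h R" if R: "R \<ge> 0" for R
    using nn[OF R] hpos[OF R]
    by (subst (asm) nn_integral_eq_integral[OF integrable_excess[OF g_int R]]) auto
  show "(\<lambda>k. \<integral>x. f k x \<partial>M) \<longlonglongrightarrow> (\<integral>x. g x \<partial>M)"
  proof (rule LIMSEQ_I)
    fix e :: real assume "e > 0"
    then have e3: "e / 3 > 0" by simp
    have "eventually (\<lambda>R. R \<ge> 0 \<and> h R < e / 3) at_top"
      using eventually_ge_at_top[of 0] order_tendstoD(2)[OF h(2) e3] by eventually_elim auto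
    from eventually_happens'[OF trivial_limit_at_top_linorder this]
    obtain R where R: "R \<ge> 0" "h R < e / 3" by blast
    (* truncation to [-R, R], whose error is the excess *)
    define cl where "cl = (\<lambda>x::real. max (- R) (min R x))"
    have cl_diff: "\<bar>x - cl x\<bar> = max 0 (\<bar>x\<bar> - R)" for x
      using R(1) by (auto simp: cl_def abs_real_def max_def min_def)
    have cl_meas[measurable]: "cl \<in> borel_measurable borel" unfolding cl_def by measurable
    have cl_bd: "\<bar>cl x\<bar> \<le> R" for x using R(1) by (auto simp: cl_def)
    have cl_int: "integrable M (\<lambda>x. cl (\<phi> x))" if [measurable]: "\<phi> \<in> borel_measurable M" for \<phi>
      by (rule integrable_const_bound[where B = R]) (use cl_bd in auto)
    have near: "\<bar>(\<integral>x. \<phi> x \<partial>M) - (\<integral>x. cl (\<phi> x) \<partial>M)\<bar> < e / 3"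
      if \<phi>: "integrable M \<phi>" "(\<integral>x. max 0 (\<bar>\<phi> x\<bar> - R) \<partial>M) \<le> h R" for \<phi>
    proof -
      have [measurable]: "\<phi> \<in> borel_measurable M" using \<phi> by simp
      have "(\<integral>x. \<phi> x \<partial>M) - (\<integral>x. cl (\<phi> x) \<partial>M) = (\<integral>x. \<phi> x - cl (\<phi> x) \<partial>M)"
        using \<phi>(1) cl_int by simp
      also have "\<bar>\<dots>\<bar> \<le> (\<integral>x. \<bar>\<phi> x - cl (\<phi> x)\<bar> \<partial>M)" by (rule integral_abs_bound)
      also have "\<dots> \<le> h R" unfolding cl_diff by (rule \<phi>(2))
      finally show ?thesis using R(2) by simp
    qed
    have "(\<lambda>k. \<integral>x. cl (f k x) \<partial>M) \<longlonglongrightarrow> (\<integral>x. cl (g x) \<partial>M)"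
    proof (rule integral_dominated_convergence[where w = "\<lambda>_. R"])
      show "AE x in M. (\<lambda>k. cl (f k x)) \<longlonglongrightarrow> cl (g x)"
        using lim unfolding cl_def by eventually_elim (intro tendsto_max tendsto_min tendsto_const)
    qed (use cl_bd in auto)
    from LIMSEQ_D[OF this e3] obtain k0
      where k0: "\<And>k. k \<ge> k0 \<Longrightarrow> \<bar>(\<integral>x. cl (f k x) \<partial>M) - (\<integral>x. cl (g x) \<partial>M)\<bar> < e / 3"
      by auto
    show "\<exists>k0. \<forall>k\<ge>k0. norm ((\<integral>x. f k x \<partial>M) - (\<integral>x. g x \<partial>M)) < e"
    proof (intro exI[of _ k0] allI impI)
      fix k assume "k \<ge> k0"
      with k0 near[OF f h(1)[OF R(1)], of k] near[OF g_int hg[OF R(1)]]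
      show "norm ((\<integral>x. f k x \<partial>M) - (\<integral>x. g x \<partial>M)) < e"
        unfolding real_norm_def using k0[OF \<open>k \<ge> k0\<close>] by linarith
    qed
  qed
qed

section \<open>Filtrations, stopping times and stopped processes\<close>

context usual_filtered_prob_space
begin

lemma subalgebra_F: "subalgebra M (F t)"
  using sets_F_subset by (auto simp: subalgebra_def space_F)

lemma finite_measure_subalgebra_F: "finite_measure_subalgebra M (F t)"
  by (intro finite_measure_subalgebra.intro finite_measure_subalgebra_axioms.intro subalgebra_F)
     unfold_locales

lemma measurable_F_mono: "f \<in> borel_measurable (F s) \<Longrightarrow> s \<le> t \<Longrightarrow> f \<in> borel_measurable (F t)"
  using sets_F_mono[of s t] by (auto simp: measurable_def space_F)

lemma measurable_F_M: "f \<in> borel_measurable (F s) \<Longrightarrow> f \<in> borel_measurable M"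
  using sets_F_subset[of s] by (auto simp: measurable_def space_F)

lemma sets_F_M: "A \<in> sets (F s) \<Longrightarrow> A \<in> sets M"
  using sets_F_subset by auto

text \<open>
  By completeness, modifications on null sets never destroy adaptedness; this lemma and the next ones
  make paths that are regular only almost surely harmless.
\<close>

lemma null_subset_in_F:
  assumes "AE \<omega> in M. P \<omega>"
  shows "{\<omega> \<in> space M. \<not> P \<omega> \<and> R \<omega>} \<in> sets (F t)"
proof -
  obtain N where "{\<omega> \<in> space M. \<not> P \<omega>} \<subseteq> N" "N \<in> null_sets M"
    using assms by (auto simp: eventually_ae_filter)
  then have "{\<omega> \<in> space M. \<not> P \<omega> \<and> R \<omega>} \<in> sets (F 0)" by (intro complete_F_0) auto
  then show ?thesis using sets_F_mono[of 0 t] by auto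
qed

lemma measurable_F_AE_cong:
  assumes g: "g \<in> borel_measurable (F t)" and eq: "AE \<omega> in M. f \<omega> = g \<omega>"
  shows "f \<in> borel_measurable (F t)"
proof (rule measurableI)
  fix A :: "'b set" assume A: "A \<in> sets borel"
  have "f -` A \<inter> space (F t) = (g -` A \<inter> space (F t) - {\<omega> \<in> space M. \<not> f \<omega> = g \<omega> \<and> True})
      \<union> {\<omega> \<in> space M. \<not> f \<omega> = g \<omega> \<and> f \<omega> \<in> A}"
    by (auto simp: space_F)
  also have "\<dots> \<in> sets (F t)"
    by (intro sets.Un sets.Diff measurable_sets[OF g A] null_subset_in_F[OF eq])
  finally show "f -` A \<inter> space (F t) \<in> sets (F t)" .
qed simp

lemma measurable_F_AE_limit:
  fixes f :: "nat \<Rightarrow> 'a \<Rightarrow> real"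
  assumes f: "\<And>k. f k \<in> borel_measurable (F t)" and lim: "AE \<omega> in M. (\<lambda>k. f k \<omega>) \<longlonglongrightarrow> g \<omega>"
  shows "g \<in> borel_measurable (F t)"
proof (rule measurable_F_AE_cong)
  show "(\<lambda>\<omega>. lim (\<lambda>k. f k \<omega>)) \<in> borel_measurable (F t)" using f by (rule borel_measurable_lim_metric)
  show "AE \<omega> in M. g \<omega> = lim (\<lambda>k. f k \<omega>)" using lim by eventually_elim (auto simp: limI)
qed

text \<open>
  Right-continuity of the filtration allows to test stopping times with strict inequalities. The half-open events
  are intersected over a countable dense set of times beyond \<open>t\<close>.
\<close>

lemma stopping_timeI_less:
  assumes lt: "\<And>t. t < \<infinity> \<Longrightarrow> {\<omega> \<in> space M. T \<omega> < t} \<in> sets (F t)"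
  shows "stopping_time F T"
proof
  fix t :: ennreal
  show "Measurable.pred (F t) (\<lambda>\<omega>. T \<omega> \<le> t)"
  proof (cases "t < \<infinity>")
    case True
    have "{\<omega> \<in> space M. T \<omega> \<le> t} \<in> sets (F s)" if "s > t" for s
    proof -
      obtain D :: "ennreal set" where D: "countable D" "\<And>X. open X \<Longrightarrow> X \<noteq> {} \<Longrightarrow> \<exists>d\<in>D. d \<in> X"
        using countable_dense_exists by blast
      have dense_D: "\<exists>d\<in>D. a < d \<and> d < b" if "a < b" for a b
        using D(2)[of "{a<..<b}"] dense[OF that] by auto
      have "{\<omega> \<in> space M. T \<omega> \<le> t} = (\<Inter>d\<in>D \<inter> {t<..<s}. {\<omega> \<in> space M. T \<omega> < d})"
      proof (intro equalityI subsetI)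
        fix \<omega> assume \<omega>: "\<omega> \<in> (\<Inter>d\<in>D \<inter> {t<..<s}. {\<omega> \<in> space M. T \<omega> < d})"
        then have "\<omega> \<in> space M" using dense_D[OF that] by auto
        moreover have "T \<omega> \<le> t"
        proof (rule ccontr)
          assume "\<not> ?thesis"
          then have "t < min s (T \<omega>)" using that by auto
          from dense_D[OF this] obtain d where "d \<in> D" "t < d" "d < s" "d < T \<omega>" by auto
          with \<omega> have "T \<omega> < d" by simp
          with \<open>d < T \<omega>\<close> show False by simp
        qed
        ultimately show "\<omega> \<in> {\<omega> \<in> space M. T \<omega> \<le> t}" by simp
      qed auto
      also have "\<dots> \<in> sets (F s)"
      proof (rule sets.countable_INT')
        show "countable (D \<inter> {t<..<s})" using D(1) by auto
        show "D \<inter> {t<..<s} \<noteq> {}" using dense_D[OF that] by auto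
        show "(\<lambda>d. {\<omega> \<in> space M. T \<omega> < d}) ` (D \<inter> {t<..<s}) \<subseteq> sets (F s)"
        proof clarsimp
          fix d assume d: "d < s"
          then have "d < \<infinity>" using top.not_eq_extremum by fastforce
          from lt[OF this] sets_F_mono[OF less_imp_le[OF d]] show "{\<omega> \<in> space M. T \<omega> < d} \<in> sets (F s)" by blast
        qed
      qed
      finally show ?thesis .
    qed
    then show ?thesis using True by (simp add: pred_def space_F right_continuous_F)
  qed (auto simp: not_less top_unique)
qed

end

section \<open>Optional stopping\<close>

text \<open>
  The value \<open>u \<and> T\<close>; being finite, it is a real number even if \<open>T\<close> is infinite.
\<close>

definition min_time :: "real \<Rightarrow> ennreal \<Rightarrow> real" where
  "min_time u T = enn2real (min (ennreal u) T)"

lemma stopped_eq: "stopped Y T u \<omega> = Y (min_time u (T \<omega>)) \<omega>"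
  by (simp add: stopped_def min_time_def)

lemma min_time_cases:
  assumes "u \<ge> 0"
  obtains "ennreal u \<le> T" "min_time u T = u"
  | r where "T = ennreal r" "0 \<le> r" "r < u" "min_time u T = r"
proof (cases "ennreal u \<le> T")
  case True
  then show ?thesis using that(1) assms by (simp add: min_time_def min_def)
next
  case False
  then have "T < ennreal u" by simp
  then obtain r where r: "0 \<le> r" "T = ennreal r"
    by (cases T) auto
  moreover have "r < u" using r \<open>T < ennreal u\<close> by (simp add: ennreal_less_iff)
  moreover have "min_time u T = r"
    using False r by (simp add: min_time_def min_def)
  ultimately show ?thesis using that(2) by blast
qed

lemma min_time_nonneg: "0 \<le> min_time u T"
  by (simp add: min_time_def)

lemma min_time_le: "0 \<le> u \<Longrightarrow> min_time u T \<le> u"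
  by (erule min_time_cases[of u T]) auto

lemma min_time_le_iff:
  assumes "0 \<le> u" "0 \<le> s"
  shows "min_time u T \<le> s \<longleftrightarrow> u \<le> s \<or> T \<le> ennreal s"
proof (rule min_time_cases[OF assms(1), of T])
  assume a: "ennreal u \<le> T" "min_time u T = u"
  have "u \<le> s" if "T \<le> ennreal s"
    using order_trans[OF a(1) that] assms by simp
  with a show ?thesis by auto
next
  fix r assume "T = ennreal r" "0 \<le> r" "r < u" "min_time u T = r"
  with assms show ?thesis by auto
qed

lemma min_time_of_le: "0 \<le> u \<Longrightarrow> ennreal u \<le> T \<Longrightarrow> min_time u T = u"
  by (simp add: min_time_def min_def)

lemma min_time_of_ge: "0 \<le> u \<Longrightarrow> T \<le> ennreal u \<Longrightarrow> min_time u T = enn2real T"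
  by (simp add: min_time_def min_def)

lemma min_time_increment:
  assumes "0 \<le> s" "s \<le> t"
  shows "min_time s T \<le> min_time t T" "min_time t T - min_time s T \<le> t - s"
proof -
  have t: "0 \<le> t" using assms by simp
  have "min_time s T \<le> min_time t T \<and> min_time t T - min_time s T \<le> t - s"
  proof (rule min_time_cases[OF assms(1), of T])
    assume a: "ennreal s \<le> T" "min_time s T = s"
    show ?thesis
    proof (rule min_time_cases[OF t, of T])
      fix r assume r: "T = ennreal r" "0 \<le> r" "r < t" "min_time t T = r"
      have "s \<le> r" using a(1) r by simp
      then show ?thesis using a r by auto
    qed (use a assms in auto)
  next
    fix r assume r: "T = ennreal r" "0 \<le> r" "r < s" "min_time s T = r"
    have "min_time t T = r"
      using r assms by (subst min_time_of_ge) (auto intro!: ennreal_leI)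
    then show ?thesis using r assms by auto
  qed
  then show "min_time s T \<le> min_time t T" "min_time t T - min_time s T \<le> t - s" by auto
qed

lemma stopped_stopped: "stopped (stopped X S) T = stopped X (\<lambda>\<omega>. min (S \<omega>) (T \<omega>))"
proof (intro ext)
  fix t \<omega>
  have "min (ennreal t) (T \<omega>) < top" by (simp add: min_less_iff_disj)
  then have "min (ennreal (enn2real (min (ennreal t) (T \<omega>)))) (S \<omega>) = min (ennreal t) (min (S \<omega>) (T \<omega>))"
    by (simp add: min.assoc min.commute min.left_commute)
  then show "stopped (stopped X S) T t \<omega> = stopped X (\<lambda>\<omega>. min (S \<omega>) (T \<omega>)) t \<omega>"
    by (simp add: stopped_def)
qed

lemma cadlag_stopped:
  assumes f: "cadlag f"
  shows "cadlag (\<lambda>t. f (min_time t T))"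
  unfolding cadlag_def
proof (intro conjI allI impI)
  fix t :: real assume t: "t \<ge> 0"
  show "((\<lambda>s. f (min_time s T)) \<longlongrightarrow> f (min_time t T)) (at_right t)"
  proof (rule cadlag_tendsto_right[OF f min_time_nonneg])
    show "eventually (\<lambda>s. min_time t T \<le> min_time s T) (at_right t)"
      using eventually_at_right_less[of t] by eventually_elim (use t min_time_increment in auto)
    show "((\<lambda>s. min_time s T) \<longlongrightarrow> min_time t T) (at_right t)"
    proof (rule tendsto_sandwich[where f = "\<lambda>_. min_time t T" and h = "\<lambda>s. min_time t T + (s - t)"])
      show "eventually (\<lambda>s. min_time t T \<le> min_time s T) (at_right t)"
        using eventually_at_right_less[of t] by eventually_elim (use t min_time_increment in auto)
      show "eventually (\<lambda>s. min_time s T \<le> min_time t T + (s - t)) (at_right t)"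
        using eventually_at_right_less[of t]
      proof eventually_elim
        case (elim s)
        then show ?case using t min_time_increment(2)[of t s T] by simp
      qed
      have "((\<lambda>s. min_time t T + (s - t)) \<longlongrightarrow> min_time t T + (t - t)) (at_right t)"
        by (intro tendsto_intros)
      then show "((\<lambda>s. min_time t T + (s - t)) \<longlongrightarrow> min_time t T) (at_right t)" by simp
    qed simp
  qed
next
  fix t :: real assume t: "t > 0"
  have pos: "eventually (\<lambda>s. 0 < s \<and> s < t) (at_left t)"
    using eventually_at_left_real[OF t] by eventually_elim auto
  show "\<exists>l. ((\<lambda>s. f (min_time s T)) \<longlongrightarrow> l) (at_left t)"
  proof (cases "ennreal t \<le> T")
    case True
    have "((\<lambda>s. f (min_time s T)) \<longlongrightarrow> left_limit f t) (at_left t)"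
    proof (rule Lim_transform_eventually[OF left_limit_tendsto[OF f t]])
      show "eventually (\<lambda>s. f s = f (min_time s T)) (at_left t)"
        using pos
      proof eventually_elim
        case (elim s)
        then have "ennreal s \<le> T" using order_trans[OF ennreal_leI True, of s] by simp
        with elim show ?case by (subst min_time_of_le) auto
      qed
    qed
    then show ?thesis ..
  next
    case False
    then obtain r where r: "0 \<le> r" "T = ennreal r" by (cases T) auto
    then have "r < t" using False t by (metis ennreal_leI linorder_not_less)
    have "((\<lambda>s. f (min_time s T)) \<longlongrightarrow> f r) (at_left t)"
    proof (rule tendsto_eventually)
      show "eventually (\<lambda>s. f (min_time s T) = f r) (at_left t)"
        using eventually_at_left_real[OF \<open>r < t\<close>]
        by eventually_elim (use r in \<open>auto simp: min_time_of_ge\<close>)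
    qed
    then show ?thesis ..
  qed
qed

text \<open>
  The value \<open>v \<le> u\<close> rounded up to the grid of mesh \<open>1 / (m + 1)\<close>, but not beyond the horizon \<open>u\<close>.
\<close>

definition upper_grid :: "nat \<Rightarrow> real \<Rightarrow> real \<Rightarrow> real" where
  "upper_grid m u v = min u (real (nat \<lceil>real (Suc m) * v\<rceil>) / real (Suc m))"

lemma upper_grid:
  assumes "0 \<le> v" "v \<le> u"
  shows "v \<le> upper_grid m u v" "upper_grid m u v \<le> u" "upper_grid m u v \<le> v + 1 / real (Suc m)"
proof -
  define x where "x = real (Suc m) * v"
  have x: "x \<ge> 0" using assms by (simp add: x_def)
  have c: "x \<le> real (nat \<lceil>x\<rceil>)" "real (nat \<lceil>x\<rceil>) \<le> x + 1"
    using x by linarith+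
  have "v = x / real (Suc m)" by (simp add: x_def)
  moreover have "x / real (Suc m) \<le> real (nat \<lceil>x\<rceil>) / real (Suc m)"
    "real (nat \<lceil>x\<rceil>) / real (Suc m) \<le> (x + 1) / real (Suc m)"
    using c by (auto intro: divide_right_mono)
  ultimately show "v \<le> upper_grid m u v" "upper_grid m u v \<le> u" "upper_grid m u v \<le> v + 1 / real (Suc m)"
    using assms by (auto simp: upper_grid_def x_def[symmetric] add_divide_distrib)
qed

lemma upper_grid_tendsto:
  assumes "0 \<le> v" "v \<le> u"
  shows "(\<lambda>m. upper_grid m u v) \<longlonglongrightarrow> v"
  by (rule tendsto_sandwich[where f = "\<lambda>_. v" and h = "\<lambda>m. v + 1 / real (Suc m)"])
     (use upper_grid[OF assms] tendsto_add[OF tendsto_const tendsto_inverse_Suc, of v] in auto)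

context usual_filtered_prob_space
begin

lemma min_time_le_in_F:
  assumes T: "stopping_time F T" and "0 \<le> u" "0 \<le> s"
  shows "{\<omega> \<in> space M. min_time u (T \<omega>) \<le> s} \<in> sets (F (ennreal s))"
proof -
  have "{\<omega> \<in> space M. min_time u (T \<omega>) \<le> s} =
      (if u \<le> s then space (F (ennreal s)) else {\<omega> \<in> space (F (ennreal s)). T \<omega> \<le> ennreal s})"
    using assms by (auto simp: min_time_le_iff space_F)
  also have "\<dots> \<in> sets (F (ennreal s))"
    using stopping_timeD[OF T, of "ennreal s"] by (auto simp: pred_def)
  finally show ?thesis .
qed

lemma stopping_grid_cell:
  assumes T: "stopping_time F T" and u: "0 \<le> u"
  shows "{\<omega> \<in> space M. nat \<lceil>real (Suc m) * min_time u (T \<omega>)\<rceil> = j} \<in> sets (F (ennreal (min u (real j / real (Suc m)))))"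
proof -
  define t where "t = (\<lambda>j::nat. min u (real j / real (Suc m)))"
  have t0: "0 \<le> t j" for j using u by (simp add: t_def)
  have le_iff: "nat \<lceil>real (Suc m) * v\<rceil> \<le> j \<longleftrightarrow> v \<le> t j" if "0 \<le> v" "v \<le> u" for v j
  proof -
    have "nat \<lceil>real (Suc m) * v\<rceil> \<le> j \<longleftrightarrow> real (Suc m) * v \<le> real j"
      by (simp add: nat_le_iff ceiling_le_iff)
    also have "\<dots> \<longleftrightarrow> v \<le> real j / real (Suc m)" by (simp add: field_simps)
    finally show ?thesis using that by (simp add: t_def)
  qed
  have sets_le: "{\<omega> \<in> space M. min_time u (T \<omega>) \<le> t i} \<in> sets (F (ennreal (t j)))" if "i \<le> j" for i
  proof -
    have "t i \<le> t j" using that by (auto simp: t_def min_le_iff_disj intro!: divide_right_mono)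
    then show ?thesis
      using min_time_le_in_F[OF T u t0, of i] sets_F_mono[OF ennreal_leI, of "t i" "t j"] by blast
  qed
  define k where "k = (\<lambda>\<omega>. nat \<lceil>real (Suc m) * min_time u (T \<omega>)\<rceil>)"
  have k_iff: "min_time u (T \<omega>) \<le> t i \<longleftrightarrow> k \<omega> \<le> i" for \<omega> i
    unfolding k_def by (rule le_iff[OF min_time_nonneg min_time_le[OF u], symmetric])
  have "{\<omega> \<in> space M. k \<omega> = j} =
      {\<omega> \<in> space M. min_time u (T \<omega>) \<le> t j} -
      (if j = 0 then {} else {\<omega> \<in> space M. min_time u (T \<omega>) \<le> t (j - 1)})"
    unfolding k_iff by (cases j) auto
  also have "\<dots> \<in> sets (F (ennreal (t j)))"
    by (intro sets.Diff sets_le) (auto intro: sets_le)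
  finally show ?thesis unfolding t_def k_def .
qed

text \<open>
  The event that the stopping time, cut off at \<open>u\<close>, is rounded up to the grid point with number \<open>j\<close>.
\<close>

definition grid_cell :: "('a \<Rightarrow> ennreal) \<Rightarrow> nat \<Rightarrow> real \<Rightarrow> nat \<Rightarrow> 'a set" where
  "grid_cell T m u j = {\<omega> \<in> space M. nat \<lceil>real (Suc m) * min_time u (T \<omega>)\<rceil> = j}"

text \<open>
  The cells partition the probability space, so a process sampled at the rounded time is a finite sum of its
  values at deterministic times.
\<close>

lemma grid_cell_sum:
  fixes f :: "nat \<Rightarrow> real"
  assumes u: "0 \<le> u" and \<omega>: "\<omega> \<in> space M"
  shows "(\<Sum>j\<le>nat \<lceil>real (Suc m) * u\<rceil>. indicator (grid_cell T m u j) \<omega> * f j)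
    = f (nat \<lceil>real (Suc m) * min_time u (T \<omega>)\<rceil>)"
proof -
  define k where "k = nat \<lceil>real (Suc m) * min_time u (T \<omega>)\<rceil>"
  have "k \<le> nat \<lceil>real (Suc m) * u\<rceil>"
    unfolding k_def by (intro nat_mono ceiling_mono mult_left_mono min_time_le u) simp
  moreover have "indicator (grid_cell T m u j) \<omega> * f j = (if k = j then f j else 0)" for j
    using \<omega> by (auto simp: grid_cell_def k_def)
  ultimately have "(\<Sum>j\<le>nat \<lceil>real (Suc m) * u\<rceil>. indicator (grid_cell T m u j) \<omega> * f j) = f k"
    by (simp del: of_nat_Suc)
  then show ?thesis unfolding k_def .
qed

lemma stopped_upper_grid_eq:
  assumes u: "0 \<le> u" and \<omega>: "\<omega> \<in> space M"
  shows "h (Y (upper_grid m u (min_time u (T \<omega>))) \<omega>) =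
    (\<Sum>j\<le>nat \<lceil>real (Suc m) * u\<rceil>. indicator (grid_cell T m u j) \<omega> * h (Y (min u (real j / real (Suc m))) \<omega>) :: real)"
  unfolding grid_cell_sum[OF assms] upper_grid_def ..

lemma grid_cell_F:
  "stopping_time F T \<Longrightarrow> 0 \<le> u \<Longrightarrow> grid_cell T m u j \<in> sets (F (ennreal (min u (real j / real (Suc m)))))"
  unfolding grid_cell_def by (rule stopping_grid_cell)

lemma stopped_upper_grid_measurable:
  assumes Y: "adapted F Y" and T: "stopping_time F T" and u: "0 \<le> u"
  shows "(\<lambda>\<omega>. Y (upper_grid m u (min_time u (T \<omega>))) \<omega>) \<in> borel_measurable (F (ennreal u))"
proof -
  have le: "ennreal (min u (real j / real (Suc m))) \<le> ennreal u" for j by (intro ennreal_leI) simp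
  have "(\<lambda>\<omega>. \<Sum>j\<le>nat \<lceil>real (Suc m) * u\<rceil>. indicator (grid_cell T m u j) \<omega> * Y (min u (real j / real (Suc m))) \<omega>)
      \<in> borel_measurable (F (ennreal u))"
  proof (intro borel_measurable_sum borel_measurable_times borel_measurable_indicator)
    fix j
    show "grid_cell T m u j \<in> sets (F (ennreal u))" using grid_cell_F[OF T u] sets_F_mono[OF le] by blast
    show "Y (min u (real j / real (Suc m))) \<in> borel_measurable (F (ennreal u))"
      by (rule measurable_F_mono[OF _ le[of j]]) (use Y u in \<open>auto simp: adapted_def\<close>)
  qed
  then show ?thesis
    by (rule measurable_cong[THEN iffD1, rotated])
       (use stopped_upper_grid_eq[OF u, where h = "\<lambda>x. x"] in \<open>simp add: space_F\<close>)
qed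

lemma stopped_upper_grid_tendsto:
  assumes Y: "AE \<omega> in M. cadlag (\<lambda>t. Y t \<omega>)" and u: "0 \<le> u"
  shows "AE \<omega> in M. (\<lambda>m. Y (upper_grid m u (min_time u (T \<omega>))) \<omega>) \<longlonglongrightarrow> stopped Y T u \<omega>"
  using Y
proof eventually_elim
  case (elim \<omega>)
  show ?case unfolding stopped_eq
    by (rule cadlag_tendsto_right[OF elim min_time_nonneg])
       (use upper_grid_tendsto[OF min_time_nonneg min_time_le[OF u]] upper_grid[OF min_time_nonneg min_time_le[OF u]] in auto)
qed

lemma adapted_stopped:
  assumes Y: "adapted F Y" "AE \<omega> in M. cadlag (\<lambda>t. Y t \<omega>)" and T: "stopping_time F T"
  shows "adapted F (stopped Y T)"
  unfolding adapted_def
proof (intro allI impI)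
  fix u :: real assume u: "0 \<le> u"
  show "stopped Y T u \<in> borel_measurable (F (ennreal u))"
    by (rule measurable_F_AE_limit[OF stopped_upper_grid_measurable[OF Y(1) T u]
          stopped_upper_grid_tendsto[OF Y(2) u]])
qed

lemma expectation_upper_grid:
  fixes h :: "real \<Rightarrow> real"
  assumes T: "stopping_time F T" and u: "0 \<le> u"
    and int: "\<And>t. 0 \<le> t \<Longrightarrow> t \<le> u \<Longrightarrow> integrable M (\<lambda>\<omega>. h (Y t \<omega>))"
  shows "integrable M (\<lambda>\<omega>. h (Y (upper_grid m u (min_time u (T \<omega>))) \<omega>))"
    and "(\<integral>\<omega>. h (Y (upper_grid m u (min_time u (T \<omega>))) \<omega>) \<partial>M) =
      (\<Sum>j\<le>nat \<lceil>real (Suc m) * u\<rceil>. \<integral>\<omega>. indicator (grid_cell T m u j) \<omega> * h (Y (min u (real j / real (Suc m))) \<omega>) \<partial>M)"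
    and "(\<Sum>j\<le>nat \<lceil>real (Suc m) * u\<rceil>. \<integral>\<omega>. indicator (grid_cell T m u j) \<omega> * h (Y u \<omega>) \<partial>M) = (\<integral>\<omega>. h (Y u \<omega>) \<partial>M)"
proof -
  have int': "integrable M (\<lambda>\<omega>. indicator (grid_cell T m u j) \<omega> * h (Y t \<omega>))" if "0 \<le> t" "t \<le> u" for j t
    using integrable_mult_indicator[OF sets_F_M[OF grid_cell_F[OF T u]] int[OF that]] by simp
  have bnds: "0 \<le> min u (real j / real (Suc m))" "min u (real j / real (Suc m)) \<le> u" for j using u by auto
  have eq: "h (Y (upper_grid m u (min_time u (T \<omega>))) \<omega>) =
    (\<Sum>j\<le>nat \<lceil>real (Suc m) * u\<rceil>. indicator (grid_cell T m u j) \<omega> * h (Y (min u (real j / real (Suc m))) \<omega>))"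
    if "\<omega> \<in> space M" for \<omega> by (rule stopped_upper_grid_eq[OF u that])
  show "integrable M (\<lambda>\<omega>. h (Y (upper_grid m u (min_time u (T \<omega>))) \<omega>))"
    by (subst Bochner_Integration.integrable_cong[OF refl eq]) (assumption, intro Bochner_Integration.integrable_sum int' bnds)
  show "(\<integral>\<omega>. h (Y (upper_grid m u (min_time u (T \<omega>))) \<omega>) \<partial>M) =
      (\<Sum>j\<le>nat \<lceil>real (Suc m) * u\<rceil>. \<integral>\<omega>. indicator (grid_cell T m u j) \<omega> * h (Y (min u (real j / real (Suc m))) \<omega>) \<partial>M)"
    by (subst Bochner_Integration.integral_cong[OF refl eq])
       (assumption, intro Bochner_Integration.integral_sum int' bnds)
  have "(\<Sum>j\<le>nat \<lceil>real (Suc m) * u\<rceil>. \<integral>\<omega>. indicator (grid_cell T m u j) \<omega> * h (Y u \<omega>) \<partial>M) =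
    (\<integral>\<omega>. (\<Sum>j\<le>nat \<lceil>real (Suc m) * u\<rceil>. indicator (grid_cell T m u j) \<omega> * h (Y u \<omega>)) \<partial>M)"
    by (rule Bochner_Integration.integral_sum[symmetric]) (use int' u in auto)
  also have "\<dots> = (\<integral>\<omega>. h (Y u \<omega>) \<partial>M)"
    by (intro Bochner_Integration.integral_cong refl grid_cell_sum u)
  finally show "(\<Sum>j\<le>nat \<lceil>real (Suc m) * u\<rceil>. \<integral>\<omega>. indicator (grid_cell T m u j) \<omega> * h (Y u \<omega>) \<partial>M) = (\<integral>\<omega>. h (Y u \<omega>) \<partial>M)" .
qed

lemma martingaleD:
  assumes "martingale M F Y"
  shows "adapted F Y" "AE \<omega> in M. cadlag (\<lambda>t. Y t \<omega>)" "t \<ge> 0 \<Longrightarrow> integrable M (Y t)"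
  using assms by (auto simp: martingale_def)

lemma martingale_integral_indicator:
  assumes Y: "martingale M F Y" and st: "0 \<le> s" "s \<le> t" and A: "A \<in> sets (F (ennreal s))"
  shows "(\<integral>\<omega>. indicator A \<omega> * Y s \<omega> \<partial>M) = (\<integral>\<omega>. indicator A \<omega> * Y t \<omega> \<partial>M)"
proof -
  interpret finite_measure_subalgebra M "F (ennreal s)" by (rule finite_measure_subalgebra_F)
  have int: "integrable M (Y t)" using Y st by (simp add: martingale_def)
  have A_M[measurable]: "A \<in> sets M" by (rule sets_F_M[OF A])
  have [measurable]: "Y s \<in> borel_measurable M" using martingaleD(3)[OF Y st(1)] by auto
  have "(\<integral>\<omega>. indicator A \<omega> * Y t \<omega> \<partial>M) = (\<integral>\<omega>. indicator A \<omega> * real_cond_exp M (F (ennreal s)) (Y t) \<omega> \<partial>M)"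
    using real_cond_exp_intA[OF int A] by (simp add: set_lebesgue_integral_def)
  also have "\<dots> = (\<integral>\<omega>. indicator A \<omega> * Y s \<omega> \<partial>M)"
  proof (rule integral_cong_AE)
    have "AE \<omega> in M. real_cond_exp M (F (ennreal s)) (Y t) \<omega> = Y s \<omega>"
      using Y st by (simp add: martingale_def)
    then show "AE \<omega> in M. indicator A \<omega> * real_cond_exp M (F (ennreal s)) (Y t) \<omega> = indicator A \<omega> * Y s \<omega>"
      by eventually_elim simp
  qed measurable
  finally show ?thesis ..
qed

text \<open>
  Convexity of \<open>x \<mapsto> (\<bar>x\<bar> - R)\<^sup>+\<close>, in elementary form: on the event where \<open>Y s\<close> lies above \<open>R\<close> (below \<open>-R\<close>) the
  excess is affine in \<open>Y s\<close>, and its continuation as an affine function of \<open>Y t\<close> is dominated by the excess of \<open>Y t\<close>.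
\<close>

lemma martingale_excess_le:
  assumes Y: "martingale M F Y" and st: "0 \<le> s" "s \<le> t" and A: "A \<in> sets (F (ennreal s))" and R: "R \<ge> 0"
  shows "(\<integral>\<omega>. indicator A \<omega> * max 0 (\<bar>Y s \<omega>\<bar> - R) \<partial>M) \<le> (\<integral>\<omega>. indicator A \<omega> * max 0 (\<bar>Y t \<omega>\<bar> - R) \<partial>M)"
proof -
  have t: "0 \<le> t" using st by simp
  have Ys[measurable]: "Y s \<in> borel_measurable (F (ennreal s))" using martingaleD(1)[OF Y] st by (simp add: adapted_def)
  note [measurable] = A
  define A1 where "A1 = A \<inter> {\<omega> \<in> space (F (ennreal s)). Y s \<omega> > R}"
  define A2 where "A2 = A \<inter> {\<omega> \<in> space (F (ennreal s)). Y s \<omega> < - R}"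
  have AF: "A1 \<in> sets (F (ennreal s))" "A2 \<in> sets (F (ennreal s))" unfolding A1_def A2_def by measurable
  have AM: "A \<in> sets M" "A1 \<in> sets M" "A2 \<in> sets M" using sets_F_M A AF by auto
  have int: "integrable M (Y s)" "integrable M (Y t)" using martingaleD(3)[OF Y] st t by auto
  have ii: "integrable M (\<lambda>\<omega>. indicator B \<omega> * f \<omega>)" if "B \<in> sets M" "integrable M f" for B and f :: "'a \<Rightarrow> real"
    using integrable_mult_indicator[OF that] by simp
  have ii': "integrable M (\<lambda>\<omega>. indicator B \<omega> * R)" if "B \<in> sets M" for B
    by (rule ii[OF that]) simp
  have split: "(\<integral>\<omega>. indicator A1 \<omega> * Y q \<omega> - indicator A1 \<omega> * R + (- (indicator A2 \<omega> * Y q \<omega>) - indicator A2 \<omega> * R) \<partial>M) =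
     (\<integral>\<omega>. indicator A1 \<omega> * Y q \<omega> \<partial>M) - (\<integral>\<omega>. indicator A1 \<omega> * R \<partial>M) +
     (- (\<integral>\<omega>. indicator A2 \<omega> * Y q \<omega> \<partial>M) - (\<integral>\<omega>. indicator A2 \<omega> * R \<partial>M))"
     if "integrable M (Y q)" for q
    using ii[OF AM(2) that] ii[OF AM(3) that] ii'[OF AM(2)] ii'[OF AM(3)]
    by (simp add: Bochner_Integration.integral_add Bochner_Integration.integral_diff)
  have "(\<integral>\<omega>. indicator A \<omega> * max 0 (\<bar>Y s \<omega>\<bar> - R) \<partial>M) =
      (\<integral>\<omega>. indicator A1 \<omega> * Y s \<omega> - indicator A1 \<omega> * R + (- (indicator A2 \<omega> * Y s \<omega>) - indicator A2 \<omega> * R) \<partial>M)"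
    by (intro Bochner_Integration.integral_cong refl) (use R in \<open>auto simp: A1_def A2_def space_F indicator_def\<close>)
  also have "\<dots> = (\<integral>\<omega>. indicator A1 \<omega> * Y t \<omega> - indicator A1 \<omega> * R + (- (indicator A2 \<omega> * Y t \<omega>) - indicator A2 \<omega> * R) \<partial>M)"
    unfolding split[OF int(1)] split[OF int(2)]
    by (simp add: martingale_integral_indicator[OF Y st] AF)
  also have "\<dots> \<le> (\<integral>\<omega>. indicator A \<omega> * max 0 (\<bar>Y t \<omega>\<bar> - R) \<partial>M)"
  proof (rule integral_mono)
    show "integrable M (\<lambda>\<omega>. indicator A1 \<omega> * Y t \<omega> - indicator A1 \<omega> * R + (- (indicator A2 \<omega> * Y t \<omega>) - indicator A2 \<omega> * R))"
      by (intro Bochner_Integration.integrable_add Bochner_Integration.integrable_diff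
          Bochner_Integration.integrable_minus ii ii' AM int)
    show "integrable M (\<lambda>\<omega>. indicator A \<omega> * max 0 (\<bar>Y t \<omega>\<bar> - R))"
      by (intro ii AM integrable_excess int R)
  qed (use R in \<open>auto simp: A1_def A2_def indicator_def\<close>)
  finally show ?thesis .
qed

text \<open>
  For the rounded times the claims are finite sums of the defining property of a martingale. By right-continuity
  the rounded values converge to the stopped value, and the excess of \<open>Y u\<close> controls all of them.
\<close>

theorem optional_stopping:
  assumes Y: "martingale M F Y" and T: "stopping_time F T" and u: "0 \<le> u"
  shows "integrable M (stopped Y T u)"
    and "(\<integral>\<omega>. stopped Y T u \<omega> \<partial>M) = (\<integral>\<omega>. Y u \<omega> \<partial>M)"
    and "\<And>R. R \<ge> 0 \<Longrightarrow> (\<integral>\<omega>. max 0 (\<bar>stopped Y T u \<omega>\<bar> - R) \<partial>M) \<le> (\<integral>\<omega>. max 0 (\<bar>Y u \<omega>\<bar> - R) \<partial>M)"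
proof -
  note Y' = martingaleD[OF Y]
  define Z where "Z = (\<lambda>m \<omega>. Y (upper_grid m u (min_time u (T \<omega>))) \<omega>)"
  have bnds: "0 \<le> min u (real j / real (Suc m))" "min u (real j / real (Suc m)) \<le> u" for j m using u by auto
  have Z_int: "integrable M (Z m)" for m
    unfolding Z_def by (rule expectation_upper_grid(1)[OF T u, where h = "\<lambda>x. x"]) (rule Y'(3))
  have EZ: "(\<integral>\<omega>. Z m \<omega> \<partial>M) = (\<integral>\<omega>. Y u \<omega> \<partial>M)" for m
    unfolding Z_def
    using expectation_upper_grid(2,3)[OF T u, where h = "\<lambda>x. x" and m = m and Y = Y]
      martingale_integral_indicator[OF Y bnds grid_cell_F[OF T u], of m] Y'(3) by simp
  have excess: "(\<integral>\<omega>. max 0 (\<bar>Z m \<omega>\<bar> - R) \<partial>M) \<le> (\<integral>\<omega>. max 0 (\<bar>Y u \<omega>\<bar> - R) \<partial>M)" if R: "R \<ge> 0" for m R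
  proof -
    have int: "integrable M (\<lambda>\<omega>. max 0 (\<bar>Y t \<omega>\<bar> - R))" if "0 \<le> t" "t \<le> u" for t
      by (intro integrable_excess Y' R that)
    note E = expectation_upper_grid[where h = "\<lambda>x. max 0 (\<bar>x\<bar> - R)" and Y = Y and m = m, OF T u int]
    have "(\<integral>\<omega>. max 0 (\<bar>Z m \<omega>\<bar> - R) \<partial>M) =
      (\<Sum>j\<le>nat \<lceil>real (Suc m) * u\<rceil>. \<integral>\<omega>. indicator (grid_cell T m u j) \<omega> *
        max 0 (\<bar>Y (min u (real j / real (Suc m))) \<omega>\<bar> - R) \<partial>M)"
      unfolding Z_def by (rule E(2))
    also have "\<dots> \<le> (\<Sum>j\<le>nat \<lceil>real (Suc m) * u\<rceil>. \<integral>\<omega>. indicator (grid_cell T m u j) \<omega> *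
        max 0 (\<bar>Y u \<omega>\<bar> - R) \<partial>M)"
      by (intro sum_mono martingale_excess_le[OF Y bnds grid_cell_F[OF T u] R])
    also have "\<dots> = (\<integral>\<omega>. max 0 (\<bar>Y u \<omega>\<bar> - R) \<partial>M)" by (rule E(3))
    finally show ?thesis .
  qed
  have meas: "stopped Y T u \<in> borel_measurable M"
    using adapted_stopped[OF Y'(1,2) T] u unfolding adapted_def by (blast intro: measurable_F_M)
  have lim: "AE \<omega> in M. (\<lambda>m. Z m \<omega>) \<longlonglongrightarrow> stopped Y T u \<omega>"
    unfolding Z_def by (rule stopped_upper_grid_tendsto[OF Y'(2) u])
  have Yu: "integrable M (Y u)" by (rule Y'(3)[OF u])
  note U = uniform_excess_limit[OF Z_int meas lim excess excess_tendsto_0[OF Yu]]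
  show "integrable M (stopped Y T u)" by (rule U(1))
  show "(\<integral>\<omega>. stopped Y T u \<omega> \<partial>M) = (\<integral>\<omega>. Y u \<omega> \<partial>M)"
    using U(3) unfolding EZ by (rule LIMSEQ_unique[OF tendsto_const, symmetric])
  show "\<And>R. R \<ge> 0 \<Longrightarrow> (\<integral>\<omega>. max 0 (\<bar>stopped Y T u \<omega>\<bar> - R) \<partial>M) \<le> (\<integral>\<omega>. max 0 (\<bar>Y u \<omega>\<bar> - R) \<partial>M)"
    by (rule U(2))
qed

lemma martingale_stopped_indicator:
  assumes Y: "martingale M F Y" and T: "stopping_time F T" and st: "0 \<le> s" "s \<le> t"
    and A: "A \<in> sets (F (ennreal s))"
  shows "(\<integral>\<omega>. indicator A \<omega> * stopped Y T s \<omega> \<partial>M) = (\<integral>\<omega>. indicator A \<omega> * stopped Y T t \<omega> \<partial>M)"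
proof -
  have t: "0 \<le> t" using st by simp
  (* Shortening T to s on an event of the past at time s gives a stopping time again, and comparing the
     expectations at S and at T isolates the contribution of A. *)
  define S where "S = (\<lambda>\<omega>. if \<omega> \<in> A then min (T \<omega>) (ennreal s) else T \<omega>)"
  have S: "stopping_time F S"
  proof
    fix r
    show "Measurable.pred (F r) (\<lambda>\<omega>. S \<omega> \<le> r)"
    proof (cases "ennreal s \<le> r")
      case True
      then have [measurable]: "A \<in> sets (F r)" using A sets_F_mono by blast
      have [measurable]: "Measurable.pred (F r) (\<lambda>\<omega>. T \<omega> \<le> r)" by (rule stopping_timeD[OF T])
      have "(\<lambda>\<omega>. S \<omega> \<le> r) = (\<lambda>\<omega>. \<omega> \<in> A \<or> T \<omega> \<le> r)"
        using True by (auto simp: S_def min_le_iff_disj)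
      then show ?thesis by simp
    next
      case False
      then have "(\<lambda>\<omega>. S \<omega> \<le> r) = (\<lambda>\<omega>. T \<omega> \<le> r)" by (auto simp: S_def min_le_iff_disj)
      then show ?thesis using stopping_timeD[OF T] by simp
    qed
  qed
  have AM: "A \<in> sets M" by (rule sets_F_M[OF A])
  note int = optional_stopping(1)[OF Y T st(1)] optional_stopping(1)[OF Y T t] 
  have ii: "integrable M (\<lambda>\<omega>. indicator A \<omega> * f \<omega>)" if "integrable M f" for f :: "'a \<Rightarrow> real"
    using integrable_mult_indicator[OF AM that] by simp
  have "stopped Y S t \<omega> = stopped Y T t \<omega> + (indicator A \<omega> * stopped Y T s \<omega> - indicator A \<omega> * stopped Y T t \<omega>)" for \<omega>
  proof -
    have "min (ennreal t) (min (T \<omega>) (ennreal s)) = min (ennreal s) (T \<omega>)"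
      using st by (metis ennreal_leI min.absorb2 min.assoc min.commute)
    then show ?thesis by (simp add: stopped_def S_def indicator_def)
  qed
  then have "(\<integral>\<omega>. stopped Y S t \<omega> \<partial>M) = (\<integral>\<omega>. stopped Y T t \<omega> + (indicator A \<omega> * stopped Y T s \<omega> - indicator A \<omega> * stopped Y T t \<omega>) \<partial>M)"
    by simp
  also have "\<dots> = (\<integral>\<omega>. stopped Y T t \<omega> \<partial>M) + ((\<integral>\<omega>. indicator A \<omega> * stopped Y T s \<omega> \<partial>M) - (\<integral>\<omega>. indicator A \<omega> * stopped Y T t \<omega> \<partial>M))"
    using int ii by simp
  finally show ?thesis
    unfolding optional_stopping(2)[OF Y T t] optional_stopping(2)[OF Y S t] by simp
qed

text \<open>
  It suffices that stopped values have constant expectation: conditional statements follow by applying this to times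
  that are shortened on an event of the past.
\<close>

theorem martingale_stopped:
  assumes Y: "martingale M F Y" and T: "stopping_time F T"
  shows "martingale M F (stopped Y T)"
  unfolding martingale_def
proof (intro conjI allI impI)
  note Y' = martingaleD[OF Y]
  show ad: "adapted F (stopped Y T)" by (rule adapted_stopped[OF Y'(1,2) T])
  show "AE \<omega> in M. cadlag (\<lambda>t. stopped Y T t \<omega>)"
    using Y'(2) unfolding stopped_eq by eventually_elim (rule cadlag_stopped)
  show "integrable M (stopped Y T t)" if "0 \<le> t" for t by (rule optional_stopping(1)[OF Y T that])
  fix s t :: real assume st: "0 \<le> s" "s \<le> t"
  then have t: "0 \<le> t" by simp
  interpret finite_measure_subalgebra M "F (ennreal s)" by (rule finite_measure_subalgebra_F)
  show "AE \<omega> in M. real_cond_exp M (F (ennreal s)) (stopped Y T t) \<omega> = stopped Y T s \<omega>"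
  proof (rule real_cond_exp_charact)
    show "(\<integral>\<omega>\<in>A. stopped Y T t \<omega> \<partial>M) = (\<integral>\<omega>\<in>A. stopped Y T s \<omega> \<partial>M)" if "A \<in> sets (F (ennreal s))" for A
      using martingale_stopped_indicator[OF Y T st that] by (simp add: set_lebesgue_integral_def)
  qed (use optional_stopping(1)[OF Y T] st t ad in \<open>auto simp: adapted_def\<close>)
qed

text \<open>
  Increments are orthogonal to everything bounded and known at their beginning. This is the only form in which the
  martingale property enters the exponential inequality.
\<close>

lemma martingale_increment_orthogonal:
  assumes Y: "martingale M F Y" and st: "0 \<le> s" "s \<le> t"
    and Z: "Z \<in> borel_measurable (F (ennreal s))" "AE \<omega> in M. \<bar>Z \<omega>\<bar> \<le> C"
  shows "integrable M (\<lambda>\<omega>. Z \<omega> * (Y t \<omega> - Y s \<omega>))" "(\<integral>\<omega>. Z \<omega> * (Y t \<omega> - Y s \<omega>) \<partial>M) = 0"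
proof -
  have t: "0 \<le> t" using st by simp
  interpret finite_measure_subalgebra M "F (ennreal s)" by (rule finite_measure_subalgebra_F)
  have ZM[measurable]: "Z \<in> borel_measurable M" by (rule measurable_F_M[OF Z(1)])
  have int: "integrable M (Y s)" "integrable M (Y t)" using martingaleD(3)[OF Y] st t by auto
  then have [measurable]: "Y s \<in> borel_measurable M" "Y t \<in> borel_measurable M" by auto
  have ZY: "integrable M (\<lambda>\<omega>. Z \<omega> * Y q \<omega>)" if "integrable M (Y q)" for q
  proof (rule Bochner_Integration.integrable_bound)
    show "integrable M (\<lambda>\<omega>. C * Y q \<omega>)" using that by simp
    show "(\<lambda>\<omega>. Z \<omega> * Y q \<omega>) \<in> borel_measurable M" using that by auto
    show "AE \<omega> in M. norm (Z \<omega> * Y q \<omega>) \<le> norm (C * Y q \<omega>)"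
      using Z(2) by eventually_elim (auto simp: abs_mult intro!: mult_right_mono)
  qed
  have "(\<integral>\<omega>. Z \<omega> * Y t \<omega> \<partial>M) = (\<integral>\<omega>. Z \<omega> * real_cond_exp M (F (ennreal s)) (Y t) \<omega> \<partial>M)"
    by (rule real_cond_exp_intg(2)[symmetric]) (use ZY int Z in auto)
  also have "\<dots> = (\<integral>\<omega>. Z \<omega> * Y s \<omega> \<partial>M)"
  proof (rule integral_cong_AE)
    have "AE \<omega> in M. real_cond_exp M (F (ennreal s)) (Y t) \<omega> = Y s \<omega>"
      using Y st by (simp add: martingale_def)
    then show "AE \<omega> in M. Z \<omega> * real_cond_exp M (F (ennreal s)) (Y t) \<omega> = Z \<omega> * Y s \<omega>"
      by eventually_elim simp
  qed measurable
  finally have eq: "(\<integral>\<omega>. Z \<omega> * Y t \<omega> \<partial>M) = (\<integral>\<omega>. Z \<omega> * Y s \<omega> \<partial>M)" .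
  show "integrable M (\<lambda>\<omega>. Z \<omega> * (Y t \<omega> - Y s \<omega>))" using ZY int by (simp add: right_diff_distrib)
  show "(\<integral>\<omega>. Z \<omega> * (Y t \<omega> - Y s \<omega>) \<partial>M) = 0" using ZY int eq by (simp add: right_diff_distrib)
qed

end

section \<open>Predictable processes\<close>

text \<open>
  The last grid point of mesh \<open>1 / (n + 1)\<close> strictly before \<open>t\<close>, for \<open>t > 0\<close>. Sampling there only uses the strict past,
  which is why it yields predictable processes.
\<close>

definition lower_grid :: "nat \<Rightarrow> real \<Rightarrow> real" where
  "lower_grid n t = real (nat (\<lceil>real (Suc n) * t\<rceil> - 1)) / real (Suc n)"

lemma lower_grid_cell:
  assumes "real j / real (Suc n) < t" "t \<le> real (Suc j) / real (Suc n)"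
  shows "lower_grid n t = real j / real (Suc n)"
proof -
  have "real j < real (Suc n) * t" "real (Suc n) * t \<le> real j + 1"
    using assms by (simp_all add: field_simps)
  then have "\<lceil>real (Suc n) * t\<rceil> = int j + 1" by linarith
  then show ?thesis by (simp add: lower_grid_def)
qed

lemma lower_grid_cell_exists:
  assumes "0 < t"
  obtains j where "real j / real (Suc n) < t" "t \<le> real (Suc j) / real (Suc n)"
proof
  define j where "j = nat (\<lceil>real (Suc n) * t\<rceil> - 1)"
  have "0 < real (Suc n) * t" using assms by simp
  then have "real j < real (Suc n) * t" "real (Suc n) * t \<le> real j + 1"
    unfolding j_def by linarith+
  then show "real j / real (Suc n) < t" "t \<le> real (Suc j) / real (Suc n)"
    by (simp_all add: field_simps)
qed

lemma lower_grid_bounds: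
  assumes "0 < t"
  shows "lower_grid n t < t" "t - 1 / real (Suc n) \<le> lower_grid n t"
proof -
  obtain j where j: "real j / real (Suc n) < t" "t \<le> real (Suc j) / real (Suc n)"
    by (rule lower_grid_cell_exists[OF assms])
  then show "lower_grid n t < t" "t - 1 / real (Suc n) \<le> lower_grid n t"
    unfolding lower_grid_cell[OF j] by (simp_all add: add_divide_distrib)
qed

lemma lower_grid_tendsto:
  assumes "0 < t"
  shows "(\<lambda>n. lower_grid n t) \<longlonglongrightarrow> t"
  by (rule tendsto_sandwich[where f = "\<lambda>n. t - 1 / real (Suc n)" and h = "\<lambda>n. t"])
     (use lower_grid_bounds[OF assms] tendsto_diff[OF tendsto_const tendsto_inverse_Suc, of t]
      in \<open>auto intro!: always_eventually less_imp_le\<close>)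

lemma filterlim_lower_grid: "0 < t \<Longrightarrow> filterlim (\<lambda>n. lower_grid n t) (at_left t) sequentially"
  unfolding filterlim_at using lower_grid_tendsto lower_grid_bounds(1)
  by (auto intro!: always_eventually simp: less_imp_neq)

context usual_filtered_prob_space
begin

lemma space_predictable_sigma: "space (predictable_sigma F) = {0..} \<times> space M"
  unfolding predictable_sigma_def by (simp add: space_F space_measure_of_conv)

lemma predictable_generator_subset:
  "{{0} \<times> B | B. B \<in> sets (F 0)} \<union>
      {{s<..t} \<times> B | s t B. 0 \<le> s \<and> s \<le> t \<and> B \<in> sets (F (ennreal s))} \<subseteq> Pow ({0..} \<times> space (F 0))"
  using sets.sets_into_space[of _ "F _"] by (fastforce simp: space_F)

lemma sets_predictable_sigma: "sets (predictable_sigma F) = sigma_sets ({0..} \<times> space M)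
     ({{0} \<times> B | B. B \<in> sets (F 0)} \<union>
      {{s<..t} \<times> B | s t B. 0 \<le> s \<and> s \<le> t \<and> B \<in> sets (F (ennreal s))})"
  unfolding predictable_sigma_def
  using sets_measure_of[OF predictable_generator_subset] by (simp add: space_F)

lemma predictable_rectangle_0: "B \<in> sets (F 0) \<Longrightarrow> {0} \<times> B \<in> sets (predictable_sigma F)"
  unfolding sets_predictable_sigma by (intro sigma_sets.Basic) auto

lemma predictable_rectangle:
  "0 \<le> s \<Longrightarrow> B \<in> sets (F (ennreal s)) \<Longrightarrow> {s<..t} \<times> B \<in> sets (predictable_sigma F)"
proof (cases "s \<le> t")
  assume "0 \<le> s" "B \<in> sets (F (ennreal s))" "s \<le> t"
  then show ?thesis unfolding sets_predictable_sigma by (intro sigma_sets.Basic) auto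
qed simp

lemma predictable_halfline:
  assumes "0 \<le> s" "B \<in> sets (F (ennreal s))"
  shows "{s<..} \<times> B \<in> sets (predictable_sigma F)"
proof -
  have "{s<..} \<times> B = (\<Union>n::nat. {s<..real n} \<times> B)"
    using real_arch_simple by auto
  also have "\<dots> \<in> sets (predictable_sigma F)"
    by (intro sets.countable_UN) (use predictable_rectangle[OF assms] in auto)
  finally show ?thesis .
qed

lemma predictable_cylinder:
  assumes "B \<in> sets (F 0)"
  shows "{0..} \<times> B \<in> sets (predictable_sigma F)"
proof -
  have "{0::real..} \<times> B = {0} \<times> B \<union> {0<..} \<times> B" by auto
  also have "\<dots> \<in> sets (predictable_sigma F)"
    using assms by (intro sets.Un predictable_rectangle_0 predictable_halfline) auto
  finally show ?thesis .
qed

lemma predictable_lower_grid: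
  assumes f: "adapted F f"
  shows "predictable F (\<lambda>t \<omega>. f (lower_grid n t) \<omega>)"
  unfolding predictable_def
proof (rule measurableI)
  fix S :: "real set" assume S: "S \<in> sets borel"
  define B where "B = (\<lambda>t. {\<omega> \<in> space M. f t \<omega> \<in> S})"
  have B: "B t \<in> sets (F (ennreal t))" if "0 \<le> t" for t
    using measurable_sets[OF _ S, of "f t" "F (ennreal t)"] f that
    by (auto simp: adapted_def B_def vimage_def Int_def space_F conj_commute)
  have "(\<lambda>(t, \<omega>). f (lower_grid n t) \<omega>) -` S \<inter> space (predictable_sigma F) =
    {0} \<times> B 0 \<union> (\<Union>j. {real j / real (Suc n)<..real (Suc j) / real (Suc n)} \<times> B (real j / real (Suc n)))"
    (is "?L = ?R")
  proof (intro set_eqI, clarify)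
    fix t \<omega>
    show "(t, \<omega>) \<in> ?L \<longleftrightarrow> (t, \<omega>) \<in> ?R"
    proof (cases "t > 0")
      case True
      then obtain j where j: "real j / real (Suc n) < t" "t \<le> real (Suc j) / real (Suc n)"
        by (rule lower_grid_cell_exists)
      have "(t, \<omega>) \<in> ?L \<longleftrightarrow> \<omega> \<in> B (lower_grid n t)" using True by (auto simp: space_predictable_sigma B_def)
      also have "\<dots> \<longleftrightarrow> (\<exists>i. real i / real (Suc n) < t \<and> t \<le> real (Suc i) / real (Suc n) \<and> \<omega> \<in> B (real i / real (Suc n)))"
        using lower_grid_cell[of _ n t] j by metis
      also have "\<dots> \<longleftrightarrow> (t, \<omega>) \<in> ?R" using True by auto
      finally show ?thesis .
    next
      case False
      have "lower_grid n 0 = 0" by (simp add: lower_grid_def)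
      moreover have "\<not> real j / real (Suc n) < t" for j
        using False by (simp add: not_less order_trans[of t 0])
      ultimately show ?thesis using False by (cases "t = 0") (auto simp: space_predictable_sigma B_def)
    qed
  qed
  also have "\<dots> \<in> sets (predictable_sigma F)"
    using B[of 0] B[of "real j / real (Suc n)" for j]
    by (intro sets.Un predictable_rectangle_0 sets.countable_UN) (auto intro!: predictable_rectangle)
  finally show "(\<lambda>(t, \<omega>). f (lower_grid n t) \<omega>) -` S \<inter> space (predictable_sigma F) \<in> sets (predictable_sigma F)" .
qed simp

text \<open>
  Covers both left-continuous processes (\<open>g = f\<close>) and the left limits of a given process.
\<close>

lemma predictable_of_left_approximation:
  assumes f: "adapted F f"
    and lim: "\<And>t \<omega>. 0 < t \<Longrightarrow> \<omega> \<in> space M \<Longrightarrow> ((\<lambda>s. f s \<omega>) \<longlongrightarrow> g t \<omega>) (at_left t)"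
    and 0: "\<And>\<omega>. \<omega> \<in> space M \<Longrightarrow> g 0 \<omega> = f 0 \<omega>"
  shows "predictable F g"
  unfolding predictable_def
proof (rule borel_measurable_LIMSEQ_metric)
  show "(\<lambda>(t, \<omega>). f (lower_grid n t) \<omega>) \<in> borel_measurable (predictable_sigma F)" for n
    using predictable_lower_grid[OF f] by (simp add: predictable_def)
  fix x assume "x \<in> space (predictable_sigma F)"
  then obtain t \<omega> where x: "x = (t, \<omega>)" "0 \<le> t" "\<omega> \<in> space M" by (auto simp: space_predictable_sigma)
  show "(\<lambda>n. case x of (t, \<omega>) \<Rightarrow> f (lower_grid n t) \<omega>) \<longlonglongrightarrow> (case x of (t, \<omega>) \<Rightarrow> g t \<omega>)"
  proof (cases "t = 0")
    case True
    then show ?thesis using 0[OF x(3)] x(1) by (simp add: lower_grid_def)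
  next
    case False
    then have "0 < t" using x by simp
    from filterlim_compose[OF lim[OF this x(3)] filterlim_lower_grid[OF this]]
    show ?thesis by (simp add: x(1))
  qed
qed

section \<open>Regularity of measures on the predictable sigma-algebra\<close>

text \<open>
  These functions play the part of continuous functions in the usual proof that finite measures on metric spaces
  are regular, and the sets where they are positive that of open sets.
\<close>

definition continuous_test :: "(real \<Rightarrow> 'a \<Rightarrow> real) \<Rightarrow> bool" where
  "continuous_test f \<longleftrightarrow> adapted F f \<and> (\<forall>\<omega>\<in>space M. continuous_on UNIV (\<lambda>t. f t \<omega>)) \<and>
     (\<forall>t \<omega>. 0 \<le> f t \<omega> \<and> f t \<omega> \<le> 1)"

definition positivity_set :: "(real \<Rightarrow> 'a \<Rightarrow> real) \<Rightarrow> (real \<times> 'a) set" where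
  "positivity_set f = {x \<in> space (predictable_sigma F). f (fst x) (snd x) > 0}"

lemma predictable_continuous_test:
  assumes "continuous_test f"
  shows "predictable F f"
proof (rule predictable_of_left_approximation)
  show "adapted F f" using assms by (simp add: continuous_test_def)
  show "((\<lambda>s. f s \<omega>) \<longlongrightarrow> f t \<omega>) (at_left t)" if "\<omega> \<in> space M" for t \<omega>
    using assms that unfolding continuous_test_def
    by (auto simp: continuous_on_def intro: tendsto_mono[OF at_le])
qed simp

lemma positivity_set_sets[measurable]:
  assumes "continuous_test f"
  shows "positivity_set f \<in> sets (predictable_sigma F)"
  using predictable_continuous_test[OF assms] unfolding predictable_def positivity_set_def
  by (simp add: case_prod_beta')

lemma continuous_test_ramp:
  assumes "B \<in> sets (F (ennreal s))" "0 \<le> s"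
  shows "continuous_test (\<lambda>t \<omega>. indicator B \<omega> * max 0 (min 1 (t - s)))"
  unfolding continuous_test_def adapted_def
proof (intro conjI allI impI ballI)
  fix t :: real assume "0 \<le> t"
  show "(\<lambda>\<omega>. indicator B \<omega> * max 0 (min 1 (t - s))) \<in> borel_measurable (F (ennreal t))"
  proof (cases "s \<le> t")
    case True
    then have "B \<in> sets (F (ennreal t))" using assms sets_F_mono[OF ennreal_leI] by blast
    then show ?thesis by simp
  qed simp
qed (auto intro!: continuous_intros simp: mult_le_one indicator_def)

lemma continuous_test_indicator:
  assumes "B \<in> sets (F 0)"
  shows "continuous_test (\<lambda>t \<omega>. indicator B \<omega>)"
  unfolding continuous_test_def adapted_def
proof (intro conjI allI impI ballI)
  fix t :: real assume "0 \<le> t"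
  have "B \<in> sets (F (ennreal t))" using assms sets_F_mono[of 0 "ennreal t"] by auto
  then show "indicator B \<in> borel_measurable (F (ennreal t))" by simp
qed (auto simp: indicator_def)

text \<open>
  Conversely to \<open>positivity_set_sets\<close>: the generating rectangles are differences of positivity sets, because
  \<open>(t - s)\<^sup>+\<close> restricted to an event of \<open>F s\<close> is adapted.
\<close>

lemma predictable_sigma_sets_subset:
  assumes "A \<in> sets (predictable_sigma F)"
  shows "A \<in> sigma_sets (space (predictable_sigma F)) (positivity_set ` Collect continuous_test)"
proof -
  let ?\<Omega> = "space (predictable_sigma F)" and ?G = "positivity_set ` Collect continuous_test"
  interpret S: sigma_algebra ?\<Omega> "sigma_sets ?\<Omega> ?G"
    by (intro sigma_algebra_sigma_sets) (auto simp: positivity_set_def)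
  have basic: "positivity_set f \<in> sigma_sets ?\<Omega> ?G" if "continuous_test f" for f
    using that by (intro sigma_sets.Basic) auto
  have "A \<in> sigma_sets ?\<Omega> ({{0} \<times> B | B. B \<in> sets (F 0)} \<union>
      {{s<..t} \<times> B | s t B. 0 \<le> s \<and> s \<le> t \<and> B \<in> sets (F (ennreal s))})"
    using assms by (simp add: sets_predictable_sigma space_predictable_sigma)
  then show ?thesis
  proof (rule subsetD[OF S.sigma_sets_subset, rotated], intro subsetI, elim UnE)
    fix A' assume "A' \<in> {{0::real} \<times> B | B. B \<in> sets (F 0)}"
    then obtain B where B: "A' = {0} \<times> B" "B \<in> sets (F 0)" by auto
    have "A' = positivity_set (\<lambda>t \<omega>. indicator B \<omega>) -
        positivity_set (\<lambda>t \<omega>. indicator (space M) \<omega> * max 0 (min 1 (t - 0)))"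
      using sets.sets_into_space[OF B(2)] unfolding B(1)
      by (auto simp: positivity_set_def space_predictable_sigma space_F indicator_def)
    also have "\<dots> \<in> sigma_sets ?\<Omega> ?G"
      using B(2) sets.top[of "F (ennreal 0)"]
      by (intro S.Diff basic continuous_test_indicator continuous_test_ramp) (auto simp: space_F)
    finally show "A' \<in> sigma_sets ?\<Omega> ?G" .
  next
    fix A' assume "A' \<in> {{s<..t} \<times> B | s t B. 0 \<le> s \<and> s \<le> t \<and> B \<in> sets (F (ennreal s))}"
    then obtain s t B where B: "A' = {s<..t} \<times> B" "0 \<le> s" "s \<le> t" "B \<in> sets (F (ennreal s))" by auto
    have "A' = positivity_set (\<lambda>x \<omega>. indicator B \<omega> * max 0 (min 1 (x - s))) -
        positivity_set (\<lambda>x \<omega>. indicator (space M) \<omega> * max 0 (min 1 (x - t)))"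
      using sets.sets_into_space[OF B(4)] B(2,3) unfolding B(1)
      by (auto simp: positivity_set_def space_predictable_sigma space_F indicator_def split: if_splits)
    also have "\<dots> \<in> sigma_sets ?\<Omega> ?G"
      using B sets.top[of "F (ennreal t)"]
      by (intro S.Diff basic continuous_test_ramp) (auto simp: space_F)
    finally show "A' \<in> sigma_sets ?\<Omega> ?G" .
  qed
qed

lemma continuous_test_product:
  assumes "\<And>i. continuous_test (g i)"
  shows "continuous_test (\<lambda>t \<omega>. \<Prod>i\<le>n. g i t \<omega>)"
  using assms unfolding continuous_test_def adapted_def
  by (auto intro!: borel_measurable_prod continuous_on_prod prod_nonneg prod_le_1)

text \<open>
  Positivity sets are closed under countable unions.
\<close>

lemma continuous_test_series:
  fixes f :: "nat \<Rightarrow> real \<Rightarrow> 'a \<Rightarrow> real"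
  assumes f: "\<And>i. continuous_test (f i)"
  defines "S \<equiv> (\<lambda>t \<omega>. \<Sum>i. (1/2) ^ Suc i * f i t \<omega>)"
  shows "continuous_test S" and "S t \<omega> > 0 \<longleftrightarrow> (\<exists>i. f i t \<omega> > 0)"
proof -
  have bnd: "0 \<le> f i t \<omega>" "f i t \<omega> \<le> 1" for i t \<omega> using f by (auto simp: continuous_test_def)
  have half: "(\<lambda>n. (1/2::real) ^ Suc n) sums 1" by (rule power_half_series)
  have le: "(1/2) ^ Suc i * f i t \<omega> \<le> (1/2) ^ Suc i" for i t \<omega>
    using bnd[of i t \<omega>] by (intro mult_left_le) auto
  have nonneg: "0 \<le> (1/2) ^ Suc i * f i t \<omega>" for i t \<omega> using bnd[of i t \<omega>] by simp
  have summ: "summable (\<lambda>i. (1/2) ^ Suc i * f i t \<omega>)" for t \<omega>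
    by (rule summable_comparison_test'[OF sums_summable[OF half], of 0]) (use le nonneg in auto)
  show "S t \<omega> > 0 \<longleftrightarrow> (\<exists>i. f i t \<omega> > 0)"
  proof -
    have "S t \<omega> > 0 \<longleftrightarrow> (\<exists>i. 0 < (1/2) ^ Suc i * f i t \<omega>)"
      unfolding S_def by (rule suminf_pos_iff[OF summ nonneg])
    then show ?thesis by (auto simp: zero_less_mult_iff)
  qed
  show "continuous_test S"
    unfolding continuous_test_def adapted_def
  proof (intro conjI allI impI ballI)
    fix t :: real assume "0 \<le> t"
    then have "f i t \<in> borel_measurable (F (ennreal t))" for i using f by (auto simp: continuous_test_def adapted_def)
    then show "S t \<in> borel_measurable (F (ennreal t))" unfolding S_def by measurable
  next
    fix \<omega> assume \<omega>: "\<omega> \<in> space M"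
    show "continuous_on UNIV (\<lambda>t. S t \<omega>)" unfolding S_def
    proof (rule uniform_limit_theorem)
      show "uniform_limit UNIV (\<lambda>n t. \<Sum>i<n. (1/2) ^ Suc i * f i t \<omega>) (\<lambda>t. \<Sum>i. (1/2) ^ Suc i * f i t \<omega>) sequentially"
        by (rule Weierstrass_m_test[OF _ sums_summable[OF half]]) (use le nonneg in auto)
      show "\<forall>\<^sub>F n in sequentially. continuous_on UNIV (\<lambda>t. \<Sum>i<n. (1/2) ^ Suc i * f i t \<omega>)"
        using f \<omega> by (auto simp: continuous_test_def intro!: always_eventually continuous_on_sum continuous_on_mult continuous_on_const simp del: power_Suc)
    qed simp
  next
    fix t \<omega>
    show "0 \<le> S t \<omega>" unfolding S_def by (rule suminf_nonneg[OF summ nonneg])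
    show "S t \<omega> \<le> 1" unfolding S_def
      using suminf_le[OF le summ sums_summable[OF half]] sums_unique[OF half] by simp
  qed
qed

text \<open>
  The sets that can be enclosed, together with their complements, in positivity sets with small overlap form a
  \<open>\<sigma>\<close>-algebra. It contains each \<open>{f > 0}\<close>, whose complement is enclosed in \<open>{f < 1 / (k + 1)}\<close>. For a countable union,
  infinitely many enclosures of the sets are joined, but only finitely many enclosures of the complements can be
  intersected; continuity of the measure from above makes up for the rest.
\<close>

theorem predictable_regularity:
  assumes \<nu>: "finite_measure \<nu>" "sets \<nu> = sets (predictable_sigma F)"
    and A: "A \<in> sets (predictable_sigma F)" and e: "(e::real) > 0"
  shows "\<exists>f g. continuous_test f \<and> continuous_test g \<and> A \<subseteq> positivity_set f \<and>
     space (predictable_sigma F) - A \<subseteq> positivity_set g \<and>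
     measure \<nu> (positivity_set f \<inter> positivity_set g) < e"
proof -
  interpret \<nu>: finite_measure \<nu> by (rule \<nu>(1))
  have pos: "positivity_set f \<in> sets \<nu>" if "continuous_test f" for f
    using positivity_set_sets[OF that] \<nu>(2) by simp
  let ?\<Omega> = "space (predictable_sigma F)"
  from predictable_sigma_sets_subset[OF A] e show ?thesis
  proof (induction A arbitrary: e)
    case (Basic A)
    then obtain f where f: "continuous_test f" "A = positivity_set f" by auto
    (* positive exactly where f < 1 / (k + 1) *)
    define g where "g = (\<lambda>(k::nat) t \<omega>. max 0 (1 / real (Suc k) - f t \<omega>))"
    have g: "continuous_test (g k)" for k
      using f(1) unfolding continuous_test_def adapted_def g_def
      by (auto intro!: continuous_intros simp: field_simps intro: add_increasing2)
    have "(\<lambda>k. measure \<nu> (positivity_set f \<inter> positivity_set (g k))) \<longlonglongrightarrow>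
        measure \<nu> (\<Inter>k. positivity_set f \<inter> positivity_set (g k))"
    proof (rule \<nu>.finite_Lim_measure_decseq)
      show "range (\<lambda>k. positivity_set f \<inter> positivity_set (g k)) \<subseteq> sets \<nu>" using pos f g by auto
      have "1 / real (Suc n) \<le> 1 / real (Suc m)" if "m \<le> n" for m n
        using that by (simp add: frac_le)
      then show "decseq (\<lambda>k. positivity_set f \<inter> positivity_set (g k))"
        by (fastforce simp: decseq_def positivity_set_def g_def)
    qed
    moreover have "(\<Inter>k. positivity_set f \<inter> positivity_set (g k)) = {}"
    proof (intro equals0I)
      fix x assume x: "x \<in> (\<Inter>k. positivity_set f \<inter> positivity_set (g k))"
      then have "f (fst x) (snd x) > 0" by (auto simp: positivity_set_def)
      then obtain k :: nat where "inverse (real (Suc k)) < f (fst x) (snd x)" using reals_Archimedean by blast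
      then have "g k (fst x) (snd x) = 0" by (simp add: g_def inverse_eq_divide)
      moreover have "g k (fst x) (snd x) > 0" using x by (auto simp: positivity_set_def)
      ultimately show False by simp
    qed
    ultimately have "(\<lambda>k. measure \<nu> (positivity_set f \<inter> positivity_set (g k))) \<longlonglongrightarrow> 0" by simp
    from order_tendstoD(2)[OF this Basic(2)]
    obtain k where k: "measure \<nu> (positivity_set f \<inter> positivity_set (g k)) < e"
      by (auto simp: eventually_sequentially)
    have "?\<Omega> - A \<subseteq> positivity_set (g k)"
      by (auto simp: f(2) positivity_set_def g_def less_max_iff_disj not_less intro: le_less_trans)
    then show ?case using f g k by (intro exI[of _ f] exI[of _ "g k"]) auto
  next
    case Empty
    have "continuous_test (\<lambda>t \<omega>. 0)" "continuous_test (\<lambda>t \<omega>. 1)"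
      by (auto simp: continuous_test_def adapted_def)
    then show ?case using Empty
      by (intro exI[of _ "\<lambda>t \<omega>. 0"] exI[of _ "\<lambda>t \<omega>. 1"]) (auto simp: positivity_set_def)
  next
    case (Compl A)
    from Compl.IH[OF Compl.prems] obtain f g where "continuous_test f" "continuous_test g"
      "A \<subseteq> positivity_set f" "?\<Omega> - A \<subseteq> positivity_set g"
      "measure \<nu> (positivity_set f \<inter> positivity_set g) < e" by blast
    then show ?case by (intro exI[of _ g] exI[of _ f]) (auto simp: Int_commute)
  next
    case (Union A)
    have "\<exists>f g. continuous_test f \<and> continuous_test g \<and> A i \<subseteq> positivity_set f \<and>
     ?\<Omega> - A i \<subseteq> positivity_set g \<and> measure \<nu> (positivity_set f \<inter> positivity_set g) < e / 2 * (1/2) ^ Suc i" for i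
      by (rule Union.IH) (use Union.prems in auto)
    then obtain f g where fg: "\<And>i. continuous_test (f i)" "\<And>i. continuous_test (g i)"
      "\<And>i. A i \<subseteq> positivity_set (f i)" "\<And>i. ?\<Omega> - A i \<subseteq> positivity_set (g i)"
      "\<And>i::nat. measure \<nu> (positivity_set (f i) \<inter> positivity_set (g i)) < e / 2 * (1/2) ^ Suc i" by metis
    define S where "S = (\<lambda>t \<omega>. \<Sum>i. (1/2) ^ Suc i * f i t \<omega>)"
    define P where "P = (\<lambda>n t \<omega>. \<Prod>i\<le>n. g i t \<omega>)"
    have S: "continuous_test S" "\<And>t \<omega>. S t \<omega> > 0 \<longleftrightarrow> (\<exists>i. f i t \<omega> > 0)"
      unfolding S_def by (rule continuous_test_series[OF fg(1)])+
    have P: "continuous_test (P n)" for n unfolding P_def by (rule continuous_test_product[OF fg(2)])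
    have g_nonneg: "0 \<le> g i t \<omega>" for i t \<omega> using fg(2) by (auto simp: continuous_test_def)
    have P_pos: "P n t \<omega> > 0 \<longleftrightarrow> (\<forall>i\<le>n. g i t \<omega> > 0)" for n t \<omega>
    proof
      assume "P n t \<omega> > 0"
      then have "\<forall>i\<le>n. g i t \<omega> \<noteq> 0" unfolding P_def by (metis atMost_iff finite_atMost less_irrefl prod_zero)
      then show "\<forall>i\<le>n. g i t \<omega> > 0" using g_nonneg by (metis less_eq_real_def)
    qed (auto simp: P_def intro!: prod_pos)
    have "(\<lambda>n. measure \<nu> (positivity_set S \<inter> positivity_set (P n))) \<longlonglongrightarrow>
        measure \<nu> (\<Inter>n. positivity_set S \<inter> positivity_set (P n))"
    proof (rule \<nu>.finite_Lim_measure_decseq)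
      show "range (\<lambda>n. positivity_set S \<inter> positivity_set (P n)) \<subseteq> sets \<nu>" using pos S P by auto
      show "decseq (\<lambda>n. positivity_set S \<inter> positivity_set (P n))"
        by (auto simp: decseq_def positivity_set_def P_pos)
    qed
    note lim = this
    have small: "measure \<nu> (\<Inter>n. positivity_set S \<inter> positivity_set (P n)) \<le> e / 2"
    proof -
      have half: "(\<lambda>n. e / 2 * (1/2::real) ^ Suc n) sums (e / 2)"
        using sums_mult[OF power_half_series, of "e / 2"] by simp
      have sm: "summable (\<lambda>i. measure \<nu> (positivity_set (f i) \<inter> positivity_set (g i)))"
        by (rule summable_comparison_test'[OF sums_summable[OF half], of 0])
           (use fg(5) in \<open>auto intro: less_imp_le\<close>)
      have "measure \<nu> (\<Inter>n. positivity_set S \<inter> positivity_set (P n)) \<le>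
          measure \<nu> (\<Union>i. positivity_set (f i) \<inter> positivity_set (g i))"
      proof (rule \<nu>.finite_measure_mono)
        show "(\<Inter>n. positivity_set S \<inter> positivity_set (P n)) \<subseteq> (\<Union>i. positivity_set (f i) \<inter> positivity_set (g i))"
          by (auto simp: positivity_set_def P_pos S(2))
        show "(\<Union>i. positivity_set (f i) \<inter> positivity_set (g i)) \<in> sets \<nu>"
          using pos fg by auto
      qed
      also have "\<dots> \<le> (\<Sum>i. measure \<nu> (positivity_set (f i) \<inter> positivity_set (g i)))"
        by (rule \<nu>.finite_measure_subadditive_countably) (use pos fg sm in auto)
      also have "\<dots> \<le> (\<Sum>i. e / 2 * (1/2) ^ Suc i)"
        by (rule suminf_le[OF less_imp_le[OF fg(5)] sm sums_summable[OF half]])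
      also have "\<dots> = e / 2" using sums_unique[OF half] by simp
      finally show ?thesis .
    qed
    have "e / 2 < e" using Union.prems by simp
    from order_tendstoD(2)[OF lim le_less_trans[OF small this]]
    obtain n where n: "measure \<nu> (positivity_set S \<inter> positivity_set (P n)) < e"
      by (auto simp: eventually_sequentially)
    have "\<Union>(range A) \<subseteq> positivity_set S" using fg(3) by (fastforce simp: positivity_set_def S(2))
    moreover have "?\<Omega> - \<Union>(range A) \<subseteq> positivity_set (P n)"
      using fg(4) by (fastforce simp: positivity_set_def P_pos)
    ultimately show ?case using S(1) P n by (intro exI[of _ S] exI[of _ "P n"]) auto
  qed
qed

end

section \<open>Hitting times\<close>

text \<open>
  Only rational times are inspected, so that this is a stopping time for every adapted process. For right-continuous
  paths it is the first time after which the level \<open>b\<close> is exceeded immediately.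
\<close>

definition hitting_time :: "(real \<Rightarrow> 'a \<Rightarrow> real) \<Rightarrow> real \<Rightarrow> 'a \<Rightarrow> ennreal" where
  "hitting_time Y b \<omega> = (INF q\<in>{q \<in> \<rat>. 0 \<le> q \<and> Y q \<omega> > b}. ennreal q)"

lemma hitting_time_less_iff:
  "hitting_time Y b \<omega> < t \<longleftrightarrow> (\<exists>q\<in>\<rat>. 0 \<le> q \<and> ennreal q < t \<and> Y q \<omega> > b)"
  unfolding hitting_time_def INF_less_iff by auto

lemma le_before_hitting_time:
  assumes f: "cadlag (\<lambda>t. Y t \<omega>)" and s: "0 \<le> s" "ennreal s < hitting_time Y b \<omega>"
  shows "Y s \<omega> \<le> b"
proof (rule ccontr)
  assume "\<not> ?thesis"
  then have b: "b < Y s \<omega>" by simp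
  have "((\<lambda>t. Y t \<omega>) \<longlongrightarrow> Y s \<omega>) (at_right s)" using f s by (auto simp: cadlag_def)
  from order_tendstoD(1)[OF this b] obtain s0 where s0: "s < s0" "\<And>q. s < q \<Longrightarrow> q < s0 \<Longrightarrow> b < Y q \<omega>"
    unfolding eventually_at_right_field by blast
  have "\<exists>s1>s. ennreal s1 \<le> hitting_time Y b \<omega>"
  proof (cases "hitting_time Y b \<omega>")
    case (real r)
    then show ?thesis using s by (intro exI[of _ r]) (auto simp: ennreal_less_iff)
  next
    case top
    then show ?thesis by (intro exI[of _ "s + 1"]) auto
  qed
  then obtain s1 where s1: "s < s1" "ennreal s1 \<le> hitting_time Y b \<omega>" by blast
  have "s < min s0 s1" using s0 s1 by simp
  then obtain q where q: "q \<in> \<rat>" "s < q" "q < min s0 s1" using Rats_dense_in_real by blast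
  then have "ennreal q < ennreal s1" using s by (auto intro: ennreal_lessI)
  then have "ennreal q < hitting_time Y b \<omega>" using s1(2) by (rule less_le_trans)
  moreover have "hitting_time Y b \<omega> \<le> ennreal q"
    unfolding hitting_time_def using q s s0(2)[of q] by (intro INF_lower) auto
  ultimately show False by simp
qed

lemma hitting_time_le:
  assumes "cadlag (\<lambda>t. Y t \<omega>)" "0 \<le> s" "b < Y s \<omega>"
  shows "hitting_time Y b \<omega> \<le> ennreal s"
  using le_before_hitting_time[where Y = Y and \<omega> = \<omega> and b = b, OF assms(1,2)] assms(3) by (meson leD leI)

lemma ge_at_hitting_time:
  assumes f: "cadlag (\<lambda>t. Y t \<omega>)" and r: "hitting_time Y b \<omega> = ennreal r" "0 \<le> r"
  shows "b \<le> Y r \<omega>"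
proof -
  have "\<exists>q. r \<le> q \<and> q < r + 1 / real (Suc n) \<and> b < Y q \<omega>" for n :: nat
  proof -
    have "hitting_time Y b \<omega> < ennreal (r + 1 / real (Suc n))"
      unfolding r(1) using r(2) by (intro ennreal_lessI add_nonneg_pos) auto
    then obtain q where q: "0 \<le> q" "ennreal q < ennreal (r + 1 / real (Suc n))" "b < Y q \<omega>" "q \<in> \<rat>"
      unfolding hitting_time_less_iff by blast
    have "hitting_time Y b \<omega> \<le> ennreal q" unfolding hitting_time_def using q by (intro INF_lower) auto
    then have "r \<le> q" using r q by simp
    moreover have "q < r + 1 / real (Suc n)" using q(1,2) by (simp add: ennreal_less_iff)
    ultimately show ?thesis using q(3) by blast
  qed
  then obtain q where q: "\<And>n. r \<le> q n" "\<And>n::nat. q n < r + 1 / real (Suc n)" "\<And>n. b < Y (q n) \<omega>" by metis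
  have "q \<longlonglongrightarrow> r"
    by (rule tendsto_sandwich[where f = "\<lambda>_. r" and h = "\<lambda>n. r + 1 / real (Suc n)"])
       (use q tendsto_add[OF tendsto_const tendsto_inverse_Suc, of r] in \<open>auto intro!: always_eventually less_imp_le\<close>)
  then have "(\<lambda>n. Y (q n) \<omega>) \<longlonglongrightarrow> Y r \<omega>"
    by (rule cadlag_tendsto_right[OF f r(2)]) (use q in auto)
  then show ?thesis by (rule LIMSEQ_le_const) (use q(3) in \<open>auto intro: less_imp_le\<close>)
qed

lemma cadlag_of_continuous:
  assumes "continuous_on UNIV f"
  shows "cadlag f"
  using assms unfolding cadlag_def continuous_on_def
  by (auto intro!: exI[of _ "f _"] intro: tendsto_mono[OF at_le])

context usual_filtered_prob_space
begin

lemma stopping_time_hitting_time: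
  assumes Y: "adapted F Y"
  shows "stopping_time F (hitting_time Y b)"
proof (rule stopping_timeI_less)
  fix t :: ennreal
  have "{\<omega> \<in> space M. hitting_time Y b \<omega> < t} =
      (\<Union>q\<in>{q \<in> \<rat>. 0 \<le> q \<and> ennreal q < t}. {\<omega> \<in> space (F t). Y q \<omega> > b})"
    unfolding hitting_time_less_iff by (auto simp: space_F)
  also have "\<dots> \<in> sets (F t)"
  proof (rule sets.countable_UN'')
    show "countable {q \<in> \<rat>. 0 \<le> q \<and> ennreal q < t}"
      using countable_rat by (rule countable_subset[rotated]) auto
    fix q assume "q \<in> {q \<in> \<rat>. 0 \<le> q \<and> ennreal q < t}"
    then have [measurable]: "Y q \<in> borel_measurable (F t)"
      using Y unfolding adapted_def by (intro measurable_F_mono[of "Y q" "ennreal q" t]) auto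
    show "{\<omega> \<in> space (F t). Y q \<omega> > b} \<in> sets (F t)" by measurable
  qed
  finally show "{\<omega> \<in> space M. hitting_time Y b \<omega> < t} \<in> sets (F t)" .
qed

section \<open>Announcing predictable times\<close>

lemma stopping_time_measurable_M: "stopping_time F T \<Longrightarrow> T \<in> borel_measurable M"
  using measurable_stopping_time[of F T M] sets_F_subset by (auto simp: space_F)

lemma measurable_time_graph:
  assumes T: "T \<in> borel_measurable M"
  shows "(\<lambda>\<omega>. (enn2real (T \<omega>), \<omega>)) \<in> measurable M (predictable_sigma F)"
  unfolding predictable_sigma_def
proof (rule measurable_measure_of[OF predictable_generator_subset])
  show "(\<lambda>\<omega>. (enn2real (T \<omega>), \<omega>)) \<in> space M \<rightarrow> {0..} \<times> space (F 0)" by (auto simp: space_F)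
  have [measurable]: "(\<lambda>\<omega>. enn2real (T \<omega>)) \<in> borel_measurable M" using T by measurable
  fix A assume "A \<in> {{0} \<times> B | B. B \<in> sets (F 0)} \<union>
      {{s<..t} \<times> B | s t B. 0 \<le> s \<and> s \<le> t \<and> B \<in> sets (F (ennreal s))}"
  then obtain I B where A: "A = I \<times> B" "I \<in> sets borel" "B \<in> sets M"
    using sets_F_M by auto
  have "(\<lambda>\<omega>. (enn2real (T \<omega>), \<omega>)) -` A \<inter> space M = ((\<lambda>\<omega>. enn2real (T \<omega>)) -` I \<inter> space M) \<inter> B"
    using sets.sets_into_space[OF A(3)] by (auto simp: A(1))
  also have "\<dots> \<in> sets M" using A(2,3) by measurable
  finally show "(\<lambda>\<omega>. (enn2real (T \<omega>), \<omega>)) -` A \<inter> space M \<in> sets M" .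
qed

lemma predictable_after_stopping_time:
  assumes T: "stopping_time F T"
  shows "{(t, \<omega>). 0 \<le> t \<and> \<omega> \<in> space M \<and> T \<omega> < ennreal t} \<in> sets (predictable_sigma F)"
proof -
  have "{(t, \<omega>). 0 \<le> t \<and> \<omega> \<in> space M \<and> T \<omega> < ennreal t} =
     (\<Union>q\<in>\<rat> \<inter> {0..}. {q<..} \<times> {\<omega> \<in> space (F (ennreal q)). T \<omega> \<le> ennreal q})" (is "?L = ?R")
  proof (intro set_eqI, clarify)
    fix t :: real and \<omega>
    have "(\<exists>q\<in>\<rat> \<inter> {0..}. q < t \<and> T \<omega> \<le> ennreal q)" if t: "0 \<le> t" "T \<omega> < ennreal t"
    proof -
      from t(2) obtain r where r: "0 \<le> r" "T \<omega> = ennreal r" by (cases "T \<omega>") auto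
      with t have "r < t" by (simp add: ennreal_less_iff)
      then obtain q where "q \<in> \<rat>" "r < q" "q < t" using Rats_dense_in_real by blast
      then show ?thesis using r by (intro bexI[of _ q]) (auto intro!: ennreal_leI)
    qed
    moreover have "T \<omega> < ennreal t" if "0 \<le> q" "q < t" "T \<omega> \<le> ennreal q" for q
      using that by (meson ennreal_lessI le_less_trans order_le_less_trans)
    ultimately show "(t, \<omega>) \<in> ?L \<longleftrightarrow> (t, \<omega>) \<in> ?R" by (auto simp: space_F)
  qed
  also have "\<dots> \<in> sets (predictable_sigma F)"
  proof (rule sets.countable_UN'')
    show "countable (\<rat> \<inter> {0..} :: real set)" using countable_rat by (rule countable_subset[rotated]) auto
    fix q :: real assume "q \<in> \<rat> \<inter> {0..}"
    then show "{q<..} \<times> {\<omega> \<in> space (F (ennreal q)). T \<omega> \<le> ennreal q} \<in> sets (predictable_sigma F)"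
      using stopping_timeD[OF T, of "ennreal q"] by (intro predictable_halfline) (auto simp: pred_def)
  qed
  finally show ?thesis .
qed

text \<open>
  Here \<open>T'\<close> agrees with \<open>T\<close> up to an event of small probability, on which it is set to infinity, and the times \<open>\<sigma> n\<close>
  approach \<open>T'\<close> strictly from below. They are the times at which a continuous adapted \<open>g\<close>, positive off the graph
  of \<open>T\<close> and zero on the graph outside a small event, falls below \<open>1 / (n + 1)\<close>. Continuity makes \<open>g\<close> small already
  before \<open>T'\<close>, and compactness keeps it away from zero on every \<open>[0, s]\<close> with \<open>s < T'\<close>.
\<close>

theorem predictable_time_announced:
  assumes T: "stopping_time F T" "predictable_time F T" "\<And>\<omega>. \<omega> \<in> space M \<Longrightarrow> 0 < T \<omega>" and e: "e > 0"
  obtains \<sigma> T' where "\<And>n::nat. stopping_time F (\<sigma> n)" "stopping_time F T'"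
    "\<And>\<omega>. \<omega> \<in> space M \<Longrightarrow> T' \<omega> = T \<omega> \<or> T' \<omega> = \<infinity>"
    "measure M {\<omega> \<in> space M. T \<omega> < \<infinity> \<and> T' \<omega> = \<infinity>} < e"
    "\<And>\<omega> n. \<omega> \<in> space M \<Longrightarrow> T' \<omega> < \<infinity> \<Longrightarrow> \<sigma> n \<omega> < T' \<omega>"
    "\<And>\<omega> r. \<omega> \<in> space M \<Longrightarrow> 0 \<le> r \<Longrightarrow> ennreal r < T' \<omega> \<Longrightarrow> eventually (\<lambda>n. ennreal r \<le> \<sigma> n \<omega>) sequentially"
proof -
  let ?P = "predictable_sigma F"
  have T_meas[measurable]: "T \<in> borel_measurable M" by (rule stopping_time_measurable_M[OF T(1)])
  define D where "D = {\<omega> \<in> space M. T \<omega> < \<infinity>}"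
  have D[measurable]: "D \<in> sets M" unfolding D_def by measurable
  define \<nu> where "\<nu> = distr (restrict_space M D) ?P (\<lambda>\<omega>. (enn2real (T \<omega>), \<omega>))"
  have graph[measurable]: "(\<lambda>\<omega>. (enn2real (T \<omega>), \<omega>)) \<in> measurable (restrict_space M D) ?P"
    by (rule measurable_restrict_space1[OF measurable_time_graph[OF T_meas]])
  have \<nu>: "finite_measure \<nu>" "sets \<nu> = sets ?P"
  proof -
    have "finite_measure (restrict_space M D)" by (rule finite_measure_restrict_space[OF _ D]) unfold_locales
    then show "finite_measure \<nu>" unfolding \<nu>_def by (rule finite_measure.finite_measure_distr[OF _ graph])
  qed (simp add: \<nu>_def)
  have \<nu>_eq: "measure \<nu> B = measure M {\<omega> \<in> D. (enn2real (T \<omega>), \<omega>) \<in> B}" if "B \<in> sets ?P" for B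
  proof -
    have "measure \<nu> B = measure (restrict_space M D) ((\<lambda>\<omega>. (enn2real (T \<omega>), \<omega>)) -` B \<inter> space (restrict_space M D))"
      unfolding \<nu>_def by (rule measure_distr[OF graph that])
    also have "\<dots> = measure M ((\<lambda>\<omega>. (enn2real (T \<omega>), \<omega>)) -` B \<inter> space (restrict_space M D))"
      by (rule measure_restrict_space) (use D sets.sets_into_space[OF D] in \<open>auto simp: space_restrict_space\<close>)
    also have "(\<lambda>\<omega>. (enn2real (T \<omega>), \<omega>)) -` B \<inter> space (restrict_space M D) = {\<omega> \<in> D. (enn2real (T \<omega>), \<omega>) \<in> B}"
      using sets.sets_into_space[OF D] by (auto simp: space_restrict_space)
    finally show ?thesis .
  qed
  (* the graph of T *)
  define A where "A = space ?P - {(t, \<omega>). 0 \<le> t \<and> \<omega> \<in> space (F 0) \<and> ennreal t < T \<omega>}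
      - {(t, \<omega>). 0 \<le> t \<and> \<omega> \<in> space M \<and> T \<omega> < ennreal t}"
  have A: "A \<in> sets ?P"
    unfolding A_def using T(2) predictable_after_stopping_time[OF T(1)]
    by (auto simp: predictable_time_def)
  have A_iff: "(t, \<omega>) \<in> A \<longleftrightarrow> 0 \<le> t \<and> \<omega> \<in> space M \<and> T \<omega> = ennreal t" for t \<omega>
    by (auto simp: A_def space_predictable_sigma space_F)
  obtain f g where fg: "continuous_test f" "continuous_test g" "A \<subseteq> positivity_set f"
     "space ?P - A \<subseteq> positivity_set g" "measure \<nu> (positivity_set f \<inter> positivity_set g) < e"
    using predictable_regularity[OF \<nu> A e] by blast
  define \<sigma> where "\<sigma> = (\<lambda>n::nat. hitting_time (\<lambda>t \<omega>. - g t \<omega>) (- (1 / real (Suc n))))"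
  define T' where "T' = (\<lambda>\<omega>. if T \<omega> < \<infinity> \<and> g (enn2real (T \<omega>)) \<omega> = 0 then T \<omega> else \<infinity>)"
  have g_nonneg: "0 \<le> g t \<omega>" for t \<omega> using fg(2) by (auto simp: continuous_test_def)
  have g_cont: "continuous_on UNIV (\<lambda>t. g t \<omega>)" if "\<omega> \<in> space M" for \<omega>
    using fg(2) that by (auto simp: continuous_test_def)
  have g_cadlag: "cadlag (\<lambda>t. - g t \<omega>)" if "\<omega> \<in> space M" for \<omega>
    by (intro cadlag_of_continuous continuous_on_minus g_cont that)
  have g_pos: "0 < g t \<omega>" if "\<omega> \<in> space M" "0 \<le> t" "ennreal t \<noteq> T' \<omega>" for t \<omega>
  proof (cases "T \<omega> = ennreal t")
    case True
    then have "g t \<omega> \<noteq> 0" using that by (auto simp: T'_def split: if_splits)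
    then show ?thesis using g_nonneg[of t \<omega>] by simp
  next
    case False
    then have "(t, \<omega>) \<in> space ?P - A" using that by (auto simp: A_iff space_predictable_sigma)
    with fg(4) show ?thesis by (auto simp: positivity_set_def)
  qed
  have st: "stopping_time F (\<sigma> n)" for n
    unfolding \<sigma>_def
    by (rule stopping_time_hitting_time) (use fg(2) in \<open>auto simp: continuous_test_def adapted_def\<close>)
  have T'_eq: "T' \<omega> = T \<omega> \<or> T' \<omega> = \<infinity>" for \<omega> by (auto simp: T'_def)
  have T'_small: "measure M {\<omega> \<in> space M. T \<omega> < \<infinity> \<and> T' \<omega> = \<infinity>} < e"
  proof -
    have "{\<omega> \<in> space M. T \<omega> < \<infinity> \<and> T' \<omega> = \<infinity>} = {\<omega> \<in> D. (enn2real (T \<omega>), \<omega>) \<in> positivity_set f \<inter> positivity_set g}"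
    proof -
      have "(enn2real (T \<omega>), \<omega>) \<in> A" if "\<omega> \<in> space M" "T \<omega> < \<infinity>" for \<omega>
        using that by (auto simp: A_iff less_top)
      with fg(3) have "(enn2real (T \<omega>), \<omega>) \<in> positivity_set f" if "\<omega> \<in> space M" "T \<omega> < \<infinity>" for \<omega>
        using that by blast
      then show ?thesis
        using g_nonneg by (auto simp: D_def T'_def positivity_set_def space_predictable_sigma less_le split: if_splits)
    qed
    then show ?thesis using fg(5) \<nu>_eq[of "positivity_set f \<inter> positivity_set g"]
      positivity_set_sets[OF fg(1)] positivity_set_sets[OF fg(2)] by auto
  qed
  have before: "\<sigma> n \<omega> < T' \<omega>" if \<omega>: "\<omega> \<in> space M" "T' \<omega> < \<infinity>" for \<omega> n
  proof -
    define r where "r = enn2real (T \<omega>)"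
    have r: "T' \<omega> = ennreal r" "T \<omega> = ennreal r" "g r \<omega> = 0"
      using \<omega> by (auto simp: T'_def r_def split: if_splits)
    have "0 < r" using T(3)[OF \<omega>(1)] r by simp
    have "((\<lambda>t. g t \<omega>) \<longlongrightarrow> g r \<omega>) (at_left r)"
      using g_cont[OF \<omega>(1)] by (auto simp: continuous_on_def intro: tendsto_mono[OF at_le])
    from order_tendstoD(2)[OF this, of "1 / real (Suc n)"]
    obtain r0 where r0: "r0 < r" "\<And>t. r0 < t \<Longrightarrow> t < r \<Longrightarrow> g t \<omega> < 1 / real (Suc n)"
      unfolding r(3) eventually_at_left_field by auto
    have "max 0 r0 < r" using r0(1) \<open>0 < r\<close> by simp
    then obtain q where q: "q \<in> \<rat>" "max 0 r0 < q" "q < r" using Rats_dense_in_real by blast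
    then show ?thesis unfolding \<sigma>_def hitting_time_less_iff r(1)
      using r0(2)[of q] by (intro bexI[of _ q]) (auto intro: ennreal_lessI)
  qed
  have after: "eventually (\<lambda>n. ennreal s \<le> \<sigma> n \<omega>) sequentially"
    if \<omega>: "\<omega> \<in> space M" and s: "0 \<le> s" "ennreal s < T' \<omega>" for \<omega> s
  proof -
    have pos: "0 < g t \<omega>" if "t \<in> {0..s}" for t
    proof (rule g_pos[OF \<omega>])
      have "ennreal t \<le> ennreal s" using that by (intro ennreal_leI) auto
      from le_less_trans[OF this s(2)] show "ennreal t \<noteq> T' \<omega>" by simp
    qed (use that in auto)
    have "\<exists>x\<in>{0..s}. \<forall>y\<in>{0..s}. g x \<omega> \<le> g y \<omega>"
      by (rule continuous_attains_inf) (use s g_cont[OF \<omega>] in \<open>auto intro: continuous_on_subset\<close>)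
    then obtain x where x: "x \<in> {0..s}" "\<And>y. y \<in> {0..s} \<Longrightarrow> g x \<omega> \<le> g y \<omega>" by blast
    from order_tendstoD(2)[OF tendsto_inverse_Suc pos[OF x(1)]] show ?thesis
    proof eventually_elim
      case (elim n)
      show "ennreal s \<le> \<sigma> n \<omega>"
      proof (rule ccontr)
        assume "\<not> ?thesis"
        then have "\<sigma> n \<omega> < ennreal s" by simp
        then obtain q where "0 \<le> q" "ennreal q < ennreal s" "g q \<omega> < 1 / real (Suc n)"
          unfolding \<sigma>_def hitting_time_less_iff by auto
        with x(2)[of q] elim show False by (auto simp: ennreal_less_iff)
      qed
    qed
  qed
  have "stopping_time F T'"
  proof
    fix t
    have "{\<omega> \<in> space (F t). T' \<omega> \<le> t} = {\<omega> \<in> space (F t). \<forall>n. \<sigma> n \<omega> \<le> t}"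
    proof (intro Collect_cong conj_cong refl iffI allI)
      fix \<omega> n assume \<omega>: "\<omega> \<in> space (F t)" "T' \<omega> \<le> t"
      show "\<sigma> n \<omega> \<le> t"
      proof (cases "T' \<omega> < \<infinity>")
        case True
        from before[OF _ True, of n] \<omega> show ?thesis by (simp add: space_F)
      qed (use \<omega> in \<open>auto simp: less_top[symmetric] top_unique\<close>)
    next
      fix \<omega> assume \<omega>: "\<omega> \<in> space (F t)" "\<forall>n. \<sigma> n \<omega> \<le> t"
      show "T' \<omega> \<le> t"
      proof (rule ccontr)
        assume "\<not> ?thesis"
        then obtain y where y: "t < y" "y < T' \<omega>" using dense[of t "T' \<omega>"] by (auto simp: not_le)
        then obtain r where r: "0 \<le> r" "y = ennreal r" by (cases y) auto
        have "\<omega> \<in> space M" using \<omega> by (simp add: space_F)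
        from after[OF this r(1)] y r obtain n where "ennreal r \<le> \<sigma> n \<omega>"
          by (auto simp: eventually_sequentially)
        with \<omega>(2) y r show False by (meson le_less_trans leD)
      qed
    qed
    also have "\<dots> \<in> sets (F t)"
      using stopping_timeD[OF st, of _ t] by (auto simp: pred_def intro!: sets.sets_Collect_countable_All)
    finally show "Measurable.pred (F t) (\<lambda>\<omega>. T' \<omega> \<le> t)" by (simp add: pred_def)
  qed
  from that[OF st this T'_eq T'_small before after] show ?thesis by blast
qed

section \<open>Martingale jumps at predictable times\<close>

text \<open>
  Optional stopping at the announcing times and at the announced time gives the same expectation. In the limit
  this says that the jump has mean zero, so it vanishes if it is never positive.
\<close>

lemma martingale_jump_at_predictable_time:
  assumes Y: "martingale M F Y"
    and T: "stopping_time F T" "predictable_time F T" "\<And>\<omega>. \<omega> \<in> space M \<Longrightarrow> 0 < T \<omega>"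
    and u: "0 \<le> u"
    and down: "AE \<omega> in M. T \<omega> \<le> ennreal u \<longrightarrow> jump Y (enn2real (T \<omega>)) \<omega> \<le> 0"
  shows "AE \<omega> in M. T \<omega> \<le> ennreal u \<longrightarrow> jump Y (enn2real (T \<omega>)) \<omega> = 0"
proof -
  note Y' = martingaleD[OF Y]
  have approx: "\<exists>B\<in>sets M. measure M B < e \<and> (AE \<omega> in M. \<omega> \<notin> B \<longrightarrow> T \<omega> \<le> ennreal u \<longrightarrow> jump Y (enn2real (T \<omega>)) \<omega> = 0)"
    if e: "e > 0" for e
  proof (rule predictable_time_announced[OF T e])
    fix \<sigma> T' assume \<sigma>: "\<And>n::nat. stopping_time F (\<sigma> n)" and T': "stopping_time F T'"
      "\<And>\<omega>. \<omega> \<in> space M \<Longrightarrow> T' \<omega> = T \<omega> \<or> T' \<omega> = \<infinity>"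
      "measure M {\<omega> \<in> space M. T \<omega> < \<infinity> \<and> T' \<omega> = \<infinity>} < e"
      "\<And>\<omega> n. \<omega> \<in> space M \<Longrightarrow> T' \<omega> < \<infinity> \<Longrightarrow> \<sigma> n \<omega> < T' \<omega>"
      "\<And>\<omega> r. \<omega> \<in> space M \<Longrightarrow> 0 \<le> r \<Longrightarrow> ennreal r < T' \<omega> \<Longrightarrow> eventually (\<lambda>n. ennreal r \<le> \<sigma> n \<omega>) sequentially"
    note [measurable] = stopping_time_measurable_M[OF T(1)] stopping_time_measurable_M[OF T'(1)]
    (* the jump that is lost when Y is stopped just before T' instead of at T' *)
    define W where "W = (\<lambda>\<omega>. if T' \<omega> \<le> ennreal u then jump Y (enn2real (T' \<omega>)) \<omega> else 0)"
    define G where "G = (\<lambda>\<omega>. lim (\<lambda>n. stopped Y (\<sigma> n) u \<omega>))"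
    have lim: "AE \<omega> in M. (\<lambda>n. stopped Y (\<sigma> n) u \<omega>) \<longlonglongrightarrow> stopped Y T' u \<omega> - W \<omega>"
      using Y'(2) AE_space
    proof eventually_elim
      case (elim \<omega>)
      show ?case
      proof (cases "T' \<omega> \<le> ennreal u")
        case True
        then have fin: "T' \<omega> < \<infinity>" by (simp add: le_less_trans[OF _ ennreal_less_top])
        define r where "r = enn2real (T' \<omega>)"
        have r: "T' \<omega> = ennreal r" "0 \<le> r" using fin by (auto simp: r_def)
        have "0 < T' \<omega>" using T'(2)[OF elim(2)] T(3)[OF elim(2)] by auto
        then have "0 < r" using r by simp
        have less: "min_time u (\<sigma> n \<omega>) < r" for n
        proof -
          have lt: "\<sigma> n \<omega> < ennreal r" using T'(4)[OF elim(2) fin] r by simp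
          then have "min_time u (\<sigma> n \<omega>) = enn2real (\<sigma> n \<omega>)"
            using True r by (intro min_time_of_ge u) (metis le_less_trans less_imp_le order_trans)
          then show ?thesis using lt \<open>0 < r\<close> by (cases "\<sigma> n \<omega>") (auto simp: ennreal_less_iff)
        qed
        have "(\<lambda>n. min_time u (\<sigma> n \<omega>)) \<longlonglongrightarrow> r"
        proof (rule order_tendstoI)
          fix a assume a: "a < r"
          obtain b where b: "max 0 a < b" "b < r" using dense[of "max 0 a" r] a \<open>0 < r\<close> by auto
          have "ennreal b < T' \<omega>" using b r by (auto intro: ennreal_lessI)
          from T'(5)[OF elim(2) _ this] b
          have "eventually (\<lambda>n. ennreal b \<le> \<sigma> n \<omega>) sequentially" by auto
          then show "eventually (\<lambda>n. a < min_time u (\<sigma> n \<omega>)) sequentially"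
          proof eventually_elim
            case (elim n)
            have "b \<le> u" using b True r u by simp
            have "min_time b (\<sigma> n \<omega>) \<le> min_time u (\<sigma> n \<omega>)"
              by (rule min_time_increment(1)) (use b \<open>b \<le> u\<close> in auto)
            moreover have "min_time b (\<sigma> n \<omega>) = b" by (rule min_time_of_le) (use b elim in auto)
            ultimately show ?case using b by auto
          qed
        next
          fix a assume "r < a"
          then show "eventually (\<lambda>n. min_time u (\<sigma> n \<omega>) < a) sequentially"
            using less by (auto intro!: always_eventually less_trans[of _ r a])
        qed
        then have "(\<lambda>n. Y (min_time u (\<sigma> n \<omega>)) \<omega>) \<longlonglongrightarrow> left_limit (\<lambda>t. Y t \<omega>) r"
          by (rule cadlag_tendsto_left[OF elim(1) \<open>0 < r\<close>]) (use less in auto)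
        then show ?thesis
          using True by (simp add: stopped_eq W_def jump_def min_time_of_ge u r_def)
      next
        case False
        then have "eventually (\<lambda>n. ennreal u \<le> \<sigma> n \<omega>) sequentially" by (intro T'(5) elim u) auto
        then have "eventually (\<lambda>n. stopped Y (\<sigma> n) u \<omega> = stopped Y T' u \<omega> - W \<omega>) sequentially"
          by eventually_elim (use False u in \<open>simp add: stopped_eq W_def min_time_of_le\<close>)
        then show ?thesis by (rule tendsto_eventually)
      qed
    qed
    have int: "integrable M (stopped Y (\<sigma> n) u)" for n by (rule optional_stopping(1)[OF Y \<sigma> u])
    have [measurable]: "stopped Y (\<sigma> n) u \<in> borel_measurable M" for n using int by blast
    have G[measurable]: "G \<in> borel_measurable M" unfolding G_def by measurable
    have G_eq: "AE \<omega> in M. G \<omega> = stopped Y T' u \<omega> - W \<omega>"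
      using lim by eventually_elim (simp add: G_def limI)
    have G_lim: "AE \<omega> in M. (\<lambda>n. stopped Y (\<sigma> n) u \<omega>) \<longlonglongrightarrow> G \<omega>"
      using lim G_eq by eventually_elim simp
    note U = uniform_excess_limit[OF int G G_lim optional_stopping(3)[OF Y \<sigma> u] excess_tendsto_0[OF Y'(3)[OF u]]]
    have "(\<integral>\<omega>. G \<omega> \<partial>M) = (\<integral>\<omega>. Y u \<omega> \<partial>M)"
      using U(3) unfolding optional_stopping(2)[OF Y \<sigma> u] by (rule LIMSEQ_unique[OF tendsto_const, symmetric])
    then have E0: "(\<integral>\<omega>. G \<omega> - stopped Y T' u \<omega> \<partial>M) = 0"
      using U(1) optional_stopping(1,2)[OF Y T'(1) u] by simp
    have "AE \<omega> in M. G \<omega> - stopped Y T' u \<omega> = 0"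
    proof (rule integral_nonneg_eq_0_iff_AE[THEN iffD1, OF _ _ E0])
      show "integrable M (\<lambda>\<omega>. G \<omega> - stopped Y T' u \<omega>)"
        using U(1) optional_stopping(1)[OF Y T'(1) u] by simp
      show "AE \<omega> in M. 0 \<le> G \<omega> - stopped Y T' u \<omega>"
        using G_eq down AE_space
      proof eventually_elim
        case (elim \<omega>)
        have "W \<omega> \<le> 0"
        proof (cases "T' \<omega> \<le> ennreal u")
          case True
          then have "T' \<omega> = T \<omega>" using T'(2)[OF elim(3)] by (auto simp: top_unique)
          then show ?thesis using elim(2) True by (simp add: W_def)
        qed (simp add: W_def)
        then show ?case using elim(1) by simp
      qed
    qed
    then have W0: "AE \<omega> in M. W \<omega> = 0" using G_eq by eventually_elim simp
    show "\<exists>B\<in>sets M. measure M B < e \<and> (AE \<omega> in M. \<omega> \<notin> B \<longrightarrow> T \<omega> \<le> ennreal u \<longrightarrow> jump Y (enn2real (T \<omega>)) \<omega> = 0)"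
    proof (intro bexI[of _ "{\<omega> \<in> space M. T \<omega> < \<infinity> \<and> T' \<omega> = \<infinity>}"] conjI)
      show "AE \<omega> in M. \<omega> \<notin> {\<omega> \<in> space M. T \<omega> < \<infinity> \<and> T' \<omega> = \<infinity>} \<longrightarrow> T \<omega> \<le> ennreal u \<longrightarrow> jump Y (enn2real (T \<omega>)) \<omega> = 0"
        using W0 AE_space
      proof eventually_elim
        case (elim \<omega>)
        show ?case
        proof (intro impI)
          assume a: "\<omega> \<notin> {\<omega> \<in> space M. T \<omega> < \<infinity> \<and> T' \<omega> = \<infinity>}" "T \<omega> \<le> ennreal u"
          then have "T \<omega> < \<infinity>" by (simp add: le_less_trans[OF _ ennreal_less_top])
          with a elim T'(2) have "T' \<omega> = T \<omega>" by auto
          with elim a show "jump Y (enn2real (T \<omega>)) \<omega> = 0" by (simp add: W_def)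
        qed
      qed
    next
      show "{\<omega> \<in> space M. T \<omega> < \<infinity> \<and> T' \<omega> = \<infinity>} \<in> sets M" by measurable
    qed (rule T'(3))
  qed
  have "\<exists>B. B \<in> sets M \<and> measure M B < 1 / real (Suc n) \<and>
      (AE \<omega> in M. \<omega> \<notin> B \<longrightarrow> T \<omega> \<le> ennreal u \<longrightarrow> jump Y (enn2real (T \<omega>)) \<omega> = 0)" for n :: nat
    using approx[of "1 / real (Suc n)"] unfolding Bex_def by simp
  from choice[OF allI, OF this] obtain B where B': "\<forall>n. B n \<in> sets M \<and> measure M (B n) < 1 / real (Suc n) \<and>
    (AE \<omega> in M. \<omega> \<notin> B n \<longrightarrow> T \<omega> \<le> ennreal u \<longrightarrow> jump Y (enn2real (T \<omega>)) \<omega> = 0)" ..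
  have B: "B n \<in> sets M" "measure M (B n) < 1 / real (Suc n)"
    "AE \<omega> in M. \<omega> \<notin> B n \<longrightarrow> T \<omega> \<le> ennreal u \<longrightarrow> jump Y (enn2real (T \<omega>)) \<omega> = 0" for n
    using B'[rule_format, of n] by simp_all
  have "measure M (\<Inter>n. B n) \<le> 0"
  proof (rule LIMSEQ_le_const[OF tendsto_inverse_Suc], intro exI[of _ 0] allI impI)
    fix n :: nat
    have "measure M (\<Inter>n. B n) \<le> measure M (B n)" by (rule finite_measure_mono) (use B in auto)
    with B(2)[of n] show "measure M (\<Inter>n. B n) \<le> 1 / real (Suc n)" by simp
  qed
  then have "(\<Inter>n. B n) \<in> null_sets M" using B(1)
    by (auto simp: null_sets_def emeasure_eq_measure measure_le_0_iff)
  from AE_not_in[OF this] show ?thesis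
    using AE_all_countable[THEN iffD2, OF allI, OF B(3)] by eventually_elim auto
qed

end

lemma left_limit_stopped:
  assumes f: "cadlag f" and r: "0 < r"
  shows "left_limit (\<lambda>t. f (min_time t S)) r = (if ennreal r \<le> S then left_limit f r else f (min_time r S))"
proof (cases "ennreal r \<le> S")
  case True
  have pos: "eventually (\<lambda>s. 0 < s \<and> s < r) (at_left r)"
    using eventually_at_left_real[OF r] by eventually_elim auto
  have "left_limit (\<lambda>t. f (min_time t S)) r = left_limit f r"
  proof (rule left_limit_eqI[OF r], rule Lim_transform_eventually[OF left_limit_tendsto[OF f r]])
    show "eventually (\<lambda>s. f s = f (min_time s S)) (at_left r)"
      using pos
    proof eventually_elim
      case (elim s)
      then have "ennreal s \<le> S" using order_trans[OF ennreal_leI True, of s] by simp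
      with elim show ?case by (subst min_time_of_le) auto
    qed
  qed
  then show ?thesis using True by simp
next
  case False
  then obtain s where s: "0 \<le> s" "S = ennreal s" by (cases S) auto
  then have "s < r" using False r by (metis ennreal_leI linorder_not_less)
  have "left_limit (\<lambda>t. f (min_time t S)) r = f s"
  proof (rule left_limit_eqI[OF r], rule tendsto_eventually)
    show "eventually (\<lambda>t. f (min_time t S) = f s) (at_left r)"
      using eventually_at_left_real[OF \<open>s < r\<close>]
      by eventually_elim (use s in \<open>auto simp: min_time_of_ge\<close>)
  qed
  moreover have "min_time r S = s" using s \<open>s < r\<close> by (simp add: min_time_of_ge)
  ultimately show ?thesis using False by simp
qed

lemma jump_stopped:
  assumes f: "cadlag (\<lambda>t. X t \<omega>)" and r: "0 < r"
  shows "jump (stopped X S) r \<omega> = (if ennreal r \<le> S \<omega> then jump X r \<omega> else 0)"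
  using left_limit_stopped[OF assms] r by (simp add: jump_def stopped_eq min_time_of_le)

lemma jump_0: "jump X 0 \<omega> = 0"
  by (simp add: jump_def left_limit_def)

lemma jump_uminus:
  assumes "cadlag (\<lambda>t. X t \<omega>)"
  shows "jump (\<lambda>t \<omega>. - X t \<omega>) t \<omega> = - jump X t \<omega>"
  using left_limit_uminus[OF assms] by (simp add: jump_def)

context usual_filtered_prob_space
begin

lemma martingale_uminus:
  assumes Y: "martingale M F Y"
  shows "martingale M F (\<lambda>t \<omega>. - Y t \<omega>)"
  unfolding martingale_def
proof (intro conjI allI impI)
  note Y' = martingaleD[OF Y]
  show "adapted F (\<lambda>t \<omega>. - Y t \<omega>)" using Y'(1) by (auto simp: adapted_def)
  show "AE \<omega> in M. cadlag (\<lambda>t. - Y t \<omega>)" using Y'(2) by eventually_elim (rule cadlag_uminus)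
  show "integrable M (\<lambda>\<omega>. - Y t \<omega>)" if "0 \<le> t" for t using Y'(3)[OF that] by simp
  fix s t :: real assume st: "0 \<le> s" "s \<le> t"
  interpret finite_measure_subalgebra M "F (ennreal s)" by (rule finite_measure_subalgebra_F)
  have "AE \<omega> in M. real_cond_exp M (F (ennreal s)) (\<lambda>\<omega>. -1 * Y t \<omega>) \<omega> = -1 * real_cond_exp M (F (ennreal s)) (Y t) \<omega>"
    by (rule real_cond_exp_cmult) (use Y'(3) st in auto)
  moreover have "AE \<omega> in M. real_cond_exp M (F (ennreal s)) (Y t) \<omega> = Y s \<omega>"
    using Y st by (simp add: martingale_def)
  ultimately show "AE \<omega> in M. real_cond_exp M (F (ennreal s)) (\<lambda>\<omega>. - Y t \<omega>) \<omega> = - Y s \<omega>"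
    by eventually_elim simp
qed

lemma local_martingale_uminus:
  assumes L: "local_martingale M F L"
  shows "local_martingale M F (\<lambda>t \<omega>. - L t \<omega>)"
proof -
  obtain T :: "nat \<Rightarrow> 'a \<Rightarrow> ennreal" where T: "\<And>n. stopping_time F (T n)"
    "AE \<omega> in M. incseq (\<lambda>n. T n \<omega>) \<and> (\<lambda>n. T n \<omega>) \<longlonglongrightarrow> \<infinity>" "\<And>n. martingale M F (stopped L (T n))"
    using L by (auto simp: local_martingale_def)
  have "stopped (\<lambda>t \<omega>. - L t \<omega>) S = (\<lambda>t \<omega>. - stopped L S t \<omega>)" for S
    by (intro ext) (simp add: stopped_def)
  then have mart: "martingale M F (stopped (\<lambda>t \<omega>. - L t \<omega>) (T n))" for n
    using martingale_uminus[OF T(3)] by simp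
  have "AE \<omega> in M. cadlag (\<lambda>t. L t \<omega>)" using L by (simp add: local_martingale_def)
  then have "AE \<omega> in M. cadlag (\<lambda>t. - L t \<omega>)" by eventually_elim (rule cadlag_uminus)
  moreover have "adapted F (\<lambda>t \<omega>. - L t \<omega>)" using L by (auto simp: local_martingale_def adapted_def)
  ultimately show ?thesis unfolding local_martingale_def
    by (intro conjI exI[of _ T] allI T mart)
qed

lemma local_martingale_jump_at_predictable_time:
  assumes L: "local_martingale M F L"
    and T: "stopping_time F T" "predictable_time F T" "\<And>\<omega>. \<omega> \<in> space M \<Longrightarrow> 0 < T \<omega>"
    and down: "AE \<omega> in M. T \<omega> < \<infinity> \<longrightarrow> jump L (enn2real (T \<omega>)) \<omega> \<le> 0"
  shows "AE \<omega> in M. T \<omega> < \<infinity> \<longrightarrow> jump L (enn2real (T \<omega>)) \<omega> = 0"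
proof -
  obtain S :: "nat \<Rightarrow> 'a \<Rightarrow> ennreal" where S: "\<And>n. stopping_time F (S n)"
    "AE \<omega> in M. incseq (\<lambda>n. S n \<omega>) \<and> (\<lambda>n. S n \<omega>) \<longlonglongrightarrow> \<infinity>" "\<And>n. martingale M F (stopped L (S n))"
    using L by (auto simp: local_martingale_def)
  have cad: "AE \<omega> in M. cadlag (\<lambda>t. L t \<omega>)" using L by (simp add: local_martingale_def)
  have real_T: "\<exists>r>0. T \<omega> = ennreal r" if "\<omega> \<in> space M" "T \<omega> < \<infinity>" for \<omega>
    using T(3)[OF that(1)] that(2) by (cases "T \<omega>") auto
  have each: "AE \<omega> in M. T \<omega> \<le> ennreal (real k) \<longrightarrow> jump (stopped L (S n)) (enn2real (T \<omega>)) \<omega> = 0" for n k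
  proof (rule martingale_jump_at_predictable_time[OF S(3) T])
    show "AE \<omega> in M. T \<omega> \<le> ennreal (real k) \<longrightarrow> jump (stopped L (S n)) (enn2real (T \<omega>)) \<omega> \<le> 0"
      using down cad AE_space
    proof eventually_elim
      case (elim \<omega>)
      show ?case
      proof
        assume "T \<omega> \<le> ennreal (real k)"
        then have fin: "T \<omega> < \<infinity>" by (simp add: le_less_trans[OF _ ennreal_less_top])
        from real_T[OF elim(3) fin] obtain r where r: "0 < r" "T \<omega> = ennreal r" by blast
        then have "0 < enn2real (T \<omega>)" by simp
        from jump_stopped[where X = L and \<omega> = \<omega>, OF elim(2) this, of "S n"] elim(1) fin
        show "jump (stopped L (S n)) (enn2real (T \<omega>)) \<omega> \<le> 0" by simp
      qed
    qed
  qed auto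
  have "AE \<omega> in M. \<forall>n k. T \<omega> \<le> ennreal (real k) \<longrightarrow> jump (stopped L (S n)) (enn2real (T \<omega>)) \<omega> = 0"
    unfolding AE_all_countable by (intro allI each)
  with S(2) cad AE_space show ?thesis
  proof eventually_elim
    case (elim \<omega>)
    show ?case
    proof
      assume "T \<omega> < \<infinity>"
      from real_T[OF elim(3) this] obtain r where r: "0 < r" "T \<omega> = ennreal r" by blast
      obtain k :: nat where k: "r \<le> real k" using real_arch_simple by blast
      have "(\<lambda>n. S n \<omega>) \<longlonglongrightarrow> \<infinity>" using elim(1) by simp
      from order_tendstoD(1)[OF this, of "ennreal r"] obtain n where n: "ennreal r < S n \<omega>"
        by (auto simp: eventually_sequentially)
      have "T \<omega> \<le> ennreal (real k)" using r k by (simp add: ennreal_leI)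
      with elim(4) r have "jump (stopped L (S n)) r \<omega> = 0" by (metis enn2real_ennreal less_imp_le)
      with jump_stopped[where X = L and \<omega> = \<omega>, OF elim(2) r(1), of "S n"] less_imp_le[OF n] r
      show "jump L (enn2real (T \<omega>)) \<omega> = 0" by simp
    qed
  qed
qed

section \<open>Jumps of predictable processes\<close>

text \<open>
  The graph of the first time with \<open>\<Delta>V \<ge> d\<close> is cut out by the predictable set \<open>{\<Delta>V \<ge> d}\<close> from the predictable
  set \<open>[0, T]\<close>. This is where predictability of \<open>V\<close> is used.
\<close>

lemma jump_debut:
  assumes V: "adapted F V" "predictable F V" and cad: "\<And>\<omega>. \<omega> \<in> space M \<Longrightarrow> cadlag (\<lambda>t. V t \<omega>)" and d: "d > 0"
  obtains T where "stopping_time F T" "predictable_time F T"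
    "\<And>\<omega>. \<omega> \<in> space M \<Longrightarrow> 0 < T \<omega>"
    "\<And>\<omega>. \<omega> \<in> space M \<Longrightarrow> T \<omega> < \<infinity> \<Longrightarrow> d \<le> jump V (enn2real (T \<omega>)) \<omega>"
    "\<And>\<omega> t. \<omega> \<in> space M \<Longrightarrow> T \<omega> = \<infinity> \<Longrightarrow> 0 < t \<Longrightarrow> jump V t \<omega> < d"
proof -
  define J where "J = (\<lambda>\<omega>. {t. 0 < t \<and> d \<le> jump V t \<omega>})"
  define T where "T = (\<lambda>\<omega>. if J \<omega> = {} then \<infinity> else ennreal (Inf (J \<omega>)))"
  have bdd: "bdd_below (J \<omega>)" for \<omega> unfolding J_def by (intro bdd_belowI[of _ 0]) auto
  have Inf_J: "Inf (J \<omega>) \<in> J \<omega>" if "\<omega> \<in> space M" "J \<omega> \<noteq> {}" for \<omega>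
    using first_jump_attained[OF cad[OF that(1)] d, of "J \<omega>"] that(2) by (simp add: J_def jump_def)
  have T_le: "T \<omega> \<le> ennreal t" if "t \<in> J \<omega>" for t \<omega>
    using cInf_lower[OF that bdd] that by (auto simp: T_def intro: ennreal_leI)
  have T_real: "\<exists>t\<in>J \<omega>. T \<omega> = ennreal t" if "\<omega> \<in> space M" "T \<omega> < \<infinity>" for \<omega>
    using Inf_J[OF that(1)] that(2) by (auto simp: T_def split: if_splits)
  have T_le_iff: "T \<omega> \<le> ennreal r \<longleftrightarrow> (\<exists>t. 0 < t \<and> t \<le> r \<and> d \<le> jump V t \<omega>)" if "\<omega> \<in> space M" "0 \<le> r" for \<omega> r
  proof
    assume le: "T \<omega> \<le> ennreal r"
    then have "T \<omega> < \<infinity>" by (simp add: le_less_trans[OF _ ennreal_less_top])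
    with T_real[OF that(1)] obtain t where "t \<in> J \<omega>" "T \<omega> = ennreal t" by blast
    then show "\<exists>t. 0 < t \<and> t \<le> r \<and> d \<le> jump V t \<omega>"
      using le that(2) by (intro exI[of _ t]) (auto simp: J_def)
  next
    assume "\<exists>t. 0 < t \<and> t \<le> r \<and> d \<le> jump V t \<omega>"
    then obtain t where t: "t \<in> J \<omega>" "t \<le> r" by (auto simp: J_def)
    show "T \<omega> \<le> ennreal r" using order_trans[OF T_le[OF t(1)] ennreal_leI[OF t(2)]] .
  qed
  have st: "stopping_time F T"
  proof
    fix t :: ennreal
    show "Measurable.pred (F t) (\<lambda>\<omega>. T \<omega> \<le> t)"
    proof (cases t)
      case (real r)
      have meas: "V p \<in> borel_measurable (F (ennreal r))" if "p\<in>insert r (\<rat> \<inter> {0..r})" for p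
      proof (rule measurable_F_mono)
        show "V p \<in> borel_measurable (F (ennreal p))" using V(1) that real(1) by (auto simp: adapted_def)
        show "ennreal p \<le> ennreal r" using that by (intro ennreal_leI) auto
      qed
      have cnt: "countable (insert r (\<rat> \<inter> {0..r}))"
        using countable_rat by (auto intro: countable_subset[rotated])
      have "Measurable.pred (F (ennreal r)) (\<lambda>\<omega>. \<forall>k::nat. \<exists>p\<in>insert r (\<rat> \<inter> {0..r}). \<exists>q\<in>insert r (\<rat> \<inter> {0..r}).
          p \<le> q \<and> q - p \<le> 1 / real (Suc k) \<and> d - 1 / real (Suc k) \<le> V q \<omega> - V p \<omega>)"
        unfolding pred_def
      proof (intro sets.sets_Collect_countable_All sets.sets_Collect_countable_Ex' cnt)
        fix k :: nat and p q assume "p\<in>insert r (\<rat> \<inter> {0..r})" "q\<in>insert r (\<rat> \<inter> {0..r})"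
        note [measurable] = meas[OF this(1)] meas[OF this(2)]
        show "{\<omega> \<in> space (F (ennreal r)). p \<le> q \<and> q - p \<le> 1 / real (Suc k) \<and> d - 1 / real (Suc k) \<le> V q \<omega> - V p \<omega>} \<in> sets (F (ennreal r))"
          by measurable
      qed
      also have "?this \<longleftrightarrow> Measurable.pred (F (ennreal r)) (\<lambda>\<omega>. T \<omega> \<le> ennreal r)"
      proof (rule measurable_cong)
        fix \<omega> assume "\<omega> \<in> space (F (ennreal r))"
        then have \<omega>: "\<omega> \<in> space M" by (simp add: space_F)
        show "(\<forall>k::nat. \<exists>p\<in>insert r (\<rat> \<inter> {0..r}). \<exists>q\<in>insert r (\<rat> \<inter> {0..r}).
          p \<le> q \<and> q - p \<le> 1 / real (Suc k) \<and> d - 1 / real (Suc k) \<le> V q \<omega> - V p \<omega>) = (T \<omega> \<le> ennreal r)"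
          unfolding T_le_iff[OF \<omega> real(1)] jump_def
          by (rule exists_jump_iff[OF cad[OF \<omega>] d real(1), symmetric])
      qed
      finally show ?thesis unfolding real(2) .
    qed simp
  qed
  have pred: "predictable_time F T"
  proof -
    have left: "predictable F (\<lambda>t \<omega>. left_limit (\<lambda>s. V s \<omega>) t)"
      by (rule predictable_of_left_approximation[OF V(1)])
         (use left_limit_tendsto[OF cad] in \<open>auto simp: left_limit_def[of _ 0]\<close>)
    have [measurable]: "(\<lambda>x. V (fst x) (snd x)) \<in> borel_measurable (predictable_sigma F)"
      "(\<lambda>x. left_limit (\<lambda>s. V s (snd x)) (fst x)) \<in> borel_measurable (predictable_sigma F)"
      using V(2) left by (simp_all add: predictable_def case_prod_beta')
    have zero: "{0} \<times> space M \<in> sets (predictable_sigma F)"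
      using predictable_rectangle_0[OF sets.top[of "F 0"]] by (simp add: space_F)
    have "{(t, \<omega>). 0 \<le> t \<and> \<omega> \<in> space (F 0) \<and> ennreal t < T \<omega>} =
      space (predictable_sigma F) - {(t, \<omega>). 0 \<le> t \<and> \<omega> \<in> space M \<and> T \<omega> < ennreal t}
       - ({x \<in> space (predictable_sigma F). d \<le> V (fst x) (snd x) - left_limit (\<lambda>s. V s (snd x)) (fst x)} - {0} \<times> space M)"
      (is "?L = ?R")
    proof (intro set_eqI, clarify)
      fix t :: real and \<omega>
      show "(t, \<omega>) \<in> ?L \<longleftrightarrow> (t, \<omega>) \<in> ?R"
      proof (cases "0 \<le> t \<and> \<omega> \<in> space M")
        case True
        have "t \<in> J \<omega>" if eq: "T \<omega> = ennreal t"
        proof -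
          have "T \<omega> < \<infinity>" using eq by simp
          with T_real[of \<omega>] True obtain s where "s \<in> J \<omega>" "T \<omega> = ennreal s" by blast
          then show ?thesis using eq True by (simp add: J_def)
        qed
        then have "ennreal t < T \<omega> \<longleftrightarrow> \<not> T \<omega> < ennreal t \<and> t \<notin> J \<omega>"
          using T_le[of t \<omega>] by (metis leD not_less_iff_gr_or_eq)
        then show ?thesis using True
          by (auto simp: J_def jump_def space_predictable_sigma space_F)
      qed (auto simp: space_predictable_sigma space_F)
    qed
    also have "\<dots> \<in> sets (predictable_sigma F)"
      by (intro sets.Diff sets.top predictable_after_stopping_time st zero) measurable
    finally show ?thesis by (simp add: predictable_time_def)
  qed
  show ?thesis
  proof (rule that[OF st pred])
    fix \<omega> assume \<omega>: "\<omega> \<in> space M"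
    show "0 < T \<omega>" using Inf_J[OF \<omega>] by (auto simp: T_def J_def)
    show "d \<le> jump V (enn2real (T \<omega>)) \<omega>" if "T \<omega> < \<infinity>"
      using T_real[OF \<omega> that] by (auto simp: J_def)
    show "jump V t \<omega> < d" if "T \<omega> = \<infinity>" "0 < t" for t
    proof (rule ccontr)
      assume "\<not> ?thesis"
      then have "t \<in> J \<omega>" using that by (simp add: J_def)
      from T_le[OF this] that show False by (simp add: top_unique)
    qed
  qed
qed

lemma predictable_jumps_less:
  assumes V: "adapted F V" "predictable F V" and cad: "AE \<omega> in M. cadlag (\<lambda>t. V t \<omega>)" and d: "d > 0"
    and L: "local_martingale M F L"
    and jumps: "\<And>T. stopping_time F T \<Longrightarrow> predictable_time F T \<Longrightarrow>
       AE \<omega> in M. T \<omega> < \<infinity> \<longrightarrow> jump V (enn2real (T \<omega>)) \<omega> = - jump L (enn2real (T \<omega>)) \<omega>"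
  shows "AE \<omega> in M. \<forall>t>0. jump V t \<omega> < d"
proof -
  (* Irregular paths are replaced by zero, so that the first jump is a predictable time on the whole space;
     the null set of these paths lies in F 0, which keeps V' predictable. *)
  define N where "N = {\<omega> \<in> space M. \<not> cadlag (\<lambda>t. V t \<omega>)}"
  have N: "N \<in> sets (F t)" for t using null_subset_in_F[OF cad, of "\<lambda>_. True"] by (simp add: N_def)
  define V' where "V' = (\<lambda>t \<omega>. if \<omega> \<in> N then 0 else V t \<omega>)"
  have eq: "AE \<omega> in M. \<forall>t. V' t \<omega> = V t \<omega>" using cad by eventually_elim (auto simp: V'_def N_def)
  have cad': "cadlag (\<lambda>t. V' t \<omega>)" if "\<omega> \<in> space M" for \<omega>
    using that by (cases "\<omega> \<in> N") (auto simp: V'_def N_def intro: cadlag_of_continuous)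
  have ad: "adapted F V'" unfolding adapted_def
  proof (intro allI impI)
    fix t :: real assume "0 \<le> t"
    then have [measurable]: "V t \<in> borel_measurable (F (ennreal t))" using V(1) by (simp add: adapted_def)
    note [measurable] = N
    show "V' t \<in> borel_measurable (F (ennreal t))" unfolding V'_def by measurable
  qed
  have pr: "predictable F V'"
  proof -
    have [measurable]: "{0..} \<times> N \<in> sets (predictable_sigma F)" by (rule predictable_cylinder[OF N])
    have [measurable]: "(\<lambda>x. V (fst x) (snd x)) \<in> borel_measurable (predictable_sigma F)"
      using V(2) by (simp add: predictable_def case_prod_beta')
    have "(\<lambda>x. if x \<in> {0..} \<times> N then 0 else V (fst x) (snd x)) \<in> borel_measurable (predictable_sigma F)"
      by measurable
    then show ?thesis unfolding predictable_def
      by (rule measurable_cong[THEN iffD1, rotated]) (auto simp: V'_def space_predictable_sigma split: if_split_asm)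
  qed
  show ?thesis
  proof (rule jump_debut[OF ad pr cad' d])
    fix T assume T: "stopping_time F T" "predictable_time F T"
      "\<And>\<omega>. \<omega> \<in> space M \<Longrightarrow> 0 < T \<omega>"
      "\<And>\<omega>. \<omega> \<in> space M \<Longrightarrow> T \<omega> < \<infinity> \<Longrightarrow> d \<le> jump V' (enn2real (T \<omega>)) \<omega>"
      "\<And>\<omega> t. \<omega> \<in> space M \<Longrightarrow> T \<omega> = \<infinity> \<Longrightarrow> 0 < t \<Longrightarrow> jump V' t \<omega> < d"
    have big: "AE \<omega> in M. T \<omega> < \<infinity> \<longrightarrow> jump L (enn2real (T \<omega>)) \<omega> \<le> - d"
      using jumps[OF T(1,2)] eq AE_space
    proof eventually_elim
      case (elim \<omega>)
      have "jump V' t \<omega> = jump V t \<omega>" for t using elim(2) by (simp add: jump_def)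
      with elim(1) T(4)[OF elim(3)] show ?case by auto
    qed
    have "AE \<omega> in M. T \<omega> < \<infinity> \<longrightarrow> jump L (enn2real (T \<omega>)) \<omega> \<le> 0"
      using big by eventually_elim (use d in auto)
    note down = this
    have "AE \<omega> in M. T \<omega> < \<infinity> \<longrightarrow> jump L (enn2real (T \<omega>)) \<omega> = 0"
      by (rule local_martingale_jump_at_predictable_time[OF L T(1,2) _ down]) (rule T(3))
    then show "AE \<omega> in M. \<forall>t>0. jump V t \<omega> < d"
      using big eq AE_space
    proof eventually_elim
      case (elim \<omega>)
      have "T \<omega> = \<infinity>" using elim(1,2) d by (auto simp: not_less top_unique)
      moreover have "jump V' t \<omega> = jump V t \<omega>" for t using elim(3) by (simp add: jump_def)
      ultimately show ?case using T(5)[OF elim(4)] by auto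
    qed
  qed
qed

text \<open>
  An upward jump of \<open>V\<close> would be a downward jump of the local martingale \<open>L\<close> at a predictable time; for downward
  jumps both processes change sign.
\<close>

theorem predictable_no_jumps:
  assumes V: "adapted F V" "predictable F V" and cad: "AE \<omega> in M. cadlag (\<lambda>t. V t \<omega>)"
    and L: "local_martingale M F L"
    and jumps: "\<And>T. stopping_time F T \<Longrightarrow> predictable_time F T \<Longrightarrow>
       AE \<omega> in M. T \<omega> < \<infinity> \<longrightarrow> jump V (enn2real (T \<omega>)) \<omega> = - jump L (enn2real (T \<omega>)) \<omega>"
  shows "AE \<omega> in M. \<forall>t>0. jump V t \<omega> = 0"
proof -
  have up: "AE \<omega> in M. \<forall>t>0. jump V t \<omega> < 1 / real (Suc n)" for n
    by (rule predictable_jumps_less[OF V cad _ L jumps]) auto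
  have down: "AE \<omega> in M. \<forall>t>0. jump (\<lambda>t \<omega>. - V t \<omega>) t \<omega> < 1 / real (Suc n)" for n
  proof (rule predictable_jumps_less[where L = "\<lambda>t \<omega>. - L t \<omega>"])
    show "adapted F (\<lambda>t \<omega>. - V t \<omega>)" using V(1) by (auto simp: adapted_def)
    show "predictable F (\<lambda>t \<omega>. - V t \<omega>)" using V(2) by (auto simp: predictable_def case_prod_beta')
    show "AE \<omega> in M. cadlag (\<lambda>t. - V t \<omega>)" using cad by eventually_elim (rule cadlag_uminus)
    show "local_martingale M F (\<lambda>t \<omega>. - L t \<omega>)" by (rule local_martingale_uminus[OF L])
    have cadL: "AE \<omega> in M. cadlag (\<lambda>t. L t \<omega>)" using L by (simp add: local_martingale_def)
    fix T assume T: "stopping_time F T" "predictable_time F T"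
    show "AE \<omega> in M. T \<omega> < \<infinity> \<longrightarrow> jump (\<lambda>t \<omega>. - V t \<omega>) (enn2real (T \<omega>)) \<omega> = - jump (\<lambda>t \<omega>. - L t \<omega>) (enn2real (T \<omega>)) \<omega>"
      using jumps[OF T] cad cadL by eventually_elim (simp add: jump_uminus)
  qed auto
  have "AE \<omega> in M. \<forall>n. \<forall>t>0. jump V t \<omega> < 1 / real (Suc n)"
    "AE \<omega> in M. \<forall>n. \<forall>t>0. jump (\<lambda>t \<omega>. - V t \<omega>) t \<omega> < 1 / real (Suc n)"
    unfolding AE_all_countable[where P = "\<lambda>n \<omega>. \<forall>t>0. jump V t \<omega> < 1 / real (Suc n)"]
      AE_all_countable[where P = "\<lambda>n \<omega>. \<forall>t>0. jump (\<lambda>t \<omega>. - V t \<omega>) t \<omega> < 1 / real (Suc n)"]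
    using up down by blast+
  then show ?thesis using cad
  proof eventually_elim
    case (elim \<omega>)
    show ?case
    proof (intro allI impI antisym)
      fix t :: real assume t: "0 < t"
      show "jump V t \<omega> \<le> 0"
        by (rule LIMSEQ_le_const[OF tendsto_inverse_Suc]) (use elim(1) t in \<open>auto intro: less_imp_le\<close>)
      have "- jump V t \<omega> \<le> 0"
        by (rule LIMSEQ_le_const[OF tendsto_inverse_Suc])
           (use elim(2) t in \<open>auto simp: jump_uminus[where X = V, OF elim(3)] intro: less_imp_le\<close>)
      then show "0 \<le> jump V t \<omega>" by simp
    qed
  qed
qed

end

section \<open>An exponential inequality for bounded martingales\<close>

lemma exp_minus_linear_le: "exp x - 1 - x \<le> x\<^sup>2 / 2 * exp \<bar>x\<bar>" for x :: real
proof -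
  obtain t where t: "\<bar>t\<bar> \<le> \<bar>x\<bar>" "exp x = (\<Sum>m<2. x ^ m / fact m) + exp t / fact 2 * x ^ 2"
    using Maclaurin_exp_le[of x 2] by blast
  then have "exp x - 1 - x = x\<^sup>2 / 2 * exp t" by (simp add: numeral_2_eq_2)
  also have "\<dots> \<le> x\<^sup>2 / 2 * exp \<bar>x\<bar>" using t(1) by (intro mult_left_mono) auto
  finally show ?thesis .
qed

lemma abs_exp_minus_1_le: "\<bar>exp x - 1\<bar> \<le> \<bar>x\<bar> * exp \<bar>x\<bar>" for x :: real
proof -
  obtain t where t: "\<bar>t\<bar> \<le> \<bar>x\<bar>" "exp x = (\<Sum>m<1. x ^ m / fact m) + exp t / fact 1 * x ^ 1"
    using Maclaurin_exp_le[of x 1] by blast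
  then have "\<bar>exp x - 1\<bar> = \<bar>x\<bar> * exp t" by (simp add: abs_mult)
  also have "\<dots> \<le> \<bar>x\<bar> * exp \<bar>x\<bar>" using t(1) by (intro mult_left_mono) auto
  finally show ?thesis .
qed

text \<open>
  An explicit constant for the error terms in the next lemma; only its independence of \<open>\<theta>\<close> and \<open>c'\<close> matters.
\<close>

definition step_const :: "real \<Rightarrow> real \<Rightarrow> real \<Rightarrow> real" where
  "step_const lam K B = 1 + \<bar>lam\<bar> * K * exp (\<bar>lam\<bar> * B) * exp (K * B)
     + K\<^sup>2 / 2 * exp (K * B) + lam\<^sup>2 / 2 * exp (\<bar>lam\<bar> * B) * B\<^sup>2"

text \<open>
  The product \<open>e\<^bsup>lam d\<^esup> e\<^bsup>-K e\<^esup>\<close> is expanded around \<open>1\<close>. The second-order term in \<open>d\<close> is what \<open>K\<close> compensates as long as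
  \<open>\<bar>d\<bar> \<le> c'\<close>, the mixed term is split by \<open>\<bar>d\<bar>\<bar>e\<bar> \<le> \<theta>d\<^sup>2 + e\<^sup>2/\<theta>\<close>, and a step larger than \<open>c'\<close> costs a constant.
\<close>

lemma exponential_step:
  fixes lam K B \<theta> c' d e :: real
  assumes K: "0 \<le> K" and B: "0 \<le> B" and \<theta>: "0 < \<theta>" "\<theta> \<le> 1"
    and c': "lam\<^sup>2 / 2 * exp (\<bar>lam\<bar> * c') \<le> K + \<theta>"
    and d: "\<bar>d\<bar> \<le> B" and e: "\<bar>e\<bar> \<le> B"
    and C: "C = step_const lam K B"
  shows "exp (lam * d - K * e) - 1 \<le> lam * d + K * (d\<^sup>2 - e)
     + C * (\<theta> * d\<^sup>2 + e\<^sup>2 / \<theta> + (if \<bar>d\<bar> \<le> c' then 0 else 1))"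
proof -
  define a where "a = exp (\<bar>lam\<bar> * B)"
  define b where "b = exp (K * B)"
  define I where "I = (if \<bar>d\<bar> \<le> c' then 0 else 1 :: real)"
  define C1 where "C1 = \<bar>lam\<bar> * K * a * b"
  define C2 where "C2 = K\<^sup>2 / 2 * b"
  define C3 where "C3 = lam\<^sup>2 / 2 * a * B\<^sup>2"
  have ab: "0 < a" "0 < b" by (auto simp: a_def b_def)
  have C_pos: "0 \<le> C1" "0 \<le> C2" "0 \<le> C3" using ab K by (auto simp: C1_def C2_def C3_def)
  have I: "0 \<le> I" by (simp add: I_def)
  have ea: "exp \<bar>lam * d\<bar> \<le> a" unfolding a_def abs_mult using d by (auto intro: mult_left_mono)
  have eb: "exp \<bar>- K * e\<bar> \<le> b" unfolding b_def abs_mult using e K by (auto intro: mult_left_mono)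
  have 1: "exp (lam * d) - 1 - lam * d \<le> (K + \<theta>) * d\<^sup>2 + C3 * I"
  proof (cases "\<bar>d\<bar> \<le> c'")
    case True
    have "exp (lam * d) - 1 - lam * d \<le> (lam * d)\<^sup>2 / 2 * exp \<bar>lam * d\<bar>" by (rule exp_minus_linear_le)
    also have "\<dots> \<le> (lam * d)\<^sup>2 / 2 * exp (\<bar>lam\<bar> * c')"
      using True by (intro mult_left_mono) (auto simp: abs_mult intro: mult_left_mono)
    also have "\<dots> = (lam\<^sup>2 / 2 * exp (\<bar>lam\<bar> * c')) * d\<^sup>2" by (simp add: power_mult_distrib)
    also have "\<dots> \<le> (K + \<theta>) * d\<^sup>2" by (intro mult_right_mono c') simp
    finally show ?thesis using True by (simp add: I_def)
  next
    case False
    have "exp (lam * d) - 1 - lam * d \<le> (lam * d)\<^sup>2 / 2 * exp \<bar>lam * d\<bar>" by (rule exp_minus_linear_le)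
    also have "\<dots> \<le> (lam * d)\<^sup>2 / 2 * a" by (intro mult_left_mono ea) simp
    also have "\<dots> = (lam\<^sup>2 / 2 * a) * d\<^sup>2" by (simp add: power_mult_distrib)
    also have "\<dots> \<le> (lam\<^sup>2 / 2 * a) * B\<^sup>2"
      using d ab by (intro mult_left_mono abs_le_square_iff[THEN iffD1]) auto
    finally have "exp (lam * d) - 1 - lam * d \<le> C3" by (simp add: C3_def)
    moreover have "0 \<le> (K + \<theta>) * d\<^sup>2" using K \<theta> by simp
    ultimately show ?thesis using False by (simp add: I_def)
  qed
  have 2: "exp (- K * e) - 1 \<le> - K * e + C2 * e\<^sup>2 / \<theta>"
  proof -
    have "exp (- K * e) - 1 - (- K * e) \<le> (- K * e)\<^sup>2 / 2 * exp \<bar>- K * e\<bar>" by (rule exp_minus_linear_le)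
    also have "\<dots> \<le> (- K * e)\<^sup>2 / 2 * b" by (intro mult_left_mono eb) simp
    also have "\<dots> = C2 * e\<^sup>2" by (simp add: C2_def power_mult_distrib)
    also have "\<dots> \<le> C2 * e\<^sup>2 / \<theta>"
      using \<theta> C_pos by (simp add: le_divide_eq mult_left_le)
    finally show ?thesis by simp
  qed
  have 3: "(exp (lam * d) - 1) * (exp (- K * e) - 1) \<le> C1 * (\<theta> * d\<^sup>2 + e\<^sup>2 / \<theta>)"
  proof -
    have "(exp (lam * d) - 1) * (exp (- K * e) - 1) \<le> \<bar>exp (lam * d) - 1\<bar> * \<bar>exp (- K * e) - 1\<bar>"
      by (metis abs_ge_self abs_mult)
    also have "\<dots> \<le> (\<bar>lam * d\<bar> * a) * (\<bar>- K * e\<bar> * b)"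
    proof (intro mult_mono)
      show "\<bar>exp (lam * d) - 1\<bar> \<le> \<bar>lam * d\<bar> * a"
        by (rule order_trans[OF abs_exp_minus_1_le mult_left_mono[OF ea]]) simp
      show "\<bar>exp (- K * e) - 1\<bar> \<le> \<bar>- K * e\<bar> * b"
        by (rule order_trans[OF abs_exp_minus_1_le mult_left_mono[OF eb]]) simp
    qed (use ab in auto)
    also have "\<dots> = C1 * (\<bar>d\<bar> * \<bar>e\<bar>)" using K by (simp add: C1_def abs_mult)
    also have "\<bar>d\<bar> * \<bar>e\<bar> \<le> \<theta> * d\<^sup>2 + e\<^sup>2 / \<theta>"
    proof -
      have "0 \<le> (\<theta> * \<bar>d\<bar> - \<bar>e\<bar>)\<^sup>2 + \<theta> * \<bar>d\<bar> * \<bar>e\<bar> * 1" using \<theta> by simp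
      also have "\<dots> = \<theta> * (\<theta> * d\<^sup>2 + e\<^sup>2 / \<theta> - \<bar>d\<bar> * \<bar>e\<bar>)"
        using \<theta> by (simp add: power2_diff field_simps power2_eq_square)
      finally have "0 \<le> \<theta> * d\<^sup>2 + e\<^sup>2 / \<theta> - \<bar>d\<bar> * \<bar>e\<bar>" using \<theta> by (simp add: zero_le_mult_iff)
      then show ?thesis by simp
    qed
    finally show ?thesis using C_pos by (simp add: mult_left_mono)
  qed
  have "exp (lam * d - K * e) = exp (lam * d) * exp (- K * e)" by (simp add: exp_add[symmetric])
  then have "exp (lam * d - K * e) - 1 = (exp (lam * d) - 1) + (exp (- K * e) - 1) + (exp (lam * d) - 1) * (exp (- K * e) - 1)"
    by (simp add: algebra_simps)
  also have "\<dots> \<le> (lam * d + ((K + \<theta>) * d\<^sup>2 + C3 * I)) + (- K * e + C2 * e\<^sup>2 / \<theta>) + C1 * (\<theta> * d\<^sup>2 + e\<^sup>2 / \<theta>)"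
    using 1 2 3 by simp
  also have "\<dots> = lam * d + K * (d\<^sup>2 - e) + (\<theta> * d\<^sup>2 + C3 * I + C2 * (e\<^sup>2 / \<theta>) + C1 * (\<theta> * d\<^sup>2 + e\<^sup>2 / \<theta>))"
    by (simp add: algebra_simps)
  also have "\<dots> \<le> lam * d + K * (d\<^sup>2 - e) + (1 + C1 + C2 + C3) * (\<theta> * d\<^sup>2 + e\<^sup>2 / \<theta> + I)"
  proof -
    have x: "0 \<le> \<theta> * d\<^sup>2" "0 \<le> e\<^sup>2 / \<theta>" using \<theta> by auto
    have "(1 + C1 + C2 + C3) * (\<theta> * d\<^sup>2 + e\<^sup>2 / \<theta> + I) - (\<theta> * d\<^sup>2 + C3 * I + C2 * (e\<^sup>2 / \<theta>) + C1 * (\<theta> * d\<^sup>2 + e\<^sup>2 / \<theta>))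
       = e\<^sup>2 / \<theta> + I + C1 * I + C2 * (\<theta> * d\<^sup>2) + C2 * I + C3 * (\<theta> * d\<^sup>2) + C3 * (e\<^sup>2 / \<theta>)"
      by (simp add: algebra_simps add_divide_distrib)
    moreover have "0 \<le> \<dots>" using x I C_pos \<theta> by (intro add_nonneg_nonneg mult_nonneg_nonneg) auto
    ultimately show ?thesis by linarith
  qed
  finally show ?thesis unfolding C step_const_def I_def C1_def C2_def C3_def a_def b_def by (simp add: mult.assoc)
qed

text \<open>
  The grid is fine enough for the path up to cell \<open>m\<close>. The condition refers to the cells before \<open>m\<close> only, so it
  is known at the beginning of cell \<open>m\<close> and may be used as a weight there.
\<close>

definition small_steps :: "real \<Rightarrow> real \<Rightarrow> (nat \<Rightarrow> real) \<Rightarrow> (nat \<Rightarrow> real) \<Rightarrow> nat \<Rightarrow> bool" where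
  "small_steps c \<eta> d e m \<longleftrightarrow> (\<forall>i<m. \<bar>d i\<bar> \<le> c) \<and> (\<Sum>i<m. (e i)\<^sup>2) \<le> \<eta>"

lemma small_steps_Suc: "small_steps c \<eta> d e (Suc m) \<Longrightarrow> small_steps c \<eta> d e m"
  unfolding small_steps_def using order_trans[of "\<Sum>i<m. (e i)\<^sup>2" "\<Sum>i<Suc m. (e i)\<^sup>2" \<eta>] by simp

lemma small_steps_sum_squares:
  assumes "\<And>i. \<bar>e i\<bar> \<le> B" "0 \<le> \<eta>"
  shows "(\<Sum>j<m. if small_steps c \<eta> d e j then (e j)\<^sup>2 else 0)
    \<le> \<eta> + (if small_steps c \<eta> d e m then 0 else B\<^sup>2)"
proof (induction m)
  case (Suc m)
  have sq: "(e m)\<^sup>2 \<le> B\<^sup>2" using assms(1)[of m] by (intro abs_le_square_iff[THEN iffD1]) auto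
  show ?case
  proof (cases "small_steps c \<eta> d e (Suc m)")
    case True
    have "(\<Sum>j<Suc m. if small_steps c \<eta> d e j then (e j)\<^sup>2 else 0) \<le> (\<Sum>j<Suc m. (e j)\<^sup>2)"
      by (intro sum_mono) auto
    also have "\<dots> \<le> \<eta>" using True by (simp add: small_steps_def)
    finally show ?thesis using True by simp
  next
    case False
    then show ?thesis using Suc.IH sq by (auto split: if_splits)
  qed
qed (use assms in auto)

lemma small_steps_exceedances:
  "(\<Sum>j<m. if small_steps c \<eta> d e j \<and> \<not> \<bar>d j\<bar> \<le> c then 1 else 0 :: real) \<le> (if small_steps c \<eta> d e m then 0 else 1)"
proof (induction m)
  case (Suc m)
  then show ?case
    using small_steps_Suc[of c \<eta> d e m] by (auto simp: small_steps_def split: if_splits)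
qed auto

text \<open>
  Dropping all increments after the first bad cell freezes \<open>z\<close> at the end of that cell; in particular the sum stays
  positive.
\<close>

lemma small_steps_frozen:
  fixes z d e :: "nat \<Rightarrow> real" and c \<eta> :: real
  assumes pos: "\<And>j. 0 < z j"
  defines "s \<equiv> (\<lambda>m. z 0 + (\<Sum>j<m. if small_steps c \<eta> d e j then z (Suc j) - z j else 0))"
  shows "0 < s m" "small_steps c \<eta> d e m \<Longrightarrow> s m = z m"
proof -
  have "0 < s m \<and> (small_steps c \<eta> d e m \<longrightarrow> s m = z m)"
  proof (induction m)
    case 0
    then show ?case using pos by (simp add: s_def)
  next
    case (Suc m)
    have "s (Suc m) = s m + (if small_steps c \<eta> d e m then z (Suc m) - z m else 0)"
      by (simp add: s_def)
    then show ?case using Suc small_steps_Suc[of c \<eta> d e m] pos[of "Suc m"] by auto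
  qed
  then show "0 < s m" "small_steps c \<eta> d e m \<Longrightarrow> s m = z m" by auto
qed

text \<open>
  The pathwise form of the inequality. Its right-hand side consists of terms with known expectation and of a penalty
  for paths on which the grid is too coarse. At most one cell contributes a step larger than \<open>c'\<close>, since the sum is
  frozen afterwards.
\<close>

lemma small_steps_exponential_le:
  fixes n q :: "nat \<Rightarrow> real" and lam K B \<theta> c' C zm :: real
  defines "d \<equiv> (\<lambda>j. n (Suc j) - n j)" and "e \<equiv> (\<lambda>j. q (Suc j) - q j)"
    and "z \<equiv> (\<lambda>j. exp (lam * n j - K * q j))"
  assumes K: "0 \<le> K" and B: "0 \<le> B" and \<theta>: "0 < \<theta>" "\<theta> \<le> 1"
    and c': "lam\<^sup>2 / 2 * exp (\<bar>lam\<bar> * c') \<le> K + \<theta>"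
    and bnd: "\<And>j. \<bar>n j\<bar> \<le> B" "\<And>j. \<bar>q j\<bar> \<le> B"
    and C: "C = step_const lam K (2 * B)"
    and zm: "zm = exp ((\<bar>lam\<bar> + K) * B)"
  shows "z m \<le> z 0 + (\<Sum>j<m. (if small_steps c' (\<theta>\<^sup>2) d e j then z j else 0) * (lam * d j + K * ((d j)\<^sup>2 - e j)))
     + zm * C * (\<theta> * (\<Sum>j<m. (d j)\<^sup>2) + \<theta>) + (if small_steps c' (\<theta>\<^sup>2) d e m then 0 else zm * C * ((2 * B)\<^sup>2 / \<theta> + 1) + zm)"
proof -
  let ?S = "small_steps c' (\<theta>\<^sup>2) d e"
  have z_pos: "0 < z j" for j by (simp add: z_def)
  have z_le: "z j \<le> zm" for j
  proof -
    have "lam * n j \<le> \<bar>lam\<bar> * B"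
      by (rule order_trans[OF abs_ge_self]) (use bnd in \<open>auto simp: abs_mult intro: mult_left_mono\<close>)
    moreover have "- (K * q j) \<le> K * B" using mult_left_mono[OF abs_le_D2[OF bnd(2)[of j]] K] by simp
    ultimately show ?thesis by (simp add: z_def zm algebra_simps)
  qed
  have C_pos: "0 \<le> C" unfolding C step_const_def using K by (intro add_nonneg_nonneg mult_nonneg_nonneg) auto
  have zm_pos: "0 < zm" by (simp add: zm)
  have d_bnd: "\<bar>d j\<bar> \<le> 2 * B" and e_bnd: "\<bar>e j\<bar> \<le> 2 * B" for j
    using bnd[of j] bnd[of "Suc j"] by (auto simp: d_def e_def)
  define err where "err = (\<lambda>j. \<theta> * (d j)\<^sup>2 + (e j)\<^sup>2 / \<theta> + (if \<bar>d j\<bar> \<le> c' then 0 else 1))"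
  have err_pos: "0 \<le> err j" for j using \<theta> by (simp add: err_def)
  have step: "z (Suc j) - z j \<le> z j * (lam * d j + K * ((d j)\<^sup>2 - e j)) + zm * C * err j" for j
  proof -
    have "z (Suc j) = z j * exp (lam * d j - K * e j)"
      by (simp add: z_def d_def e_def exp_add[symmetric] algebra_simps)
    then have "z (Suc j) - z j = z j * (exp (lam * d j - K * e j) - 1)" by (simp add: algebra_simps)
    also have "\<dots> \<le> z j * (lam * d j + K * ((d j)\<^sup>2 - e j) + C * err j)"
      unfolding err_def
      by (intro mult_left_mono exponential_step[OF K _ \<theta> c' d_bnd e_bnd C]) (use B z_pos[of j] in auto)
    also have "\<dots> = z j * (lam * d j + K * ((d j)\<^sup>2 - e j)) + z j * (C * err j)" by (simp add: algebra_simps)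
    also have "z j * (C * err j) \<le> zm * (C * err j)" using z_le C_pos err_pos by (intro mult_right_mono) auto
    finally show ?thesis by (simp add: mult.assoc)
  qed
  define s where "s = z 0 + (\<Sum>j<m. if ?S j then z (Suc j) - z j else 0)"
  have s: "0 < s" "?S m \<Longrightarrow> s = z m"
    unfolding s_def by (rule small_steps_frozen[of z, OF z_pos]; assumption)+
  have "z m \<le> s + (if ?S m then 0 else zm)"
    using s z_le[of m] by (cases "?S m") auto
  also have "s \<le> z 0 + (\<Sum>j<m. (if ?S j then z j else 0) * (lam * d j + K * ((d j)\<^sup>2 - e j)) + zm * C * (if ?S j then err j else 0))"
    unfolding s_def using step by (intro add_mono order_refl sum_mono) auto
  also have "\<dots> = z 0 + (\<Sum>j<m. (if ?S j then z j else 0) * (lam * d j + K * ((d j)\<^sup>2 - e j))) + zm * C * (\<Sum>j<m. if ?S j then err j else 0)"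
    by (simp add: sum.distrib sum_distrib_left)
  finally have bound: "z m \<le> z 0 + (\<Sum>j<m. (if ?S j then z j else 0) * (lam * d j + K * ((d j)\<^sup>2 - e j)))
      + zm * C * (\<Sum>j<m. if ?S j then err j else 0) + (if ?S m then 0 else zm)" by simp
  have "(\<Sum>j<m. if ?S j then err j else 0) \<le> \<theta> * (\<Sum>j<m. (d j)\<^sup>2) + \<theta> + (if ?S m then 0 else (2 * B)\<^sup>2 / \<theta> + 1)"
  proof -
    have "(\<Sum>j<m. if ?S j then err j else 0) = (\<Sum>j<m. if ?S j then \<theta> * (d j)\<^sup>2 else 0)
       + (\<Sum>j<m. if ?S j then (e j)\<^sup>2 else 0) / \<theta> + (\<Sum>j<m. if ?S j \<and> \<not> \<bar>d j\<bar> \<le> c' then 1 else 0)"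
      unfolding sum.distrib[symmetric] sum_divide_distrib
      by (intro sum.cong refl) (auto simp: err_def)
    also have "\<dots> \<le> \<theta> * (\<Sum>j<m. (d j)\<^sup>2) + (\<theta>\<^sup>2 + (if ?S m then 0 else (2 * B)\<^sup>2)) / \<theta> + (if ?S m then 0 else 1)"
    proof (intro add_mono divide_right_mono)
      show "(\<Sum>j<m. if ?S j then \<theta> * (d j)\<^sup>2 else 0) \<le> \<theta> * (\<Sum>j<m. (d j)\<^sup>2)"
        unfolding sum_distrib_left using \<theta> by (intro sum_mono) auto
      show "(\<Sum>j<m. if ?S j then (e j)\<^sup>2 else 0) \<le> \<theta>\<^sup>2 + (if ?S m then 0 else (2 * B)\<^sup>2)"
        by (rule small_steps_sum_squares[OF e_bnd]) simp
      show "(\<Sum>j<m. if ?S j \<and> \<not> \<bar>d j\<bar> \<le> c' then 1 else 0) \<le> (if ?S m then 0 else 1::real)"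
        by (rule small_steps_exceedances)
    qed (use \<theta> in auto)
    also have "\<dots> = \<theta> * (\<Sum>j<m. (d j)\<^sup>2) + \<theta> + (if ?S m then 0 else (2 * B)\<^sup>2 / \<theta> + 1)"
      using \<theta> by (simp add: add_divide_distrib power2_eq_square)
    finally show ?thesis .
  qed
  then have "zm * C * (\<Sum>j<m. if ?S j then err j else 0) \<le>
      zm * C * (\<theta> * (\<Sum>j<m. (d j)\<^sup>2) + \<theta> + (if ?S m then 0 else (2 * B)\<^sup>2 / \<theta> + 1))"
    using C_pos zm_pos by (intro mult_left_mono) auto
  moreover have "x \<le> s + k * r + (if P then 0 else k * v + w)"
    if "x \<le> s + k * E + (if P then 0 else w)" "k * E \<le> k * (r + (if P then 0 else v))"
    for x s k E r v w :: real and P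
    using that by (cases P) (auto simp: distrib_left)
  ultimately show ?thesis using bound by blast
qed

context usual_filtered_prob_space
begin

lemma measurable_small_steps:
  assumes Y: "adapted F Y" and A: "adapted F A" and t: "0 \<le> t 0" "\<And>j. t j \<le> t (Suc j)"
  shows "Measurable.pred (F (ennreal (t m))) (\<lambda>\<omega>. small_steps c \<eta> (\<lambda>j. Y (t (Suc j)) \<omega> - Y (t j) \<omega>) (\<lambda>j. A (t (Suc j)) \<omega> - A (t j) \<omega>) m)"
proof -
  have mono: "t i \<le> t j" if "i \<le> j" for i j by (rule lift_Suc_mono_le[of t, OF t(2) that])
  have nonneg: "0 \<le> t j" for j by (rule order_trans[OF t(1) mono[of 0 j]]) simp
  have meas: "X (t i) \<in> borel_measurable (F (ennreal (t m)))" if "adapted F X" "i \<le> m" for i X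
  proof (rule measurable_F_mono)
    show "X (t i) \<in> borel_measurable (F (ennreal (t i)))" using that nonneg by (simp add: adapted_def)
    show "ennreal (t i) \<le> ennreal (t m)" by (intro ennreal_leI mono that)
  qed
  have "Measurable.pred (F (ennreal (t m))) (\<lambda>\<omega>. (\<forall>i\<in>{..<m}. \<bar>Y (t (Suc i)) \<omega> - Y (t i) \<omega>\<bar> \<le> c) \<and>
      (\<Sum>i<m. (A (t (Suc i)) \<omega> - A (t i) \<omega>)\<^sup>2) \<le> \<eta>)"
  proof (intro pred_intros_logic pred_intros_finite)
    fix i assume "i \<in> {..<m}"
    then have [measurable]: "Y (t (Suc i)) \<in> borel_measurable (F (ennreal (t m)))" "Y (t i) \<in> borel_measurable (F (ennreal (t m)))"
      by (auto intro: meas[OF Y])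
    show "Measurable.pred (F (ennreal (t m))) (\<lambda>\<omega>. \<bar>Y (t (Suc i)) \<omega> - Y (t i) \<omega>\<bar> \<le> c)" by measurable
  next
    have sum: "(\<lambda>\<omega>. \<Sum>i<m. (A (t (Suc i)) \<omega> - A (t i) \<omega>)\<^sup>2) \<in> borel_measurable (F (ennreal (t m)))"
      by (intro borel_measurable_sum borel_measurable_power borel_measurable_diff meas[OF A]) auto
    show "Measurable.pred (F (ennreal (t m))) (\<lambda>\<omega>. (\<Sum>i<m. (A (t (Suc i)) \<omega> - A (t i) \<omega>)\<^sup>2) \<le> \<eta>)"
      unfolding pred_def by (rule borel_measurable_le[OF sum borel_measurable_const])
  qed (rule finite_lessThan)
  then show ?thesis unfolding small_steps_def by (simp only: Ball_def lessThan_iff)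
qed

lemma exponential_grid_bound:
  fixes lam K B \<theta> c' C zm :: real
  assumes Y: "martingale M F Y" and A: "adapted F A"
    and L: "martingale M F (\<lambda>t \<omega>. (Y t \<omega>)\<^sup>2 - (Y 0 \<omega>)\<^sup>2 - A t \<omega>)"
    and bnd: "AE \<omega> in M. \<forall>t\<ge>0. \<bar>Y t \<omega>\<bar> \<le> B \<and> \<bar>A t \<omega>\<bar> \<le> B"
    and t: "0 \<le> t 0" "\<And>j. t j \<le> t (Suc j)"
    and K: "0 \<le> K" and B: "0 \<le> B" and \<theta>: "0 < \<theta>" "\<theta> \<le> 1"
    and c': "lam\<^sup>2 / 2 * exp (\<bar>lam\<bar> * c') \<le> K + \<theta>"
    and C: "C = step_const lam K (2 * B)"
    and zm: "zm = exp ((\<bar>lam\<bar> + K) * B)"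
  shows "(\<integral>\<omega>. exp (lam * Y (t m) \<omega> - K * A (t m) \<omega>) \<partial>M) \<le> (\<integral>\<omega>. exp (lam * Y (t 0) \<omega> - K * A (t 0) \<omega>) \<partial>M)
     + zm * C * (\<theta> * B\<^sup>2 + \<theta>) + (zm * C * ((2 * B)\<^sup>2 / \<theta> + 1) + zm) *
       measure M {\<omega> \<in> space M. \<not> small_steps c' (\<theta>\<^sup>2) (\<lambda>j. Y (t (Suc j)) \<omega> - Y (t j) \<omega>) (\<lambda>j. A (t (Suc j)) \<omega> - A (t j) \<omega>) m}"
proof -
  have mono: "t i \<le> t j" if "i \<le> j" for i j by (rule lift_Suc_mono_le[of t, OF t(2) that])
  have nonneg: "0 \<le> t j" for j by (rule order_trans[OF t(1) mono[of 0 j]]) simp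
  note Y' = martingaleD[OF Y]
  define d where "d = (\<lambda>j \<omega>. Y (t (Suc j)) \<omega> - Y (t j) \<omega>)"
  define e where "e = (\<lambda>j \<omega>. A (t (Suc j)) \<omega> - A (t j) \<omega>)"
  define z where "z = (\<lambda>j \<omega>. exp (lam * Y (t j) \<omega> - K * A (t j) \<omega>))"
  define S where "S = (\<lambda>j \<omega>. small_steps c' (\<theta>\<^sup>2) (\<lambda>j. d j \<omega>) (\<lambda>j. e j \<omega>) j)"
  define G where "G = (\<lambda>j \<omega>. if S j \<omega> then z j \<omega> else 0)"
  have YA_meas: "Y (t j) \<in> borel_measurable (F (ennreal (t j)))" "A (t j) \<in> borel_measurable (F (ennreal (t j)))" for j
    using Y'(1) A nonneg by (auto simp: adapted_def)
  have YA_M[measurable]: "Y (t j) \<in> borel_measurable M" "A (t j) \<in> borel_measurable M" for j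
    using YA_meas measurable_F_M by blast+
  have S_meas: "Measurable.pred (F (ennreal (t j))) (S j)" for j
    unfolding S_def d_def e_def by (rule measurable_small_steps[OF Y'(1) A t])
  have S_M[measurable]: "Measurable.pred M (S j)" for j
    using S_meas[of j] sets_F_subset unfolding pred_def space_F by blast
  have z_M[measurable]: "z j \<in> borel_measurable M" for j unfolding z_def by measurable
  have G_meas: "G j \<in> borel_measurable (F (ennreal (t j)))" for j
  proof -
    note [measurable] = YA_meas S_meas
    show ?thesis unfolding G_def z_def by measurable
  qed
  have bnd': "AE \<omega> in M. \<bar>Y (t j) \<omega>\<bar> \<le> B \<and> \<bar>A (t j) \<omega>\<bar> \<le> B" for j
    using bnd by eventually_elim (use nonneg in auto)
  have z_bnd: "AE \<omega> in M. \<bar>z j \<omega>\<bar> \<le> zm" for j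
    using bnd'[of j]
  proof eventually_elim
    case (elim \<omega>)
    have "lam * Y (t j) \<omega> \<le> \<bar>lam\<bar> * B"
      by (rule order_trans[OF abs_ge_self]) (use elim in \<open>auto simp: abs_mult intro: mult_left_mono\<close>)
    moreover have "- (K * A (t j) \<omega>) \<le> K * B"
      using mult_left_mono[OF abs_le_D2[OF conjunct2[OF elim]] K] by simp
    ultimately show ?case by (simp add: z_def zm algebra_simps)
  qed
  have zm_pos: "0 < zm" by (simp add: zm)
  have C_pos: "0 \<le> C" unfolding C step_const_def using K by (intro add_nonneg_nonneg mult_nonneg_nonneg) auto
  have G_bnd: "AE \<omega> in M. \<bar>G j \<omega>\<bar> \<le> zm" for j
    using z_bnd[of j] by eventually_elim (use zm_pos in \<open>auto simp: G_def\<close>)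
  have int_bnd: "integrable M f" if "f \<in> borel_measurable M" "AE \<omega> in M. \<bar>f \<omega>\<bar> \<le> D" for f :: "'a \<Rightarrow> real" and D
    by (rule integrable_const_bound[where B = D]) (use that in auto)
  have int_z: "integrable M (z j)" for j by (rule int_bnd[OF z_M z_bnd])
  have orth_d: "integrable M (\<lambda>\<omega>. Z \<omega> * d j \<omega>)" "(\<integral>\<omega>. Z \<omega> * d j \<omega> \<partial>M) = 0"
    if "Z \<in> borel_measurable (F (ennreal (t j)))" "AE \<omega> in M. \<bar>Z \<omega>\<bar> \<le> D" for Z D j
    unfolding d_def using martingale_increment_orthogonal[OF Y nonneg t(2) that] by auto
  have orth_L: "integrable M (\<lambda>\<omega>. G j \<omega> * ((d j \<omega>)\<^sup>2 - e j \<omega>))" "(\<integral>\<omega>. G j \<omega> * ((d j \<omega>)\<^sup>2 - e j \<omega>) \<partial>M) = 0" for j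
  proof -
    note o = martingale_increment_orthogonal[OF L nonneg t(2) G_meas G_bnd, of j]
    have Z: "(\<lambda>\<omega>. 2 * G j \<omega> * Y (t j) \<omega>) \<in> borel_measurable (F (ennreal (t j)))"
      by (intro borel_measurable_times borel_measurable_const G_meas YA_meas)
    have Zb: "AE \<omega> in M. \<bar>2 * G j \<omega> * Y (t j) \<omega>\<bar> \<le> 2 * zm * B"
      using G_bnd[of j] bnd'[of j] by eventually_elim (auto simp: abs_mult intro!: mult_mono)
    note o' = orth_d[OF Z Zb]
    (* d^2 - e is the increment of the third martingale minus 2 Y d *)
    have eq: "G j \<omega> * ((d j \<omega>)\<^sup>2 - e j \<omega>) = G j \<omega> * (((Y (t (Suc j)) \<omega>)\<^sup>2 - (Y 0 \<omega>)\<^sup>2 - A (t (Suc j)) \<omega>)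
         - ((Y (t j) \<omega>)\<^sup>2 - (Y 0 \<omega>)\<^sup>2 - A (t j) \<omega>)) - 2 * G j \<omega> * Y (t j) \<omega> * d j \<omega>" for \<omega>
      by (simp add: d_def e_def power2_eq_square algebra_simps)
    show "integrable M (\<lambda>\<omega>. G j \<omega> * ((d j \<omega>)\<^sup>2 - e j \<omega>))" unfolding eq using o(1) o'(1) by (rule Bochner_Integration.integrable_diff)
    show "(\<integral>\<omega>. G j \<omega> * ((d j \<omega>)\<^sup>2 - e j \<omega>) \<partial>M) = 0"
      unfolding eq Bochner_Integration.integral_diff[OF o(1) o'(1)] o(2) o'(2) by simp
  qed
  have Y2: "integrable M (\<lambda>\<omega>. (Y (t j) \<omega>)\<^sup>2)" for j
  proof (rule int_bnd)
    show "AE \<omega> in M. \<bar>(Y (t j) \<omega>)\<^sup>2\<bar> \<le> B\<^sup>2"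
      using bnd'[of j] by eventually_elim (auto intro!: abs_le_square_iff[THEN iffD1] simp: B)
  qed measurable
  have d2: "integrable M (\<lambda>\<omega>. (d j \<omega>)\<^sup>2)" "(\<integral>\<omega>. (d j \<omega>)\<^sup>2 \<partial>M) = (\<integral>\<omega>. (Y (t (Suc j)) \<omega>)\<^sup>2 \<partial>M) - (\<integral>\<omega>. (Y (t j) \<omega>)\<^sup>2 \<partial>M)" for j
  proof -
    have "AE \<omega> in M. \<bar>Y (t j) \<omega>\<bar> \<le> B" using bnd'[of j] by eventually_elim simp
    note o = orth_d[OF YA_meas(1) this]
    have eq: "(d j \<omega>)\<^sup>2 = (Y (t (Suc j)) \<omega>)\<^sup>2 - (Y (t j) \<omega>)\<^sup>2 - 2 * (Y (t j) \<omega> * d j \<omega>)" for \<omega>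
      by (simp add: d_def power2_eq_square algebra_simps)
    show "integrable M (\<lambda>\<omega>. (d j \<omega>)\<^sup>2)" unfolding eq using Y2 o(1) by simp
    show "(\<integral>\<omega>. (d j \<omega>)\<^sup>2 \<partial>M) = (\<integral>\<omega>. (Y (t (Suc j)) \<omega>)\<^sup>2 \<partial>M) - (\<integral>\<omega>. (Y (t j) \<omega>)\<^sup>2 \<partial>M)"
      unfolding eq using Y2 o by simp
  qed
  have sum_d2: "(\<Sum>j<m. \<integral>\<omega>. (d j \<omega>)\<^sup>2 \<partial>M) \<le> B\<^sup>2"
  proof -
    have "(\<Sum>j<m. \<integral>\<omega>. (d j \<omega>)\<^sup>2 \<partial>M) = (\<integral>\<omega>. (Y (t m) \<omega>)\<^sup>2 \<partial>M) - (\<integral>\<omega>. (Y (t 0) \<omega>)\<^sup>2 \<partial>M)"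
      unfolding d2(2) by (rule sum_lessThan_telescope)
    also have "\<dots> \<le> (\<integral>\<omega>. (Y (t m) \<omega>)\<^sup>2 \<partial>M)" by simp
    also have "\<dots> \<le> (\<integral>\<omega>. B\<^sup>2 \<partial>M)"
    proof (rule integral_mono_AE[OF Y2])
      show "AE \<omega> in M. (Y (t m) \<omega>)\<^sup>2 \<le> B\<^sup>2"
        using bnd'[of m] by eventually_elim (auto intro!: abs_le_square_iff[THEN iffD1] simp: B)
    qed simp
    also have "\<dots> = B\<^sup>2" by (simp add: prob_space)
    finally show ?thesis .
  qed
  define D where "D = zm * C * ((2 * B)\<^sup>2 / \<theta> + 1) + zm"
  have int_S: "integrable M (\<lambda>\<omega>. if S m \<omega> then 0 else D)"
    by (rule int_bnd[of _ "\<bar>D\<bar>"]) auto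
  have int_mid: "integrable M (\<lambda>\<omega>. \<Sum>j<m. lam * (G j \<omega> * d j \<omega>) + K * (G j \<omega> * ((d j \<omega>)\<^sup>2 - e j \<omega>)))"
    by (intro Bochner_Integration.integrable_sum Bochner_Integration.integrable_add
        integrable_mult_right orth_d(1)[OF G_meas G_bnd] orth_L(1))
  have int_sq: "integrable M (\<lambda>\<omega>. zm * C * \<theta> * (\<Sum>j<m. (d j \<omega>)\<^sup>2) + zm * C * \<theta>)"
    by (intro Bochner_Integration.integrable_sum Bochner_Integration.integrable_add
        integrable_mult_right d2(1) integrable_const)
  have main: "(\<integral>\<omega>. z m \<omega> \<partial>M) \<le> (\<integral>\<omega>. z 0 \<omega> + (\<Sum>j<m. lam * (G j \<omega> * d j \<omega>) + K * (G j \<omega> * ((d j \<omega>)\<^sup>2 - e j \<omega>)))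
     + (zm * C * \<theta> * (\<Sum>j<m. (d j \<omega>)\<^sup>2) + zm * C * \<theta>) + (if S m \<omega> then 0 else D) \<partial>M)"
  proof (rule integral_mono_AE[OF int_z])
    show "integrable M (\<lambda>\<omega>. z 0 \<omega> + (\<Sum>j<m. lam * (G j \<omega> * d j \<omega>) + K * (G j \<omega> * ((d j \<omega>)\<^sup>2 - e j \<omega>)))
     + (zm * C * \<theta> * (\<Sum>j<m. (d j \<omega>)\<^sup>2) + zm * C * \<theta>) + (if S m \<omega> then 0 else D))"
      by (rule Bochner_Integration.integrable_add[OF Bochner_Integration.integrable_add[OF
          Bochner_Integration.integrable_add[OF int_z int_mid] int_sq] int_S])
    show "AE \<omega> in M. z m \<omega> \<le> z 0 \<omega> + (\<Sum>j<m. lam * (G j \<omega> * d j \<omega>) + K * (G j \<omega> * ((d j \<omega>)\<^sup>2 - e j \<omega>)))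
     + (zm * C * \<theta> * (\<Sum>j<m. (d j \<omega>)\<^sup>2) + zm * C * \<theta>) + (if S m \<omega> then 0 else D)"
      using bnd
    proof eventually_elim
      case (elim \<omega>)
      have b: "\<bar>Y (t j) \<omega>\<bar> \<le> B" "\<bar>A (t j) \<omega>\<bar> \<le> B" for j using elim nonneg by auto
      have eq: "G j \<omega> * (lam * d j \<omega> + K * ((d j \<omega>)\<^sup>2 - e j \<omega>)) =
          lam * (G j \<omega> * d j \<omega>) + K * (G j \<omega> * ((d j \<omega>)\<^sup>2 - e j \<omega>))" for j by (simp add: algebra_simps)
      have "z m \<omega> \<le> z 0 \<omega> + (\<Sum>j<m. G j \<omega> * (lam * d j \<omega> + K * ((d j \<omega>)\<^sup>2 - e j \<omega>)))
         + zm * C * (\<theta> * (\<Sum>j<m. (d j \<omega>)\<^sup>2) + \<theta>) + (if S m \<omega> then 0 else D)"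
        unfolding z_def G_def S_def D_def d_def e_def
        by (rule small_steps_exponential_le[OF K B \<theta> c' b C zm])
      then show ?case unfolding eq by (simp add: distrib_left mult.assoc)
    qed
  qed
  have lin: "(\<integral>\<omega>. z 0 \<omega> + (\<Sum>j<m. lam * (G j \<omega> * d j \<omega>) + K * (G j \<omega> * ((d j \<omega>)\<^sup>2 - e j \<omega>)))
     + (zm * C * \<theta> * (\<Sum>j<m. (d j \<omega>)\<^sup>2) + zm * C * \<theta>) + (if S m \<omega> then 0 else D) \<partial>M)
     = (\<integral>\<omega>. z 0 \<omega> \<partial>M) + (\<integral>\<omega>. (\<Sum>j<m. lam * (G j \<omega> * d j \<omega>) + K * (G j \<omega> * ((d j \<omega>)\<^sup>2 - e j \<omega>))) \<partial>M)
      + (\<integral>\<omega>. zm * C * \<theta> * (\<Sum>j<m. (d j \<omega>)\<^sup>2) + zm * C * \<theta> \<partial>M) + (\<integral>\<omega>. (if S m \<omega> then 0 else D) \<partial>M)"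
    by (simp only: Bochner_Integration.integral_add[OF Bochner_Integration.integrable_add[OF
          Bochner_Integration.integrable_add[OF int_z int_mid] int_sq] int_S]
        Bochner_Integration.integral_add[OF Bochner_Integration.integrable_add[OF int_z int_mid] int_sq]
        Bochner_Integration.integral_add[OF int_z int_mid])
  have mid: "(\<integral>\<omega>. (\<Sum>j<m. lam * (G j \<omega> * d j \<omega>) + K * (G j \<omega> * ((d j \<omega>)\<^sup>2 - e j \<omega>))) \<partial>M) = 0"
    using orth_d[OF G_meas G_bnd] orth_L by (subst Bochner_Integration.integral_sum) auto
  have sq: "(\<integral>\<omega>. zm * C * \<theta> * (\<Sum>j<m. (d j \<omega>)\<^sup>2) + zm * C * \<theta> \<partial>M) \<le> zm * C * (\<theta> * B\<^sup>2 + \<theta>)"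
  proof -
    have "(\<integral>\<omega>. zm * C * \<theta> * (\<Sum>j<m. (d j \<omega>)\<^sup>2) + zm * C * \<theta> \<partial>M) = zm * C * \<theta> * (\<Sum>j<m. \<integral>\<omega>. (d j \<omega>)\<^sup>2 \<partial>M) + zm * C * \<theta>"
      using d2(1) by (subst Bochner_Integration.integral_add) (auto simp: prob_space)
    also have "\<dots> \<le> zm * C * \<theta> * B\<^sup>2 + zm * C * \<theta>"
      using sum_d2 zm_pos C_pos \<theta> by (intro add_mono mult_left_mono) auto
    finally show ?thesis by (simp add: algebra_simps)
  qed
  have last: "(\<integral>\<omega>. (if S m \<omega> then 0 else D) \<partial>M) = D * measure M {\<omega> \<in> space M. \<not> S m \<omega>}"
  proof -
    have "(\<integral>\<omega>. (if S m \<omega> then 0 else D) \<partial>M) = (\<integral>\<omega>. D * indicator {\<omega> \<in> space M. \<not> S m \<omega>} \<omega> \<partial>M)"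
      by (intro Bochner_Integration.integral_cong) auto
    also have "\<dots> = D * measure M {\<omega> \<in> space M. \<not> S m \<omega>}"
    proof -
      have "{\<omega> \<in> space M. \<not> S m \<omega>} \<in> sets M" by measurable
      then show ?thesis by (simp add: integrable_real_indicator less_top[symmetric])
    qed
    finally show ?thesis .
  qed
  have "(\<integral>\<omega>. z m \<omega> \<partial>M) \<le> (\<integral>\<omega>. z 0 \<omega> \<partial>M) + zm * C * (\<theta> * B\<^sup>2 + \<theta>) + D * measure M {\<omega> \<in> space M. \<not> S m \<omega>}"
    using main sq unfolding lin mid last by simp
  then show ?thesis unfolding z_def D_def S_def d_def e_def .
qed

end

lemma finite_variation_on_stopped:
  assumes f: "finite_variation_on f 0 u"
  shows "finite_variation_on (\<lambda>t. f (min_time t T)) 0 u"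
proof -
  obtain B where B: "\<And>n s. mono s \<Longrightarrow> range s \<subseteq> {0..u} \<Longrightarrow> (\<Sum>i<n. \<bar>f (s (Suc i)) - f (s i)\<bar>) \<le> B"
    using f unfolding finite_variation_on_def by blast
  have "(\<Sum>i<n. \<bar>f (min_time (s (Suc i)) T) - f (min_time (s i) T)\<bar>) \<le> B" if s: "mono s" "range s \<subseteq> {0..u}" for n and s :: "nat \<Rightarrow> real"
  proof (rule B)
    have s_bnd: "0 \<le> s i" "s i \<le> u" for i using subsetD[OF s(2) rangeI[of s i]] by auto
    show "mono (\<lambda>i. min_time (s i) T)"
      using s(1) s_bnd by (auto simp: mono_def intro!: min_time_increment(1))
    show "range (\<lambda>i. min_time (s i) T) \<subseteq> {0..u}"
      using min_time_nonneg min_time_le[OF s_bnd(1)] s_bnd(2) order_trans by fastforce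
  qed
  then show ?thesis unfolding finite_variation_on_def by blast
qed

text \<open>
  For the continuous path \<open>g\<close> of finite variation, the sum of squared increments is at most the largest increment
  times the variation.
\<close>

lemma eventually_small_steps:
  assumes f: "cadlag f" "\<And>t. 0 < t \<Longrightarrow> t \<le> u \<Longrightarrow> \<bar>f t - left_limit f t\<bar> \<le> c" "0 \<le> c" "c < c'"
    and g: "cadlag g" "\<And>t. 0 < t \<Longrightarrow> t \<le> u \<Longrightarrow> g t - left_limit g t = 0" "finite_variation_on g 0 u"
    and u: "0 \<le> u" and \<eta>: "0 < \<eta>"
  shows "eventually (\<lambda>k. small_steps c' \<eta>
     (\<lambda>j. f (u * real (Suc j) / real (Suc k)) - f (u * real j / real (Suc k)))
     (\<lambda>j. g (u * real (Suc j) / real (Suc k)) - g (u * real j / real (Suc k))) (Suc k)) sequentially"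
proof -
  obtain V where V: "\<And>n s. mono s \<Longrightarrow> range s \<subseteq> {0..u} \<Longrightarrow> (\<Sum>i<n. \<bar>g (s (Suc i)) - g (s i)\<bar>) \<le> V"
    using g(3) unfolding finite_variation_on_def by blast
  have V0: "0 \<le> V" using V[of "\<lambda>_. 0" 0] u by (simp add: mono_def)
  obtain h1 where h1: "h1 > 0" "\<And>p q. 0 \<le> p \<Longrightarrow> p \<le> q \<Longrightarrow> q \<le> u \<Longrightarrow> q - p \<le> h1 \<Longrightarrow> \<bar>f q - f p\<bar> \<le> c'"
    using abs_increments_le_of_jumps_le[OF f(1,3,4) f(2)] by blast
  define \<kappa> where "\<kappa> = \<eta> / (V + 1)"
  have \<kappa>: "0 < \<kappa>" using \<eta> V0 by (simp add: \<kappa>_def)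
  have g2: "\<bar>g t - left_limit g t\<bar> \<le> 0" if "0 < t" "t \<le> u" for t using g(2)[OF that] by simp
  obtain h2 where h2: "h2 > 0" "\<And>p q. 0 \<le> p \<Longrightarrow> p \<le> q \<Longrightarrow> q \<le> u \<Longrightarrow> q - p \<le> h2 \<Longrightarrow> \<bar>g q - g p\<bar> \<le> \<kappa>"
    using abs_increments_le_of_jumps_le[OF g(1) order_refl \<kappa> g2] by blast
  have "(\<lambda>k. u * (1 / real (Suc k))) \<longlonglongrightarrow> u * 0" by (intro tendsto_mult tendsto_const tendsto_inverse_Suc)
  then have lim: "(\<lambda>k. u * (1 / real (Suc k))) \<longlonglongrightarrow> 0" by simp
  have "0 < min h1 h2" using h1 h2 by simp
  from order_tendstoD(2)[OF lim this] show ?thesis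
  proof eventually_elim
    case (elim k)
    define s where "s = (\<lambda>j. u * real j / real (Suc k))"
    have s_step: "s (Suc j) - s j = u * (1 / real (Suc k))" for j
      unfolding s_def diff_divide_distrib[symmetric] right_diff_distrib[symmetric] by simp
    have s_le: "s j \<le> s (Suc j)" for j 
    proof -
      have "0 \<le> u * (1 / real (Suc k))" using u by simp
      with s_step[of j] show ?thesis by linarith
    qed
    have s_nonneg: "0 \<le> s j" for j using u by (simp add: s_def)
    have s_u: "s j \<le> u" if "j \<le> Suc k" for j
      using that u by (simp add: s_def divide_le_eq mult_left_mono del: of_nat_Suc)
    have f_step: "\<bar>f (s (Suc j)) - f (s j)\<bar> \<le> c'" and g_step: "\<bar>g (s (Suc j)) - g (s j)\<bar> \<le> \<kappa>" if "j < Suc k" for j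
      using h1(2)[of "s j" "s (Suc j)"] h2(2)[of "s j" "s (Suc j)"] s_nonneg[of j] s_le[of j] s_u[of "Suc j"] that s_step[of j] elim
      by auto
    have "(\<Sum>j<Suc k. (g (s (Suc j)) - g (s j))\<^sup>2) \<le> (\<Sum>j<Suc k. \<kappa> * \<bar>g (s (Suc j)) - g (s j)\<bar>)"
    proof (rule sum_mono)
      fix j assume "j \<in> {..<Suc k}"
      then have "\<bar>g (s (Suc j)) - g (s j)\<bar> * \<bar>g (s (Suc j)) - g (s j)\<bar> \<le> \<kappa> * \<bar>g (s (Suc j)) - g (s j)\<bar>"
        by (intro mult_right_mono g_step) auto
      then show "(g (s (Suc j)) - g (s j))\<^sup>2 \<le> \<kappa> * \<bar>g (s (Suc j)) - g (s j)\<bar>"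
        by (simp add: power2_eq_square)
    qed
    also have "\<dots> = \<kappa> * (\<Sum>j<Suc k. \<bar>g (min u (s (Suc j))) - g (min u (s j))\<bar>)"
      unfolding sum_distrib_left using s_u by (intro sum.cong refl) (auto simp: min_absorb2)
    also have "\<dots> \<le> \<kappa> * V"
    proof (intro mult_left_mono V)
      show "mono (\<lambda>j. min u (s j))" unfolding mono_iff_le_Suc by (intro allI min.mono order_refl s_le)
      show "range (\<lambda>j. min u (s j)) \<subseteq> {0..u}" using s_nonneg u by auto
    qed (use \<kappa> in auto)
    also have "\<dots> \<le> \<eta>" using V0 \<eta> by (simp add: \<kappa>_def field_simps)
    finally show ?case using f_step unfolding small_steps_def s_def by blast
  qed
qed

lemma cadlag_abs: "cadlag f \<Longrightarrow> cadlag (\<lambda>t. \<bar>f t\<bar>)" for f :: "real \<Rightarrow> real"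
  unfolding cadlag_def by (metis tendsto_rabs)

lemma cadlag_diff: "cadlag f \<Longrightarrow> cadlag g \<Longrightarrow> cadlag (\<lambda>t. f t - g t)"
  unfolding cadlag_def by (metis tendsto_diff)

lemma cadlag_cmult: "cadlag f \<Longrightarrow> cadlag (\<lambda>t. c * f t)"
  unfolding cadlag_def by (metis tendsto_mult_left)

text \<open>
  Before the hitting time of level \<open>R\<close> the process is bounded by \<open>R\<close>, and at this time it overshoots by at most one jump.
\<close>

lemma abs_le_at_hitting_time:
  assumes f: "cadlag (\<lambda>t. Y t \<omega>)" and s: "0 \<le> s" "ennreal s \<le> hitting_time (\<lambda>t \<omega>. \<bar>Y t \<omega>\<bar>) R \<omega>"
    and 0: "\<bar>Y 0 \<omega>\<bar> \<le> R + c" and j: "0 < s \<Longrightarrow> \<bar>jump Y s \<omega>\<bar> \<le> c"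
  shows "\<bar>Y s \<omega>\<bar> \<le> R + c"
proof (cases "s = 0")
  case False
  then have spos: "0 < s" using s by simp
  have "\<bar>left_limit (\<lambda>t. Y t \<omega>) s\<bar> \<le> R"
  proof (rule tendsto_upperbound)
    show "((\<lambda>t. \<bar>Y t \<omega>\<bar>) \<longlongrightarrow> \<bar>left_limit (\<lambda>t. Y t \<omega>) s\<bar>) (at_left s)"
      by (intro tendsto_rabs left_limit_tendsto f spos)
    show "eventually (\<lambda>t. \<bar>Y t \<omega>\<bar> \<le> R) (at_left s)"
      using eventually_at_left_real[OF spos]
    proof eventually_elim
      case (elim t)
      then have "ennreal t < ennreal s" by (auto intro: ennreal_lessI)
      from less_le_trans[OF this s(2)] show ?case
        using le_before_hitting_time[where Y = "\<lambda>t \<omega>. \<bar>Y t \<omega>\<bar>" and \<omega> = \<omega>, OF cadlag_abs[OF f]] elim by auto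
    qed
  qed simp
  then show ?thesis using j[OF spos] by (simp add: jump_def)
qed (use 0 in simp)

context usual_filtered_prob_space
begin

text \<open>
  Refining the grid removes the penalty, because almost every path eventually has small steps; then \<open>\<theta>\<close> tends to \<open>0\<close>.
\<close>

theorem exponential_bound:
  fixes lam K B c :: real
  assumes Y: "martingale M F Y" and A: "adapted F A"
    and L: "martingale M F (\<lambda>t \<omega>. (Y t \<omega>)\<^sup>2 - (Y 0 \<omega>)\<^sup>2 - A t \<omega>)"
    and bnd: "AE \<omega> in M. \<forall>t\<ge>0. \<bar>Y t \<omega>\<bar> \<le> B \<and> \<bar>A t \<omega>\<bar> \<le> B" and B: "0 \<le> B"
    and jY: "AE \<omega> in M. \<forall>t>0. \<bar>jump Y t \<omega>\<bar> \<le> c" and c: "0 \<le> c"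
    and cA: "AE \<omega> in M. cadlag (\<lambda>t. A t \<omega>)" and jA: "AE \<omega> in M. \<forall>t>0. jump A t \<omega> = 0"
    and u: "0 \<le> u" and vA: "AE \<omega> in M. finite_variation_on (\<lambda>t. A t \<omega>) 0 u"
    and K: "K = lam\<^sup>2 / 2 * exp (\<bar>lam\<bar> * c)"
  shows "(\<integral>\<omega>. exp (lam * Y u \<omega> - K * A u \<omega>) \<partial>M) \<le> (\<integral>\<omega>. exp (lam * Y 0 \<omega> - K * A 0 \<omega>) \<partial>M)"
proof -
  note Y' = martingaleD[OF Y]
  have K0: "0 \<le> K" by (simp add: K)
  define C where "C = step_const lam K (2 * B)"
  define zm where "zm = exp ((\<bar>lam\<bar> + K) * B)"
  let ?E = "\<lambda>t. \<integral>\<omega>. exp (lam * Y t \<omega> - K * A t \<omega>) \<partial>M"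
  have step: "?E u \<le> ?E 0 + zm * C * (\<theta> * B\<^sup>2 + \<theta>)" if \<theta>: "0 < \<theta>" "\<theta> \<le> 1" for \<theta>
  proof -
    have "((\<lambda>x. lam\<^sup>2 / 2 * exp (\<bar>lam\<bar> * x)) \<longlongrightarrow> K) (at_right c)"
      unfolding K by (intro tendsto_intros)
    from order_tendstoD(2)[OF this, of "K + \<theta>"] \<theta>
    obtain c2 where c2: "c < c2" "\<And>x. c < x \<Longrightarrow> x < c2 \<Longrightarrow> lam\<^sup>2 / 2 * exp (\<bar>lam\<bar> * x) < K + \<theta>"
      unfolding eventually_at_right_field by auto
    (* the step bound must exceed c strictly to be met eventually; the excess costs only theta d^2 *)
    obtain c' where c': "c < c'" "c' < c2" using dense[OF c2(1)] by blast
    have c'K: "lam\<^sup>2 / 2 * exp (\<bar>lam\<bar> * c') \<le> K + \<theta>" using c2(2)[OF c'] by simp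
    define t where "t = (\<lambda>k j. u * real j / real (Suc k))"
    have t0: "t k 0 = 0" "t k (Suc k) = u" for k by (simp_all add: t_def)
    have t_mono: "t k j \<le> t k (Suc j)" for k j using u by (auto simp: t_def intro!: divide_right_mono mult_left_mono)
    define S where "S = (\<lambda>k \<omega>. small_steps c' (\<theta>\<^sup>2) (\<lambda>j. Y (t k (Suc j)) \<omega> - Y (t k j) \<omega>) (\<lambda>j. A (t k (Suc j)) \<omega> - A (t k j) \<omega>) (Suc k))"
    define p where "p = (\<lambda>k. measure M {\<omega> \<in> space M. \<not> S k \<omega>})"
    define D where "D = zm * C * ((2 * B)\<^sup>2 / \<theta> + 1) + zm"
    have S_meas: "Measurable.pred M (S k)" for k
    proof -
      have "Measurable.pred (F (ennreal (t k (Suc k)))) (S k)"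
        unfolding S_def by (rule measurable_small_steps[OF Y'(1) A]) (simp_all only: t0 t_mono order_refl)
      then show ?thesis unfolding pred_def space_F by (rule sets_F_M)
    qed
    have bound: "?E u \<le> ?E 0 + zm * C * (\<theta> * B\<^sup>2 + \<theta>) + D * p k" for k
      using exponential_grid_bound[where t = "t k" and m = "Suc k", OF Y A L bnd _ t_mono K0 B \<theta> c'K C_def zm_def]
      unfolding t0 p_def D_def S_def by simp
    have "p \<longlonglongrightarrow> 0"
    proof -
      have set: "{\<omega> \<in> space M. \<not> S k \<omega>} \<in> sets M" for k using S_meas[of k] by measurable
      have "(\<lambda>k. \<integral>\<omega>. indicator {\<omega> \<in> space M. \<not> S k \<omega>} \<omega> \<partial>M) \<longlonglongrightarrow> (\<integral>\<omega>. 0 \<partial>M :: real)"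
      proof (rule integral_dominated_convergence[where w = "\<lambda>_. 1"])
        show "AE \<omega> in M. (\<lambda>k. indicator {\<omega> \<in> space M. \<not> S k \<omega>} \<omega> :: real) \<longlonglongrightarrow> 0"
          using Y'(2) jY cA jA vA
        proof eventually_elim
          case (elim \<omega>)
          have "eventually (\<lambda>k. S k \<omega>) sequentially"
            unfolding S_def t_def
            by (rule eventually_small_steps[OF elim(1) _ c c'(1) elim(3) _ elim(5) u])
               (use elim(2,4) \<theta> in \<open>auto simp: jump_def\<close>)
          then have "eventually (\<lambda>k. indicator {\<omega> \<in> space M. \<not> S k \<omega>} \<omega> = (0::real)) sequentially"
            by eventually_elim simp
          then show ?case by (rule tendsto_eventually)
        qed
        show "(\<lambda>\<omega>. indicator {\<omega> \<in> space M. \<not> S k \<omega>} \<omega> :: real) \<in> borel_measurable M" for k using set by simp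
      qed auto
      then show ?thesis using set by (simp add: p_def)
    qed
    then have "(\<lambda>k. ?E 0 + zm * C * (\<theta> * B\<^sup>2 + \<theta>) + D * p k) \<longlonglongrightarrow> ?E 0 + zm * C * (\<theta> * B\<^sup>2 + \<theta>) + D * 0"
      by (intro tendsto_intros)
    then show ?thesis by (intro LIMSEQ_le_const[where X = "\<lambda>k. ?E 0 + zm * C * (\<theta> * B\<^sup>2 + \<theta>) + D * p k"]) (use bound in auto)
  qed
  have "(\<lambda>n. ?E 0 + zm * C * (1 / real (Suc n) * B\<^sup>2 + 1 / real (Suc n))) \<longlonglongrightarrow> ?E 0 + zm * C * (0 * B\<^sup>2 + 0)"
    by (intro tendsto_add tendsto_mult tendsto_const tendsto_inverse_Suc)
  then have lim: "(\<lambda>n. ?E 0 + zm * C * (1 / real (Suc n) * B\<^sup>2 + 1 / real (Suc n))) \<longlonglongrightarrow> ?E 0" by simp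
  show ?thesis
    by (rule LIMSEQ_le_const[OF lim]) (intro exI[of _ 0] allI impI step, auto)
qed

section \<open>The maximal inequality\<close>

lemma martingale_stopped_earlier:
  assumes S: "martingale M F (stopped N S)" and T: "stopping_time F T" "\<And>\<omega>. T \<omega> \<le> S \<omega>"
  shows "martingale M F (stopped N T)"
proof -
  have "stopped (stopped N S) T = stopped N T"
    unfolding stopped_stopped using T(2) by (simp add: min_absorb2)
  with martingale_stopped[OF S T(1)] show ?thesis by simp
qed

text \<open>
  The processes are stopped when \<open>W\<close> exceeds \<open>b\<close>, and also at reducing times and at level \<open>n\<close> in order to have bounded
  martingales. On \<open>E n\<close> the first of these reasons takes effect by time \<open>n\<close>, so that \<open>W \<ge> b\<close> at the stopped time
  \<open>n\<close>; and \<open>E n\<close> tends to the event that \<open>b\<close> is exceeded at all.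
\<close>

theorem exponential_maximal_inequality:
  fixes lam K c b :: real
  assumes N: "local_martingale M F N" and L: "local_martingale M F (martingale_part (\<lambda>t \<omega>. (N t \<omega>)\<^sup>2) Q)"
    and N0: "AE \<omega> in M. N 0 \<omega> = 0" and Q0: "AE \<omega> in M. Q 0 \<omega> = 0"
    and Q: "locally_finite_variation M F Q"
    and jN: "AE \<omega> in M. \<forall>t>0. \<bar>jump N t \<omega>\<bar> \<le> c" and c: "0 \<le> c" and jQ: "AE \<omega> in M. \<forall>t>0. jump Q t \<omega> = 0"
    and K: "K = lam\<^sup>2 / 2 * exp (\<bar>lam\<bar> * c)"
  defines "W \<equiv> (\<lambda>t \<omega>. lam * N t \<omega> - K * Q t \<omega>)"
  shows "measure M {\<omega> \<in> space M. hitting_time W b \<omega> < \<infinity>} \<le> exp (- b)"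
proof -
  obtain S1 :: "nat \<Rightarrow> 'a \<Rightarrow> ennreal" where S1: "\<And>n. stopping_time F (S1 n)"
    "AE \<omega> in M. incseq (\<lambda>n. S1 n \<omega>) \<and> (\<lambda>n. S1 n \<omega>) \<longlonglongrightarrow> \<infinity>" "\<And>n. martingale M F (stopped N (S1 n))"
    using N by (auto simp: local_martingale_def)
  obtain S2 :: "nat \<Rightarrow> 'a \<Rightarrow> ennreal" where S2: "\<And>n. stopping_time F (S2 n)"
    "AE \<omega> in M. incseq (\<lambda>n. S2 n \<omega>) \<and> (\<lambda>n. S2 n \<omega>) \<longlonglongrightarrow> \<infinity>"
    "\<And>n. martingale M F (stopped (martingale_part (\<lambda>t \<omega>. (N t \<omega>)\<^sup>2) Q) (S2 n))"
    using L by (auto simp: local_martingale_def)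
  have adN: "adapted F N" and cN: "AE \<omega> in M. cadlag (\<lambda>t. N t \<omega>)" using N by (auto simp: local_martingale_def)
  have adQ: "adapted F Q" and cQ: "AE \<omega> in M. cadlag (\<lambda>t. Q t \<omega>)"
    and vQ: "AE \<omega> in M. \<forall>t\<ge>0. finite_variation_on (\<lambda>s. Q s \<omega>) 0 t"
    using Q by (auto simp: locally_finite_variation_def)
  (* before H n both N and Q are bounded by n *)
  define H where "H = (\<lambda>(n::nat) \<omega>. min (hitting_time (\<lambda>t \<omega>. \<bar>N t \<omega>\<bar>) (real n) \<omega>) (hitting_time (\<lambda>t \<omega>. \<bar>Q t \<omega>\<bar>) (real n) \<omega>))"
  define \<rho> where "\<rho> = (\<lambda>n \<omega>. min (min (S1 n \<omega>) (S2 n \<omega>)) (H n \<omega>))"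
  define \<tau> where "\<tau> = (\<lambda>n \<omega>. min (\<rho> n \<omega>) (hitting_time W b \<omega>))"
  have stW: "stopping_time F (hitting_time W b)"
    by (rule stopping_time_hitting_time) (use adN adQ in \<open>auto simp: W_def adapted_def intro!: borel_measurable_diff borel_measurable_times\<close>)
  have st\<rho>: "stopping_time F (\<rho> n)" for n
    unfolding \<rho>_def H_def
    by (intro stopping_time_min S1(1) S2(1) stopping_time_hitting_time) (use adN adQ in \<open>auto simp: adapted_def\<close>)
  have st\<tau>: "stopping_time F (\<tau> n)" for n
    unfolding \<tau>_def by (intro stopping_time_min st\<rho> stW)
  define E where "E = (\<lambda>n. {\<omega> \<in> space M. hitting_time W b \<omega> \<le> min (\<rho> n \<omega>) (ennreal (real n))})"
  have [measurable]: "hitting_time W b \<in> borel_measurable M" "\<rho> n \<in> borel_measurable M" for n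
    by (intro stopping_time_measurable_M stW st\<rho>)+
  have E_sets[measurable]: "E n \<in> sets M" for n unfolding E_def by measurable
  have E_le: "measure M (E n) \<le> exp (- b)" for n
  proof -
    define Y where "Y = stopped N (\<tau> n)"
    define A where "A = stopped Q (\<tau> n)"
    define B where "B = real n + c"
    have B: "0 \<le> B" using c by (simp add: B_def)
    have Y: "martingale M F Y"
      unfolding Y_def by (rule martingale_stopped_earlier[OF S1(3)[of n] st\<tau>]) (simp add: \<tau>_def \<rho>_def min_le_iff_disj)
    have A: "adapted F A" unfolding A_def by (rule adapted_stopped[OF adQ cQ st\<tau>])
    have "martingale M F (stopped (martingale_part (\<lambda>t \<omega>. (N t \<omega>)\<^sup>2) Q) (\<tau> n))"
      by (rule martingale_stopped_earlier[OF S2(3)[of n] st\<tau>]) (simp add: \<tau>_def \<rho>_def min_le_iff_disj)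
    also have "stopped (martingale_part (\<lambda>t \<omega>. (N t \<omega>)\<^sup>2) Q) (\<tau> n) = (\<lambda>t \<omega>. (Y t \<omega>)\<^sup>2 - (Y 0 \<omega>)\<^sup>2 - A t \<omega>)"
      by (intro ext) (simp add: stopped_def martingale_part_def Y_def A_def)
    finally have LY: "martingale M F (\<lambda>t \<omega>. (Y t \<omega>)\<^sup>2 - (Y 0 \<omega>)\<^sup>2 - A t \<omega>)" .
    have min_le: "ennreal (min_time t (\<tau> n \<omega>)) \<le> H n \<omega>" if "0 \<le> t" for t \<omega>
    proof -
      have "ennreal (min_time t (\<tau> n \<omega>)) \<le> \<tau> n \<omega>"
        using that by (cases rule: min_time_cases[of t "\<tau> n \<omega>"]) auto
      also have "\<dots> \<le> H n \<omega>" by (simp add: \<tau>_def \<rho>_def min.coboundedI1)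
      finally show ?thesis .
    qed
    have bnd: "AE \<omega> in M. \<forall>t\<ge>0. \<bar>Y t \<omega>\<bar> \<le> B \<and> \<bar>A t \<omega>\<bar> \<le> B"
      using cN cQ N0 Q0 jN jQ
    proof eventually_elim
      case (elim \<omega>)
      show ?case
      proof (intro allI impI conjI)
        fix t :: real assume t: "0 \<le> t"
        show "\<bar>Y t \<omega>\<bar> \<le> B" unfolding Y_def stopped_eq B_def
          by (rule abs_le_at_hitting_time[where Y = N and \<omega> = \<omega>, OF elim(1) min_time_nonneg])
             (use elim c min_le[OF t, of \<omega>] in \<open>auto simp: H_def\<close>)
        show "\<bar>A t \<omega>\<bar> \<le> B" unfolding A_def stopped_eq B_def
          by (rule abs_le_at_hitting_time[where Y = Q and \<omega> = \<omega>, OF elim(2) min_time_nonneg])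
             (use elim c min_le[OF t, of \<omega>] in \<open>auto simp: H_def\<close>)
      qed
    qed
    have jY: "AE \<omega> in M. \<forall>t>0. \<bar>jump Y t \<omega>\<bar> \<le> c"
      using jN cN by eventually_elim (use c in \<open>auto simp: Y_def jump_stopped\<close>)
    have jA: "AE \<omega> in M. \<forall>t>0. jump A t \<omega> = 0"
      using jQ cQ by eventually_elim (auto simp: A_def jump_stopped)
    have cA: "AE \<omega> in M. cadlag (\<lambda>t. A t \<omega>)"
      using cQ unfolding A_def stopped_eq by eventually_elim (rule cadlag_stopped)
    have vA: "AE \<omega> in M. finite_variation_on (\<lambda>t. A t \<omega>) 0 (real n)"
      using vQ unfolding A_def stopped_eq by eventually_elim (rule finite_variation_on_stopped, simp)
    have "(\<integral>\<omega>. exp (lam * Y (real n) \<omega> - K * A (real n) \<omega>) \<partial>M) \<le> (\<integral>\<omega>. exp (lam * Y 0 \<omega> - K * A 0 \<omega>) \<partial>M)"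
      by (rule exponential_bound[OF Y A LY bnd B jY c cA jA _ vA K]) simp
    also have "\<dots> = (\<integral>\<omega>. 1 \<partial>M)"
    proof (rule integral_cong_AE)
      have "Y 0 \<in> borel_measurable M" "A 0 \<in> borel_measurable M"
        using martingaleD(1)[OF Y] A measurable_F_M unfolding adapted_def by (metis order_refl)+
      then show "(\<lambda>\<omega>. exp (lam * Y 0 \<omega> - K * A 0 \<omega>)) \<in> borel_measurable M" by measurable
      show "AE \<omega> in M. exp (lam * Y 0 \<omega> - K * A 0 \<omega>) = 1"
        using N0 Q0 by eventually_elim (simp add: Y_def A_def stopped_def)
    qed simp
    also have "\<dots> = 1" by (simp add: prob_space)
    finally have E1: "(\<integral>\<omega>. exp (lam * Y (real n) \<omega> - K * A (real n) \<omega>) \<partial>M) \<le> 1" .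
    have "exp b * measure M (E n) = (\<integral>\<omega>. exp b * indicator (E n) \<omega> \<partial>M)" by simp
    also have "\<dots> \<le> (\<integral>\<omega>. exp (lam * Y (real n) \<omega> - K * A (real n) \<omega>) \<partial>M)"
    proof (rule integral_mono_AE)
      have YA: "Y (real n) \<in> borel_measurable M" "A (real n) \<in> borel_measurable M"
        using martingaleD(1)[OF Y] A measurable_F_M unfolding adapted_def by (metis of_nat_0_le_iff)+
      show "integrable M (\<lambda>\<omega>. exp (lam * Y (real n) \<omega> - K * A (real n) \<omega>))"
      proof (rule integrable_const_bound[where B = "exp (\<bar>lam\<bar> * B + \<bar>K\<bar> * B)"])
        show "AE \<omega> in M. norm (exp (lam * Y (real n) \<omega> - K * A (real n) \<omega>)) \<le> exp (\<bar>lam\<bar> * B + \<bar>K\<bar> * B)"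
          using bnd
        proof eventually_elim
          case (elim \<omega>)
          have "\<bar>lam * Y (real n) \<omega>\<bar> \<le> \<bar>lam\<bar> * B" "\<bar>K * A (real n) \<omega>\<bar> \<le> \<bar>K\<bar> * B"
            using elim by (auto simp: abs_mult intro!: mult_left_mono)
          then show ?case by simp
        qed
        show "(\<lambda>\<omega>. exp (lam * Y (real n) \<omega> - K * A (real n) \<omega>)) \<in> borel_measurable M" using YA by measurable
      qed
      show "AE \<omega> in M. exp b * indicator (E n) \<omega> \<le> exp (lam * Y (real n) \<omega> - K * A (real n) \<omega>)"
        using cN cQ
      proof eventually_elim
        case (elim \<omega>)
        show ?case
        proof (cases "\<omega> \<in> E n")
          case True
          then have le: "hitting_time W b \<omega> \<le> \<rho> n \<omega>" "hitting_time W b \<omega> \<le> ennreal (real n)" by (auto simp: E_def)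
          then obtain r where r: "0 \<le> r" "hitting_time W b \<omega> = ennreal r"
            by (cases "hitting_time W b \<omega>") (auto simp: top_unique)
          have "\<tau> n \<omega> = ennreal r" using le r by (simp add: \<tau>_def min_absorb2)
          then have "min_time (real n) (\<tau> n \<omega>) = r" using le r by (simp add: min_time_of_ge)
          moreover have "b \<le> W r \<omega>"
          proof (rule ge_at_hitting_time[where Y = W and \<omega> = \<omega>, OF _ r(2,1)])
            show "cadlag (\<lambda>t. W t \<omega>)" unfolding W_def by (intro cadlag_diff cadlag_cmult elim)
          qed
          ultimately show ?thesis using True by (simp add: Y_def A_def stopped_eq W_def)
        qed simp
      qed
    qed (auto intro!: integrable_real_indicator simp: less_top[symmetric])
    finally have "exp b * measure M (E n) \<le> 1" using E1 by simp
    then show ?thesis by (simp add: exp_minus field_simps)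
  qed
  have lim: "(\<lambda>n. measure M (E n)) \<longlonglongrightarrow> measure M {\<omega> \<in> space M. hitting_time W b \<omega> < \<infinity>}"
  proof -
    have D: "{\<omega> \<in> space M. hitting_time W b \<omega> < \<infinity>} \<in> sets M" by measurable
    have "(\<lambda>n. \<integral>\<omega>. indicator (E n) \<omega> \<partial>M) \<longlonglongrightarrow> (\<integral>\<omega>. indicator {\<omega> \<in> space M. hitting_time W b \<omega> < \<infinity>} \<omega> \<partial>M :: real)"
    proof (rule integral_dominated_convergence[where w = "\<lambda>_. 1"])
      show "AE \<omega> in M. (\<lambda>n. indicator (E n) \<omega> :: real) \<longlonglongrightarrow> indicator {\<omega> \<in> space M. hitting_time W b \<omega> < \<infinity>} \<omega>"
        using cN cQ S1(2) S2(2) AE_space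
      proof eventually_elim
        case (elim \<omega>)
        have "eventually (\<lambda>n. \<omega> \<in> E n \<longleftrightarrow> hitting_time W b \<omega> < \<infinity>) sequentially"
        proof (cases "hitting_time W b \<omega>")
          case (real r)
          obtain B1 where B1: "\<And>t. 0 \<le> t \<Longrightarrow> t \<le> r \<Longrightarrow> \<bar>N t \<omega>\<bar> \<le> B1" using cadlag_bounded[OF elim(1)] by blast
          obtain B2 where B2: "\<And>t. 0 \<le> t \<Longrightarrow> t \<le> r \<Longrightarrow> \<bar>Q t \<omega>\<bar> \<le> B2" using cadlag_bounded[OF elim(2)] by blast
          have "eventually (\<lambda>n. ennreal r < S1 n \<omega>) sequentially" "eventually (\<lambda>n. ennreal r < S2 n \<omega>) sequentially"
            using order_tendstoD(1)[OF conjunct2[OF elim(3)], of "ennreal r"] order_tendstoD(1)[OF conjunct2[OF elim(4)], of "ennreal r"]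
            by auto
          moreover have "eventually (\<lambda>n. max r (max B1 B2) \<le> real n) sequentially"
            using filterlim_real_sequentially unfolding filterlim_at_top by blast
          ultimately show ?thesis
          proof eventually_elim
            case (elim n)
            have "ennreal r \<le> hitting_time (\<lambda>t \<omega>. \<bar>N t \<omega>\<bar>) (real n) \<omega>"
            proof (rule ccontr)
              assume "\<not> ?thesis"
              then obtain q where "0 \<le> q" "ennreal q < ennreal r" "real n < \<bar>N q \<omega>\<bar>"
                by (auto simp: not_le hitting_time_less_iff)
              with B1[of q] elim(3) show False by (auto simp: ennreal_less_iff)
            qed
            moreover have "ennreal r \<le> hitting_time (\<lambda>t \<omega>. \<bar>Q t \<omega>\<bar>) (real n) \<omega>"
            proof (rule ccontr)
              assume "\<not> ?thesis"
              then obtain q where "0 \<le> q" "ennreal q < ennreal r" "real n < \<bar>Q q \<omega>\<bar>"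
                by (auto simp: not_le hitting_time_less_iff)
              with B2[of q] elim(3) show False by (auto simp: ennreal_less_iff)
            qed
            ultimately have "ennreal r \<le> \<rho> n \<omega>" using elim(1,2) by (simp add: \<rho>_def H_def less_imp_le)
            moreover have "ennreal r \<le> ennreal (real n)" using elim(3) by (intro ennreal_leI) simp
            ultimately show ?case using \<open>\<omega> \<in> space M\<close> real by (simp add: E_def)
          qed
        qed (auto simp: E_def top_unique)
        then have "eventually (\<lambda>n. indicator (E n) \<omega> = (indicator {\<omega> \<in> space M. hitting_time W b \<omega> < \<infinity>} \<omega> :: real)) sequentially"
          by eventually_elim (use elim(5) in \<open>auto simp: indicator_def\<close>)
        then show ?case by (rule tendsto_eventually)
      qed
    qed (use D in auto)
    then show ?thesis using D by simp
  qed
  show ?thesis by (rule LIMSEQ_le_const2[OF lim]) (use E_le in auto)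
qed

end

lemma jump_martingale_part:
  assumes N: "cadlag (\<lambda>t. martingale_part X A t \<omega>)" and A: "cadlag (\<lambda>t. A t \<omega>)" and t: "0 < t"
  shows "jump X t \<omega> = jump (martingale_part X A) t \<omega> + jump A t \<omega>"
proof -
  have X: "X s \<omega> = X 0 \<omega> + (martingale_part X A s \<omega> + A s \<omega>)" for s by (simp add: martingale_part_def)
  have "left_limit (\<lambda>s. X s \<omega>) t = X 0 \<omega> + (left_limit (\<lambda>s. martingale_part X A s \<omega>) t + left_limit (\<lambda>s. A s \<omega>) t)"
  proof (rule left_limit_eqI[OF t])
    have "((\<lambda>s. X 0 \<omega> + (martingale_part X A s \<omega> + A s \<omega>)) \<longlongrightarrow>
        X 0 \<omega> + (left_limit (\<lambda>s. martingale_part X A s \<omega>) t + left_limit (\<lambda>s. A s \<omega>) t)) (at_left t)"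
      by (intro tendsto_add tendsto_const left_limit_tendsto N A t)
    then show "((\<lambda>s. X s \<omega>) \<longlongrightarrow>
        X 0 \<omega> + (left_limit (\<lambda>s. martingale_part X A s \<omega>) t + left_limit (\<lambda>s. A s \<omega>) t)) (at_left t)"
      unfolding X[symmetric] .
  qed
  then show ?thesis by (simp add: jump_def martingale_part_def)
qed

lemma jump_square_eq_0:
  assumes N: "cadlag (\<lambda>t. N t \<omega>)" and t: "0 < t" and j: "jump N t \<omega> = 0"
  shows "jump (\<lambda>t \<omega>. (N t \<omega>)\<^sup>2) t \<omega> = 0"
proof -
  have "left_limit (\<lambda>t. (N t \<omega>)\<^sup>2) t = (left_limit (\<lambda>t. N t \<omega>) t)\<^sup>2"
    by (rule left_limit_eqI[OF t]) (intro tendsto_power left_limit_tendsto N t)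
  with j show ?thesis by (simp add: jump_def)
qed

theorem lemma3:
  fixes M :: "'a measure" and F :: "ennreal \<Rightarrow> 'a measure"
    and X Xp Q :: "real \<Rightarrow> 'a \<Rightarrow> real"
    and c lam a \<epsilon> :: real
  assumes "usual_filtered_prob_space M F"
    and "semimartingale M F X"
    and "quasi_left_continuous M F X"
    and "c > 0"
    and "AE \<omega> in M. \<forall>t\<ge>0. \<bar>jump X t \<omega>\<bar> \<le> c"
    and "compensator M F X Xp"
    and "predictable_quadratic_variation M F (martingale_part X Xp) Q"
    and "lam > 0" and "a > 0"
    and "\<epsilon> \<in> {1, -1}"
  shows "outer_measure_of M
           {\<omega> \<in> space M. \<exists>t\<ge>0. \<epsilon> * (X t \<omega> - X 0 \<omega> - Xp t \<omega>)
                                  \<ge> a + lam * exp (lam * c) / 2 * Q t \<omega>}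
         \<le> ennreal (exp (- lam * a))"
proof -
  interpret usual_filtered_prob_space M F by (rule assms(1))
  define N where "N = martingale_part X Xp"
  have Xp: "predictable F Xp" "locally_finite_variation M F Xp" "AE \<omega> in M. Xp 0 \<omega> = 0"
    and N: "local_martingale M F N"
    using assms(6) by (auto simp: compensator_def N_def)
  have Q: "predictable F Q" "locally_finite_variation M F Q" "AE \<omega> in M. Q 0 \<omega> = 0"
    and L: "local_martingale M F (martingale_part (\<lambda>t \<omega>. (N t \<omega>)\<^sup>2) Q)"
    using assms(7) by (auto simp: predictable_quadratic_variation_def compensator_def N_def)
  have cN: "AE \<omega> in M. cadlag (\<lambda>t. N t \<omega>)" using N by (simp add: local_martingale_def)
  have cL: "AE \<omega> in M. cadlag (\<lambda>t. martingale_part (\<lambda>t \<omega>. (N t \<omega>)\<^sup>2) Q t \<omega>)" using L by (simp add: local_martingale_def)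
  have adXp: "adapted F Xp" and cXp: "AE \<omega> in M. cadlag (\<lambda>t. Xp t \<omega>)"
    using Xp(2) by (auto simp: locally_finite_variation_def)
  have adQ: "adapted F Q" and cQ: "AE \<omega> in M. cadlag (\<lambda>t. Q t \<omega>)"
    using Q(2) by (auto simp: locally_finite_variation_def)
  have qlc: "AE \<omega> in M. T \<omega> < \<infinity> \<longrightarrow> jump X (enn2real (T \<omega>)) \<omega> = 0" if "predictable_time F T" for T
    using assms(3) that by (auto simp: quasi_left_continuous_def)
  have jX_eq: "AE \<omega> in M. \<forall>t\<ge>0. jump X t \<omega> = jump N t \<omega> + jump Xp t \<omega>"
    using cN cXp
  proof eventually_elim
    case (elim \<omega>)
    show ?case
    proof (intro allI impI)
      fix t :: real assume "0 \<le> t"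
      then show "jump X t \<omega> = jump N t \<omega> + jump Xp t \<omega>"
        using jump_martingale_part[where X = X and A = Xp, OF elim[unfolded N_def]]
        by (cases "t = 0") (auto simp: jump_0 N_def)
    qed
  qed
  have jXp: "AE \<omega> in M. \<forall>t>0. jump Xp t \<omega> = 0"
  proof (rule predictable_no_jumps[OF adXp Xp(1) cXp N])
    fix T assume "predictable_time F T"
    from qlc[OF this] jX_eq
    show "AE \<omega> in M. T \<omega> < \<infinity> \<longrightarrow> jump Xp (enn2real (T \<omega>)) \<omega> = - jump N (enn2real (T \<omega>)) \<omega>"
      by eventually_elim auto
  qed
  have jNX: "AE \<omega> in M. \<forall>t>0. jump N t \<omega> = jump X t \<omega>"
    using jX_eq jXp by eventually_elim auto
  have jN: "AE \<omega> in M. \<forall>t>0. \<bar>jump N t \<omega>\<bar> \<le> c"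
    using jNX assms(5) by eventually_elim auto
  have jQ: "AE \<omega> in M. \<forall>t>0. jump Q t \<omega> = 0"
  proof (rule predictable_no_jumps[OF adQ Q(1) cQ L])
    fix T assume "predictable_time F T"
    from qlc[OF this] jNX cN cQ cL
    show "AE \<omega> in M. T \<omega> < \<infinity> \<longrightarrow> jump Q (enn2real (T \<omega>)) \<omega> =
        - jump (martingale_part (\<lambda>t \<omega>. (N t \<omega>)\<^sup>2) Q) (enn2real (T \<omega>)) \<omega>"
    proof eventually_elim
      case (elim \<omega>)
      show ?case
      proof
        assume fin: "T \<omega> < \<infinity>"
        show "jump Q (enn2real (T \<omega>)) \<omega> = - jump (martingale_part (\<lambda>t \<omega>. (N t \<omega>)\<^sup>2) Q) (enn2real (T \<omega>)) \<omega>"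
        proof (cases "enn2real (T \<omega>) = 0")
          case False
          then have pos: "0 < enn2real (T \<omega>)" by (simp add: less_le)
          have "jump N (enn2real (T \<omega>)) \<omega> = 0" using elim(1,2) fin pos by simp
          from jump_square_eq_0[where N = N and \<omega> = \<omega>, OF elim(3) pos this]
            jump_martingale_part[where X = "\<lambda>t \<omega>. (N t \<omega>)\<^sup>2" and A = Q and \<omega> = \<omega>, OF elim(5,4) pos]
          show ?thesis by simp
        qed (simp add: jump_0)
      qed
    qed
  qed
  define lam' where "lam' = \<epsilon> * lam"
  define K where "K = lam'\<^sup>2 / 2 * exp (\<bar>lam'\<bar> * c)"
  have K: "K = lam\<^sup>2 / 2 * exp (lam * c)"
    using assms(8,10) by (auto simp: K_def lam'_def)
  define W where "W = (\<lambda>t \<omega>. lam' * N t \<omega> - K * Q t \<omega>)"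
  let ?A = "{\<omega> \<in> space M. \<exists>t\<ge>0. \<epsilon> * (X t \<omega> - X 0 \<omega> - Xp t \<omega>) \<ge> a + lam * exp (lam * c) / 2 * Q t \<omega>}"
  have N0: "AE \<omega> in M. N 0 \<omega> = 0" using Xp(3) by eventually_elim (simp add: N_def martingale_part_def)
  (* The hitting time detects that b is exceeded, not that it is reached; hence the margin below lam a. *)
  have bound: "outer_measure_of M ?A \<le> ennreal (exp (- b))" if b: "b < lam * a" for b
  proof -
    define D where "D = {\<omega> \<in> space M. hitting_time W b \<omega> < \<infinity>}"
    have "stopping_time F (hitting_time W b)"
      using N adQ unfolding local_martingale_def
      by (intro stopping_time_hitting_time)
         (auto simp: W_def adapted_def intro!: borel_measurable_diff borel_measurable_times)
    then have [measurable]: "hitting_time W b \<in> borel_measurable M" by (rule stopping_time_measurable_M)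
    have D: "D \<in> sets M" unfolding D_def by measurable
    have le: "measure M D \<le> exp (- b)"
      unfolding D_def W_def
      by (rule exponential_maximal_inequality[OF N L N0 Q(3,2) jN _ jQ K_def]) (use assms(4) in simp)
    obtain Z where Z: "Z \<in> null_sets M" "{\<omega> \<in> space M. \<not> (cadlag (\<lambda>t. N t \<omega>) \<and> cadlag (\<lambda>t. Q t \<omega>))} \<subseteq> Z"
      using AE_conjI[OF cN cQ] by (auto simp: eventually_ae_filter)
    have sub: "?A \<subseteq> D \<union> Z"
    proof
      fix \<omega> assume "\<omega> \<in> ?A"
      then obtain t where \<omega>: "\<omega> \<in> space M" and t: "0 \<le> t"
        "a + lam * exp (lam * c) / 2 * Q t \<omega> \<le> \<epsilon> * N t \<omega>"
        by (auto simp: N_def martingale_part_def)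
      show "\<omega> \<in> D \<union> Z"
      proof (cases "cadlag (\<lambda>t. N t \<omega>) \<and> cadlag (\<lambda>t. Q t \<omega>)")
        case True
        have "lam * (a + lam * exp (lam * c) / 2 * Q t \<omega>) \<le> lam * (\<epsilon> * N t \<omega>)"
          using t(2) assms(8) by (intro mult_left_mono) auto
        then have "lam * a \<le> W t \<omega>"
          by (simp add: W_def K lam'_def power2_eq_square algebra_simps)
        then have "b < W t \<omega>" using b by simp
        moreover have "cadlag (\<lambda>t. W t \<omega>)" unfolding W_def using True by (intro cadlag_diff cadlag_cmult) auto
        ultimately have "hitting_time W b \<omega> \<le> ennreal t" using t(1) by (intro hitting_time_le)
        then show ?thesis using \<omega> by (simp add: D_def le_less_trans[OF _ ennreal_less_top])
      qed (use Z \<omega> in auto)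
    qed
    have "outer_measure_of M ?A \<le> outer_measure_of M (D \<union> Z)" by (rule outer_measure_of_mono[OF sub])
    also have "\<dots> = emeasure M (D \<union> Z)" using D Z(1) by (intro outer_measure_of_eq) auto
    also have "\<dots> = emeasure M D" by (rule emeasure_Un_null_set[OF D Z(1)])
    also have "\<dots> \<le> ennreal (exp (- b))" using le by (simp add: emeasure_eq_measure ennreal_leI)
    finally show ?thesis .
  qed
  have "(\<lambda>n. exp (- (lam * a - 1 / real (Suc n)))) \<longlonglongrightarrow> exp (- (lam * a - 0))"
    by (intro tendsto_exp tendsto_minus tendsto_diff tendsto_const tendsto_inverse_Suc)
  then have "(\<lambda>n. ennreal (exp (- (lam * a - 1 / real (Suc n))))) \<longlonglongrightarrow> ennreal (exp (- (lam * a - 0)))"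
    by (rule tendsto_ennrealI)
  then have "outer_measure_of M ?A \<le> ennreal (exp (- (lam * a - 0)))"
    by (rule LIMSEQ_le_const) (intro exI[of _ 0] allI impI bound, simp)
  then show ?thesis by simp
qed

end
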